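(* Let $X\in L^1(\mathbb{P}_0)$, let $\phi_1,\phi_2\in\Phi_0$ be lower-semicontinuous, and let $r>0$. Define $$\rho^{l}_{\mathrm{oce},\mathbb{P}_0}(X)=\sup_{\{\mathbb{Q}:\mathbb{Q}\ll \mathbb{P}_0\}}\ \sup_{\{\bar{\mathbb{Q}}:\bar{\mathbb{Q}}\ll \mathbb{Q}\}}\mathbb{E}_{\bar{\mathbb{Q}}}[-X]-I_{\phi_1}(\bar{\mathbb{Q}},\mathbb{Q})- I_{\phi_2}(\mathbb{Q},\mathbb{P}_0),\qquad (P_l)$$ $$\rho^{s}_{\mathrm{oce},\mathbb{P}_0}(X)=\sup_{\{\mathbb{Q}:I_{\phi_2}(\mathbb{Q},\mathbb{P}_0)\leq r\}}\ \sup_{\{\bar{\mathbb{Q}}:\bar{\mathbb{Q}}\ll \mathbb{Q}\}}\mathbb{E}_{\bar{\mathbb{Q}}}[-X]-I_{\phi_1}(\bar{\mathbb{Q}},\mathbb{Q}).\qquad (P_s)$$ Then $$\rho^{l}_{\mathrm{oce},\mathbb{P}_0}(X)=\inf_{\theta_1,\theta_2\in \mathbb{R}}\Big\{-\theta_1-\theta_2+\mathbb{E}_{\mathbb{P}_0}\left[\phi_2^*(\phi_1^*(\theta_2-X)+\theta_1)\right]\Big\},\qquad (D_l)$$ $$\rho^{s}_{\mathrm{oce},\mathbb{P}_0}(X)=\inf_{\lambda\geq 0,\ \theta_1,\theta_2\in\mathbb{R}}\Big\{-\theta_1-\theta_2+\lambda r+\mathbb{E}_{\mathbb{P}_0}\left[\lambda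 \phi_2^*\left(\frac{\phi_1^*(\theta_2-X)+\theta_1}{\lambda}\right)\right]\Big\}.\qquad (D_s)$$ Furthermore, for $\boldsymbol{\theta}=(\theta_1,\theta_2)$ put $\beta^*(\omega,\boldsymbol{\theta})=\phi_2^*(\phi_1^*(\theta_2-X(\omega))+\theta_1)$ and $\tilde{\beta}^*(\omega,\boldsymbol{\theta},\lambda)=\lambda \phi_2^*\left(\frac{\phi_1^*(\theta_2-X(\omega))+\theta_1}{\lambda}\right)$, and suppose that: (1) $\phi_1^*$ and $\phi_2^*$ are differentiable on $\mathbb{R}$; (2) each of the sets $\mathcal{F}=\{\boldsymbol{\theta}\in \mathbb{R}^2 : \int_\Omega \beta^*(\omega,\boldsymbol{\theta})\,\mathrm{d}\mathbb{P}_0(\omega)<\infty\}$ and $\tilde{\mathcal{F}}=\{(\boldsymbol{\theta},\lambda)\in \mathbb{R}^2\times [0,\infty) : \int_\Omega \tilde{\beta}^*(\omega,\boldsymbol{\theta},\lambda)\,\mathrm{d}\mathbb{P}_0(\omega)<\infty\}$ has non-empty interior. Then there exist dual solutions $\boldsymbol{\theta}^*$ and $(\tilde{\boldsymbol{\theta}}^*,\lambda^* )$ attaining the minimum in $(D_l)$ and $(D_s)$ respectively. Moreover, if $\boldsymbol{\theta}^*\in \mathrm{int}(\mathcal{F})$ and $(\tilde{\boldsymbol{\theta}}^*,\lambda^* )\in \mathrm{int}(\tilde{\mathcal{F}})$, then the partial derivatives with respect to $\boldsymbol{\theta}$, namely $(\partial_{\theta_1}\beta^*(\omega,\boldsymbol{\theta}^*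 ),\partial_{\theta_2}\beta^*(\omega,\boldsymbol{\theta}^* ))$, respectively $(\partial_{\theta_1}\tilde\beta^*(\omega,\tilde{\boldsymbol{\theta}}^*,\lambda^* ),\partial_{\theta_2}\tilde\beta^*(\omega,\tilde{\boldsymbol{\theta}}^*,\lambda^* ))$, are the densities with respect to $\mathbb{P}_0$ of measures $(\mathbb{Q}^*,\bar{\mathbb{Q}}^* )$ that attain the maximum in $(P_l)$, respectively $(P_s)$.
   Context: $\mathbb{P}_0$ is a given (nominal) probability measure on a measurable space $(\Omega,\mathcal{F})$; $\mathbb{Q},\bar{\mathbb{Q}}$ range over probability measures. $\Phi_0$ is the set of all convex functions $\phi:\mathbb{R}\to[0,\infty]$ with $\phi(1)=0$ whose effective domain $\mathrm{dom}(\phi)=\{t:\phi(t)<\infty\}$ is contained in $[0,\infty)$ and contains a neighborhood of $1$. The $\phi$-divergence is $I_\phi(\mathbb{Q},\mathbb{P})=\int_\Omega\phi\left(\frac{\mathrm{d}\mathbb{Q}}{\mathrm{d}\mathbb{P}}\right)\mathrm{d}\mathbb{P}$ if $\mathbb{Q}\ll\mathbb{P}$, and $+\infty$ otherwise. Conventions: $\phi(0)=\lim_{t\downarrow0}\phi(t)$, $0\phi(0/0)=0$, $0\phi(a/0)=a\lim_{t\to\infty}\phi(t)/t$ for $a>0$. $\phi^*(s)=\sup_{t\in\mathbb{R}}\{st-\phi(t)\}$ is the convex conjugate. Convention for $\lambda=0$: $0\phi^*(s/0)=0$ if $s\le0$ and $+\infty$ if $s>0$.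
   Formalization: Attainment in (D_s) is shown with the λ=0 term taken as the limit sup over t in dom φ₂ of st, and with the stated convention only if (0,∞)⊆dom φ₂ (it can fail otherwise); where E[-X] and the penalty are both +∞, their difference is read as one integral of the combined integrand. *)

theory Defs
  imports "HOL-Probability.Probability"
begin

definition effdom :: "(real \<Rightarrow> ennreal) \<Rightarrow> real set" where
  "effdom \<phi> = {t. \<phi> t < \<infinity>}"

definition convex_ext :: "(real \<Rightarrow> ennreal) \<Rightarrow> bool" where
  "convex_ext \<phi> \<longleftrightarrow>
     (\<forall>x y u. 0 \<le> u \<and> u \<le> 1 \<longrightarrow>
        \<phi> ((1 - u) * x + u * y) \<le> ennreal (1 - u) * \<phi> x + ennreal u * \<phi> y)"

definition lower_semicont :: "(real \<Rightarrow> ennreal) \<Rightarrow> bool" where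
  "lower_semicont \<phi> \<longleftrightarrow> (\<forall>x. \<phi> x \<le> Liminf (at x) \<phi>)"

text \<open>For a lower-semicontinuous member of \<open>Phi0\<close> the convention that \<open>\<phi> 0\<close> is the limit of
  \<open>\<phi>\<close> at \<open>0\<close> from the right holds automatically.\<close>

definition Phi0 :: "(real \<Rightarrow> ennreal) set" where
  "Phi0 = {\<phi>. convex_ext \<phi> \<and> \<phi> 1 = 0 \<and> effdom \<phi> \<subseteq> {0..} \<and> 1 \<in> interior (effdom \<phi>)}"

definition phi_div :: "(real \<Rightarrow> ennreal) \<Rightarrow> 'a measure \<Rightarrow> 'a measure \<Rightarrow> ennreal" where
  "phi_div \<phi> Q P =
     (if absolutely_continuous P Q then \<integral>\<^sup>+\<omega>. \<phi> (enn2real (RN_deriv P Q \<omega>)) \<partial>P else \<infinity>)"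

definition prob_on :: "'a measure \<Rightarrow> 'a measure set" where
  "prob_on P = {Q. prob_space Q \<and> sets Q = sets P}"

text \<open>In \<open>ereal\<close>, \<open>\<infinity> - \<infinity> = \<infinity>\<close>. The subtraction below takes the value \<open>-\<infinity>\<close> there.\<close>

definition ediff :: "ereal \<Rightarrow> ereal \<Rightarrow> ereal" where
  "ediff a b = (if b = \<infinity> then -\<infinity> else a - b)"

definition eexpect :: "'a measure \<Rightarrow> ('a \<Rightarrow> ereal) \<Rightarrow> ereal" where
  "eexpect M f = ediff (enn2ereal (\<integral>\<^sup>+\<omega>. e2ennreal (f \<omega>) \<partial>M))
                       (enn2ereal (\<integral>\<^sup>+\<omega>. e2ennreal (- f \<omega>) \<partial>M))"

definition conjugate :: "(real \<Rightarrow> ennreal) \<Rightarrow> real \<Rightarrow> ereal" where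
  "conjugate \<phi> s = (SUP t. ereal (s * t) - enn2ereal (\<phi> t))"

text \<open>The inner conjugate may take the value \<open>\<infinity>\<close> (never \<open>-\<infinity>\<close>), where the outer one is \<open>\<infinity>\<close>.\<close>

definition conjugate_ext :: "(real \<Rightarrow> ennreal) \<Rightarrow> ereal \<Rightarrow> ereal" where
  "conjugate_ext \<phi> u = (if u = \<infinity> then \<infinity> else conjugate \<phi> (real_of_ereal u))"

definition conjugate_persp :: "(real \<Rightarrow> ennreal) \<Rightarrow> real \<Rightarrow> ereal \<Rightarrow> ereal" where
  "conjugate_persp \<phi> lam u =
     (if lam = 0 then (if u \<le> 0 then 0 else \<infinity>)
      else ereal lam * conjugate_ext \<phi> (u / ereal lam))"

definition conjugate_differentiable :: "(real \<Rightarrow> ennreal) \<Rightarrow> bool" where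
  "conjugate_differentiable \<phi> \<longleftrightarrow>
     (\<forall>s. \<bar>conjugate \<phi> s\<bar> \<noteq> \<infinity>) \<and>
     (\<lambda>s. real_of_ereal (conjugate \<phi> s)) differentiable_on UNIV"


text \<open>The primal objectives are the literal differences, with one convention: if both the expected
  value and the penalty are \<open>\<infinity>\<close>, the difference is read as the integral of the combined
  integrand. With \<open>z = dQ/dP0\<close> and \<open>y = dQ'/dQ\<close> this integrand is
  \<open>- X z y - z \<phi>1(y) - \<phi>2(z)\<close>, respectively \<open>- X y - \<phi>1(y)\<close> with respect to \<open>Q\<close>. The case
  cannot be read as \<open>-\<infinity>\<close>: if \<open>\<phi>1(t) = t ln t - t + 1\<close> and \<open>\<phi>2(t) = (t - 1)^2\<close> on \<open>[0,2]\<close>, and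
  \<open>exp(-X)\<close> is integrable but \<open>X exp(-X)\<close> is not, then the optimal densities given by the dual
  solution fall under it.\<close>

definition primal_l ::
  "'a measure \<Rightarrow> (real \<Rightarrow> ennreal) \<Rightarrow> (real \<Rightarrow> ennreal) \<Rightarrow> ('a \<Rightarrow> real) \<Rightarrow>
   'a measure \<Rightarrow> 'a measure \<Rightarrow> ereal" where
  "primal_l P0 \<phi>1 \<phi>2 X Q Q' =
     (let e = eexpect Q' (\<lambda>\<omega>. ereal (- X \<omega>));
          p = enn2ereal (phi_div \<phi>1 Q' Q) + enn2ereal (phi_div \<phi>2 Q P0)
      in if e = \<infinity> \<and> p = \<infinity>
         then eexpect P0 (\<lambda>\<omega>.
                let z = enn2real (RN_deriv P0 Q \<omega>); y = enn2real (RN_deriv Q Q' \<omega>)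
                in ereal (- X \<omega> * (z * y)) - ereal z * enn2ereal (\<phi>1 y) - enn2ereal (\<phi>2 z))
         else ediff e p)"

definition primal_s ::
  "(real \<Rightarrow> ennreal) \<Rightarrow> ('a \<Rightarrow> real) \<Rightarrow> 'a measure \<Rightarrow> 'a measure \<Rightarrow> ereal" where
  "primal_s \<phi>1 X Q Q' =
     (let e = eexpect Q' (\<lambda>\<omega>. ereal (- X \<omega>));
          p = enn2ereal (phi_div \<phi>1 Q' Q)
      in if e = \<infinity> \<and> p = \<infinity>
         then eexpect Q (\<lambda>\<omega>.
                let y = enn2real (RN_deriv Q Q' \<omega>)
                in ereal (- X \<omega> * y) - enn2ereal (\<phi>1 y))
         else ediff e p)"

definition feasible_l :: "'a measure \<Rightarrow> 'a measure set" where
  "feasible_l P0 = {Q \<in> prob_on P0. absolutely_continuous P0 Q}"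

definition feasible_s :: "'a measure \<Rightarrow> (real \<Rightarrow> ennreal) \<Rightarrow> real \<Rightarrow> 'a measure set" where
  "feasible_s P0 \<phi>2 r = {Q \<in> prob_on P0. phi_div \<phi>2 Q P0 \<le> ennreal r}"

definition rho_l ::
  "'a measure \<Rightarrow> (real \<Rightarrow> ennreal) \<Rightarrow> (real \<Rightarrow> ennreal) \<Rightarrow> ('a \<Rightarrow> real) \<Rightarrow> ereal" where
  "rho_l P0 \<phi>1 \<phi>2 X =
     (SUP Q \<in> feasible_l P0. SUP Q' \<in> feasible_l Q. primal_l P0 \<phi>1 \<phi>2 X Q Q')"

definition rho_s ::
  "'a measure \<Rightarrow> (real \<Rightarrow> ennreal) \<Rightarrow> (real \<Rightarrow> ennreal) \<Rightarrow> real \<Rightarrow> ('a \<Rightarrow> real) \<Rightarrow> ereal" where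
  "rho_s P0 \<phi>1 \<phi>2 r X =
     (SUP Q \<in> feasible_s P0 \<phi>2 r. SUP Q' \<in> feasible_l Q. primal_s \<phi>1 X Q Q')"


definition beta_l ::
  "(real \<Rightarrow> ennreal) \<Rightarrow> (real \<Rightarrow> ennreal) \<Rightarrow> ('a \<Rightarrow> real) \<Rightarrow> 'a \<Rightarrow> real \<times> real \<Rightarrow> ereal" where
  "beta_l \<phi>1 \<phi>2 X \<omega> = (\<lambda>(\<theta>1, \<theta>2).
     conjugate_ext \<phi>2 (conjugate \<phi>1 (\<theta>2 - X \<omega>) + ereal \<theta>1))"

definition beta_s ::
  "(real \<Rightarrow> ennreal) \<Rightarrow> (real \<Rightarrow> ennreal) \<Rightarrow> ('a \<Rightarrow> real) \<Rightarrow> 'a \<Rightarrow> (real \<times> real) \<times> real \<Rightarrow> ereal" where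
  "beta_s \<phi>1 \<phi>2 X \<omega> = (\<lambda>((\<theta>1, \<theta>2), lam).
     conjugate_persp \<phi>2 lam (conjugate \<phi>1 (\<theta>2 - X \<omega>) + ereal \<theta>1))"

definition dual_l ::
  "'a measure \<Rightarrow> (real \<Rightarrow> ennreal) \<Rightarrow> (real \<Rightarrow> ennreal) \<Rightarrow> ('a \<Rightarrow> real) \<Rightarrow> real \<times> real \<Rightarrow> ereal" where
  "dual_l P0 \<phi>1 \<phi>2 X = (\<lambda>(\<theta>1, \<theta>2).
     ereal (- \<theta>1 - \<theta>2) + eexpect P0 (\<lambda>\<omega>. beta_l \<phi>1 \<phi>2 X \<omega> (\<theta>1, \<theta>2)))"

definition dual_s ::
  "'a measure \<Rightarrow> (real \<Rightarrow> ennreal) \<Rightarrow> (real \<Rightarrow> ennreal) \<Rightarrow> real \<Rightarrow> ('a \<Rightarrow> real) \<Rightarrow>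
   (real \<times> real) \<times> real \<Rightarrow> ereal" where
  "dual_s P0 \<phi>1 \<phi>2 r X = (\<lambda>((\<theta>1, \<theta>2), lam).
     ereal (- \<theta>1 - \<theta>2 + lam * r) + eexpect P0 (\<lambda>\<omega>. beta_s \<phi>1 \<phi>2 X \<omega> ((\<theta>1, \<theta>2), lam)))"

definition finite_l ::
  "'a measure \<Rightarrow> (real \<Rightarrow> ennreal) \<Rightarrow> (real \<Rightarrow> ennreal) \<Rightarrow> ('a \<Rightarrow> real) \<Rightarrow> (real \<times> real) set" where
  "finite_l P0 \<phi>1 \<phi>2 X = {\<theta>. eexpect P0 (\<lambda>\<omega>. beta_l \<phi>1 \<phi>2 X \<omega> \<theta>) < \<infinity>}"

definition finite_s ::
  "'a measure \<Rightarrow> (real \<Rightarrow> ennreal) \<Rightarrow> (real \<Rightarrow> ennreal) \<Rightarrow> ('a \<Rightarrow> real) \<Rightarrow>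
   ((real \<times> real) \<times> real) set" where
  "finite_s P0 \<phi>1 \<phi>2 X =
     {(\<theta>, lam). 0 \<le> lam \<and> eexpect P0 (\<lambda>\<omega>. beta_s \<phi>1 \<phi>2 X \<omega> (\<theta>, lam)) < \<infinity>}"

text \<open>The limit of \<open>lam \<phi>\<^sup>*(u/lam)\<close> for \<open>lam\<close> tending to \<open>0\<close> from the right is the supremum of \<open>u t\<close>
  over the effective domain of \<open>\<phi>\<close>. It agrees with the convention in \<open>conjugate_persp\<close> if and
  only if that domain contains \<open>{0<..}\<close>. Otherwise \<open>dual_s\<close> is too large at \<open>lam = 0\<close>, which
  leaves its infimum unchanged but can destroy attainment. Example: \<open>\<phi>1 = \<phi>2 = \<phi>\<close> with
  \<open>\<phi>(t) = (t - 1)^2\<close> on \<open>[1/2, 3/2]\<close>, \<open>r = 1\<close>, and \<open>X = 4, -4\<close> with probability \<open>1/2\<close> each.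
  Since \<open>\<phi> \<le> 1/4\<close> on its domain, halving \<open>lam > 0\<close> lowers \<open>dual_s\<close> by at least \<open>3/8 lam\<close>, so no
  minimizer has \<open>lam > 0\<close>; at \<open>lam = 0\<close> all values are at least \<open>4\<close>, while the value at
  \<open>\<theta>1 = -23/4\<close>, \<open>\<theta>2 = 0\<close>, \<open>lam = 1/10\<close> is below \<open>4\<close>. Existence for arbitrary \<open>\<phi>2\<close> is
  therefore stated with \<open>dual_s_closed\<close>, which differs from \<open>dual_s\<close> only at \<open>lam = 0\<close>.\<close>

definition beta_s_closed ::
  "(real \<Rightarrow> ennreal) \<Rightarrow> (real \<Rightarrow> ennreal) \<Rightarrow> ('a \<Rightarrow> real) \<Rightarrow> 'a \<Rightarrow> (real \<times> real) \<times> real \<Rightarrow> ereal" where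
  "beta_s_closed \<phi>1 \<phi>2 X \<omega> = (\<lambda>((\<theta>1, \<theta>2), lam).
     if lam = 0 then (SUP t \<in> effdom \<phi>2. (conjugate \<phi>1 (\<theta>2 - X \<omega>) + ereal \<theta>1) * ereal t)
     else beta_s \<phi>1 \<phi>2 X \<omega> ((\<theta>1, \<theta>2), lam))"

definition dual_s_closed ::
  "'a measure \<Rightarrow> (real \<Rightarrow> ennreal) \<Rightarrow> (real \<Rightarrow> ennreal) \<Rightarrow> real \<Rightarrow> ('a \<Rightarrow> real) \<Rightarrow>
   (real \<times> real) \<times> real \<Rightarrow> ereal" where
  "dual_s_closed P0 \<phi>1 \<phi>2 r X = (\<lambda>((\<theta>1, \<theta>2), lam).
     ereal (- \<theta>1 - \<theta>2 + lam * r) + eexpect P0 (\<lambda>\<omega>. beta_s_closed \<phi>1 \<phi>2 X \<omega> ((\<theta>1, \<theta>2), lam)))"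

definition is_density :: "'a measure \<Rightarrow> 'a measure \<Rightarrow> ('a \<Rightarrow> real) \<Rightarrow> bool" where
  "is_density P Q z \<longleftrightarrow>
     z \<in> borel_measurable P \<and> (\<forall>\<omega>\<in>space P. 0 \<le> z \<omega>) \<and> Q = density P (\<lambda>\<omega>. ennreal (z \<omega>))"

end

theory Submission
  imports Defs
begin

text \<open>With \<open>z = dQ/dP0\<close>, \<open>y = dQ'/dQ\<close> and \<open>w = z y\<close>, both primal problems maximize a concave functional
  of \<open>(z, w)\<close> under the linear constraints \<open>E z = E w = 1\<close> and, in \<open>(P_s)\<close>, the convex constraint
  \<open>E \<phi>2(z) \<le> r\<close>. The constant pair \<open>(1, 1)\<close> is a Slater point, so the finite-dimensional
  value function has a supergradient at the constraint levels; its entries are \<open>\<theta>1, \<theta>2\<close> and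
  \<open>- lam\<close>. The resulting Lagrangian is maximized pointwise: a supremum of a concave function is one over
  countably many points, finitely many of them can be selected by simple functions, and monotone
  convergence interchanges supremum and expectation. This gives strong duality together with a dual
  solution, without the smoothness assumptions. Without a binding cost, the same argument treats \<open>(P_l)\<close>.

  At an interior dual solution the first order conditions in \<open>\<theta>1\<close>, \<open>\<theta>2\<close> and \<open>lam\<close> may be taken under
  the expectation by convexity, and read \<open>E z = 1\<close>, \<open>E w = 1\<close> and \<open>E \<phi>2(z) = r\<close> for the partial
  derivatives \<open>z, w\<close>. Equality in the Fenchel-Young inequality then makes \<open>(z, w)\<close> attain the dual value.\<close>

section \<open>Expectations in the extended reals\<close>

lemma ediff_mono: "a \<le> a' \<Longrightarrow> b' \<le> b \<Longrightarrow> ediff a b \<le> ediff a' b'"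
  by (auto simp: ediff_def intro: ereal_minus_mono)

lemma eexpect_cong_AE:
  assumes "AE \<omega> in M. f \<omega> = g \<omega>"
  shows "eexpect M f = eexpect M g"
proof -
  have "(\<integral>\<^sup>+\<omega>. e2ennreal (f \<omega>) \<partial>M) = (\<integral>\<^sup>+\<omega>. e2ennreal (g \<omega>) \<partial>M)"
    and "(\<integral>\<^sup>+\<omega>. e2ennreal (- f \<omega>) \<partial>M) = (\<integral>\<^sup>+\<omega>. e2ennreal (- g \<omega>) \<partial>M)"
    using assms by (auto intro!: nn_integral_cong_AE)
  then show ?thesis by (simp add: eexpect_def)
qed

lemma eexpect_mono_AE:
  assumes "AE \<omega> in M. f \<omega> \<le> g \<omega>"
  shows "eexpect M f \<le> eexpect M g"
proof -
  have "(\<integral>\<^sup>+\<omega>. e2ennreal (f \<omega>) \<partial>M) \<le> (\<integral>\<^sup>+\<omega>. e2ennreal (g \<omega>) \<partial>M)"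
    and "(\<integral>\<^sup>+\<omega>. e2ennreal (- g \<omega>) \<partial>M) \<le> (\<integral>\<^sup>+\<omega>. e2ennreal (- f \<omega>) \<partial>M)"
    using assms by (auto intro!: nn_integral_mono_AE e2ennreal_mono)
  then show ?thesis by (simp add: eexpect_def ediff_mono less_eq_ennreal.rep_eq)
qed

lemma eexpect_eq_MInf: "(\<integral>\<^sup>+\<omega>. e2ennreal (- f \<omega>) \<partial>M) = \<infinity> \<Longrightarrow> eexpect M f = - \<infinity>"
  by (simp add: eexpect_def ediff_def)

lemma integrable_parts_finite:
  fixes g :: "'a \<Rightarrow> real"
  assumes "integrable M g"
  obtains p n where "0 \<le> p" "0 \<le> n" "(\<integral>\<^sup>+\<omega>. ennreal (g \<omega>) \<partial>M) = ennreal p"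
    "(\<integral>\<^sup>+\<omega>. ennreal (- g \<omega>) \<partial>M) = ennreal n" "(\<integral>\<omega>. g \<omega> \<partial>M) = p - n"
proof -
  have "(\<integral>\<^sup>+\<omega>. ennreal (g \<omega>) \<partial>M) < top" "(\<integral>\<^sup>+\<omega>. ennreal (- g \<omega>) \<partial>M) < top"
    using assms by (auto simp: real_integrable_def less_top)
  then show thesis
    by (intro that[of "enn2real (\<integral>\<^sup>+\<omega>. ennreal (g \<omega>) \<partial>M)" "enn2real (\<integral>\<^sup>+\<omega>. ennreal (- g \<omega>) \<partial>M)"])
      (simp_all add: real_lebesgue_integral_def[OF assms])
qed

lemma eexpect_ereal:
  fixes g :: "'a \<Rightarrow> real"
  assumes "integrable M g"
  shows "eexpect M (\<lambda>\<omega>. ereal (g \<omega>)) = ereal (\<integral>\<omega>. g \<omega> \<partial>M)"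
proof -
  obtain p n where "0 \<le> p" "0 \<le> n" "(\<integral>\<^sup>+\<omega>. ennreal (g \<omega>) \<partial>M) = ennreal p"
    "(\<integral>\<^sup>+\<omega>. ennreal (- g \<omega>) \<partial>M) = ennreal n" "(\<integral>\<omega>. g \<omega> \<partial>M) = p - n"
    using assms by (rule integrable_parts_finite)
  then show ?thesis by (simp add: eexpect_def ediff_def)
qed

lemma integrable_of_eexpect_finite:
  fixes g :: "'a \<Rightarrow> real"
  assumes "g \<in> borel_measurable M" and "\<bar>eexpect M (\<lambda>\<omega>. ereal (g \<omega>))\<bar> \<noteq> \<infinity>"
  shows "integrable M g"
  using assms by (cases "\<integral>\<^sup>+\<omega>. ennreal (- g \<omega>) \<partial>M") (auto simp: real_integrable_def eexpect_def ediff_def)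

text \<open>Integrating \<open>f\<^sup>+ + v = f\<^sup>- + u\<close> for \<open>f = u - v\<close> avoids the subtraction of infinite integrals.\<close>

lemma eexpect_ediff:
  fixes u v :: "'a \<Rightarrow> ennreal"
  assumes [measurable]: "u \<in> borel_measurable M" "v \<in> borel_measurable M"
    and not_both_infinite: "(\<integral>\<^sup>+\<omega>. u \<omega> \<partial>M) \<noteq> \<infinity> \<or> (\<integral>\<^sup>+\<omega>. v \<omega> \<partial>M) \<noteq> \<infinity>"
  shows "eexpect M (\<lambda>\<omega>. ediff (enn2ereal (u \<omega>)) (enn2ereal (v \<omega>)))
    = ediff (enn2ereal (\<integral>\<^sup>+\<omega>. u \<omega> \<partial>M)) (enn2ereal (\<integral>\<^sup>+\<omega>. v \<omega> \<partial>M))"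
proof -
  define pos neg where "pos \<omega> = e2ennreal (ediff (enn2ereal (u \<omega>)) (enn2ereal (v \<omega>)))"
    and "neg \<omega> = e2ennreal (- ediff (enn2ereal (u \<omega>)) (enn2ereal (v \<omega>)))" for \<omega>
  have [measurable]: "pos \<in> borel_measurable M" "neg \<in> borel_measurable M"
    unfolding pos_def neg_def ediff_def by measurable
  have "ennreal (a - b) + ennreal b = ennreal (b - a) + ennreal a" if "0 \<le> a" "0 \<le> b" for a b
    using that by (cases "a \<le> b") (simp_all add: ennreal_neg flip: ennreal_plus)
  then have balance: "pos \<omega> + v \<omega> = neg \<omega> + u \<omega>" for \<omega>
    by (cases "u \<omega>"; cases "v \<omega>") (simp_all add: pos_def neg_def ediff_def)
  have parts_le: "pos \<omega> \<le> u \<omega>" "neg \<omega> \<le> v \<omega>" for \<omega>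
    by (cases "u \<omega>"; cases "v \<omega>", simp_all add: pos_def neg_def ediff_def ennreal_leI e2ennreal_neg)+
  have "(\<integral>\<^sup>+\<omega>. pos \<omega> + v \<omega> \<partial>M) = (\<integral>\<^sup>+\<omega>. neg \<omega> + u \<omega> \<partial>M)" by (simp only: balance)
  then have "(\<integral>\<^sup>+\<omega>. pos \<omega> \<partial>M) + (\<integral>\<^sup>+\<omega>. v \<omega> \<partial>M) = (\<integral>\<^sup>+\<omega>. neg \<omega> \<partial>M) + (\<integral>\<^sup>+\<omega>. u \<omega> \<partial>M)"
    by (simp add: nn_integral_add)
  moreover have "(\<integral>\<^sup>+\<omega>. pos \<omega> \<partial>M) \<le> (\<integral>\<^sup>+\<omega>. u \<omega> \<partial>M)" "(\<integral>\<^sup>+\<omega>. neg \<omega> \<partial>M) \<le> (\<integral>\<^sup>+\<omega>. v \<omega> \<partial>M)"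
    by (intro nn_integral_mono parts_le)+
  moreover have "ediff (enn2ereal P) (enn2ereal N) = ediff (enn2ereal a) (enn2ereal b)"
    if "P + b = N + a" "P \<le> a" "N \<le> b" "a \<noteq> \<infinity> \<or> b \<noteq> \<infinity>" for P N a b
    using that by (cases P; cases N; cases a; cases b) (auto simp: ediff_def top_unique simp flip: ennreal_plus)
  ultimately show ?thesis using not_both_infinite by (simp add: eexpect_def flip: pos_def neg_def)
qed

lemma eexpect_add_integrable:
  fixes g :: "'a \<Rightarrow> real"
  assumes [measurable]: "f \<in> borel_measurable M" and integrable_g: "integrable M g"
  shows "eexpect M (\<lambda>\<omega>. f \<omega> + ereal (g \<omega>)) = eexpect M f + ereal (\<integral>\<omega>. g \<omega> \<partial>M)"
proof -
  have [measurable]: "g \<in> borel_measurable M" using integrable_g by auto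
  obtain p n where integral_parts: "0 \<le> p" "0 \<le> n" "(\<integral>\<^sup>+\<omega>. ennreal (g \<omega>) \<partial>M) = ennreal p"
    "(\<integral>\<^sup>+\<omega>. ennreal (- g \<omega>) \<partial>M) = ennreal n" "(\<integral>\<omega>. g \<omega> \<partial>M) = p - n"
    using integrable_g by (rule integrable_parts_finite)
  define P N where "P = (\<integral>\<^sup>+\<omega>. e2ennreal (f \<omega>) \<partial>M)" and "N = (\<integral>\<^sup>+\<omega>. e2ennreal (- f \<omega>) \<partial>M)"
  have eexpect_f: "eexpect M f = ediff (enn2ereal P) (enn2ereal N)" by (simp add: eexpect_def P_def N_def)
  show ?thesis
  proof (cases "N = \<infinity>")
    case True
    have "e2ennreal (- a) \<le> e2ennreal (- (a + ereal b)) + ennreal b" for a b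
      by (cases a; cases "0 \<le> a"; cases "0 \<le> b"; cases "0 \<le> a + b")
        (auto simp: ennreal_neg ennreal_leI e2ennreal_neg simp flip: ennreal_plus)
    then have "N \<le> (\<integral>\<^sup>+\<omega>. e2ennreal (- (f \<omega> + ereal (g \<omega>))) + ennreal (g \<omega>) \<partial>M)"
      unfolding N_def by (intro nn_integral_mono)
    also have "\<dots> = (\<integral>\<^sup>+\<omega>. e2ennreal (- (f \<omega> + ereal (g \<omega>))) \<partial>M) + ennreal p"
      by (simp add: nn_integral_add integral_parts)
    finally have "eexpect M (\<lambda>\<omega>. f \<omega> + ereal (g \<omega>)) = - \<infinity>"
      using True by (intro eexpect_eq_MInf) (simp add: top_unique)
    then show ?thesis using True by (simp add: eexpect_f ediff_def)
  next
    case False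
    have "a + ereal b
      = ediff (enn2ereal (e2ennreal a + ennreal b)) (enn2ereal (e2ennreal (- a) + ennreal (- b)))"
      for a b
      by (cases a; cases "0 \<le> a"; cases "0 \<le> b")
        (auto simp: ediff_def ennreal_neg e2ennreal_neg zero_ennreal.rep_eq simp flip: ennreal_plus)
    then have "eexpect M (\<lambda>\<omega>. f \<omega> + ereal (g \<omega>))
        = ediff (enn2ereal (P + ennreal p)) (enn2ereal (N + ennreal n))"
      using False eexpect_ediff[of "\<lambda>\<omega>. e2ennreal (f \<omega>) + ennreal (g \<omega>)" M
          "\<lambda>\<omega>. e2ennreal (- f \<omega>) + ennreal (- g \<omega>)"]
      by (simp add: nn_integral_add integral_parts P_def N_def)
    also have "\<dots> = ediff (enn2ereal P) (enn2ereal N) + ereal (p - n)"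
      using False integral_parts(1,2) by (cases P; cases N) (auto simp: ediff_def simp flip: ennreal_plus)
    finally show ?thesis by (simp add: eexpect_f integral_parts)
  qed
qed

lemma eexpect_diff_ennreal:
  fixes g :: "'a \<Rightarrow> real" and p :: "'a \<Rightarrow> ennreal"
  assumes [measurable]: "g \<in> borel_measurable M" "p \<in> borel_measurable M"
    and not_both_infinite: "eexpect M (\<lambda>\<omega>. ereal (g \<omega>)) \<noteq> \<infinity> \<or> (\<integral>\<^sup>+\<omega>. p \<omega> \<partial>M) \<noteq> \<infinity>"
  shows "eexpect M (\<lambda>\<omega>. ereal (g \<omega>) - enn2ereal (p \<omega>))
    = ediff (eexpect M (\<lambda>\<omega>. ereal (g \<omega>))) (enn2ereal (\<integral>\<^sup>+\<omega>. p \<omega> \<partial>M))"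
proof -
  define P N where "P = (\<integral>\<^sup>+\<omega>. ennreal (g \<omega>) \<partial>M)" and "N = (\<integral>\<^sup>+\<omega>. ennreal (- g \<omega>) \<partial>M)"
  have eexpect_g: "eexpect M (\<lambda>\<omega>. ereal (g \<omega>)) = ediff (enn2ereal P) (enn2ereal N)"
    by (simp add: eexpect_def P_def N_def)
  show ?thesis
  proof (cases "N = \<infinity>")
    case True
    have "ennreal (- a) \<le> e2ennreal (- (ereal a - enn2ereal b))" for a b
      by (cases b) (auto simp: ennreal_leI)
    then have "N \<le> (\<integral>\<^sup>+\<omega>. e2ennreal (- (ereal (g \<omega>) - enn2ereal (p \<omega>))) \<partial>M)"
      unfolding N_def by (intro nn_integral_mono)
    then have "eexpect M (\<lambda>\<omega>. ereal (g \<omega>) - enn2ereal (p \<omega>)) = - \<infinity>"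
      using True by (intro eexpect_eq_MInf) (simp add: top_unique)
    then show ?thesis using True by (cases "\<integral>\<^sup>+\<omega>. p \<omega> \<partial>M") (simp_all add: eexpect_g ediff_def)
  next
    case False
    have "ereal a - enn2ereal b = ediff (enn2ereal (ennreal a)) (enn2ereal (ennreal (- a) + b))" for a b
      by (cases b; cases "0 \<le> a") (auto simp: ediff_def ennreal_neg zero_ennreal.rep_eq simp flip: ennreal_plus)
    moreover have "P \<noteq> \<infinity> \<or> N + (\<integral>\<^sup>+\<omega>. p \<omega> \<partial>M) \<noteq> \<infinity>"
      using not_both_infinite False by (auto simp: eexpect_g ediff_def)
    ultimately have "eexpect M (\<lambda>\<omega>. ereal (g \<omega>) - enn2ereal (p \<omega>))
        = ediff (enn2ereal P) (enn2ereal (N + (\<integral>\<^sup>+\<omega>. p \<omega> \<partial>M)))"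
      using eexpect_ediff[of "\<lambda>\<omega>. ennreal (g \<omega>)" M "\<lambda>\<omega>. ennreal (- g \<omega>) + p \<omega>"]
      by (simp add: nn_integral_add P_def N_def)
    also have "\<dots> = ediff (ediff (enn2ereal P) (enn2ereal N)) (enn2ereal (\<integral>\<^sup>+\<omega>. p \<omega> \<partial>M))"
      using False by (cases P; cases N; cases "\<integral>\<^sup>+\<omega>. p \<omega> \<partial>M") (auto simp: ediff_def simp flip: ennreal_plus)
    finally show ?thesis by (simp add: eexpect_g)
  qed
qed

lemma e2ennreal_ereal_mult: "0 \<le> a \<Longrightarrow> e2ennreal (ereal a * u) = ennreal a * e2ennreal u"
  by (cases u; cases "a = 0"; cases "0 \<le> u")
    (auto simp: ennreal_neg ennreal_mult' e2ennreal_neg ennreal_mult_top mult_le_0_iff)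

lemma eexpect_density:
  fixes z :: "'a \<Rightarrow> real"
  assumes [measurable]: "z \<in> borel_measurable M" "f \<in> borel_measurable M"
    and nonneg: "\<And>\<omega>. 0 \<le> z \<omega>"
  shows "eexpect (density M (\<lambda>\<omega>. ennreal (z \<omega>))) f = eexpect M (\<lambda>\<omega>. ereal (z \<omega>) * f \<omega>)"
proof -
  have "e2ennreal (- (ereal (z \<omega>) * f \<omega>)) = ennreal (z \<omega>) * e2ennreal (- f \<omega>)" for \<omega>
    using e2ennreal_ereal_mult[OF nonneg, of \<omega> "- f \<omega>"] by simp
  then show ?thesis by (simp add: eexpect_def nn_integral_density e2ennreal_ereal_mult nonneg)
qed

lemma eexpect_SUP_incseq_le:
  fixes g :: "nat \<Rightarrow> 'a \<Rightarrow> real"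
  assumes integrable_g: "\<And>n. integrable M (g n)" and incseq_g: "\<And>\<omega>. incseq (\<lambda>n. g n \<omega>)"
    and bound: "\<And>n. (\<integral>\<omega>. g n \<omega> \<partial>M) \<le> V"
  shows "eexpect M (\<lambda>\<omega>. SUP n. ereal (g n \<omega>)) \<le> ereal V"
proof -
  define d where "d n \<omega> = g n \<omega> - g 0 \<omega>" for n \<omega>
  have increments: "integrable M (d n)" "0 \<le> d n \<omega>" "incseq (\<lambda>n. d n \<omega>)" for n \<omega>
    using integrable_g incseq_g[of \<omega>] by (auto simp: d_def[abs_def] incseq_def)
  note [measurable] = borel_measurable_integrable[OF increments(1)]
  have SUP_d: "(SUP n. ereal (g n \<omega>)) = (SUP n. ereal (d n \<omega>)) + ereal (g 0 \<omega>)" for \<omega>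
    by (subst SUP_ereal_add_left[symmetric]) (auto simp: d_def)
  have "e2ennreal (SUP n. ereal (d n \<omega>)) = (SUP n. ennreal (d n \<omega>))" for \<omega>
    using sup_continuousD[OF sup_continuous_e2ennreal[OF sup_continuous_id], of "\<lambda>n. ereal (d n \<omega>)"]
      increments(3)[of \<omega>]
    by (simp add: incseq_def)
  then have "(\<integral>\<^sup>+\<omega>. e2ennreal (SUP n. ereal (d n \<omega>)) \<partial>M) = (SUP n. \<integral>\<^sup>+\<omega>. ennreal (d n \<omega>) \<partial>M)"
    using increments(3) by (simp, intro nn_integral_monotone_convergence_SUP)
      (auto simp: incseq_def le_fun_def ennreal_leI)
  also have "\<dots> \<le> ennreal (V - (\<integral>\<omega>. g 0 \<omega> \<partial>M))"
    using integrable_g bound increments(1,2)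
    by (intro SUP_least) (subst nn_integral_eq_integral, auto simp: d_def[abs_def] intro!: ennreal_leI)
  finally have "eexpect M (\<lambda>\<omega>. SUP n. ereal (d n \<omega>)) \<le> ediff (ereal (V - (\<integral>\<omega>. g 0 \<omega> \<partial>M))) 0"
    unfolding eexpect_def using bound[of 0]
    by (intro ediff_mono) (simp_all add: less_eq_ennreal.rep_eq)
  then have "eexpect M (\<lambda>\<omega>. SUP n. ereal (d n \<omega>)) + ereal (\<integral>\<omega>. g 0 \<omega> \<partial>M) \<le> ereal V"
    by (cases "eexpect M (\<lambda>\<omega>. SUP n. ereal (d n \<omega>))") (auto simp: ediff_def)
  then show ?thesis unfolding SUP_d by (simp add: eexpect_add_integrable integrable_g)
qed

lemma integrable_simple_function_compose:
  fixes \<Psi> :: "'b \<Rightarrow> 'a \<Rightarrow> real"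
  assumes simple_s: "simple_function M s" and integrable_Psi: "\<And>b. b \<in> s ` space M \<Longrightarrow> integrable M (\<Psi> b)"
  shows "integrable M (\<lambda>\<omega>. \<Psi> (s \<omega>) \<omega>)"
proof -
  have "integrable M (\<lambda>\<omega>. \<Sum>b\<in>s ` space M. indicator (s -` {b} \<inter> space M) \<omega> *\<^sub>R \<Psi> b \<omega>)"
    using simple_functionD(2)[OF simple_s] integrable_Psi
    by (intro Bochner_Integration.integrable_sum integrable_mult_indicator)
  moreover have "(\<Sum>b\<in>s ` space M. indicator (s -` {b} \<inter> space M) \<omega> *\<^sub>R \<Psi> b \<omega>) = \<Psi> (s \<omega>) \<omega>"
    if "\<omega> \<in> space M" for \<omega>
  proof -
    have "(\<Sum>b\<in>s ` space M. indicator (s -` {b} \<inter> space M) \<omega> *\<^sub>R \<Psi> b \<omega>)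
        = (\<Sum>b\<in>s ` space M. if b = s \<omega> then \<Psi> b \<omega> else 0)"
      using that by (intro sum.cong) (auto simp: indicator_def)
    then show ?thesis using simple_functionD(1)[OF simple_s] that by simp
  qed
  ultimately show ?thesis by (simp cong: Bochner_Integration.integrable_cong)
qed

lemma SUP_countable_simple_selectors:
  fixes \<Psi> :: "'b \<Rightarrow> 'a \<Rightarrow> real"
  assumes countable_C: "countable C" "C \<noteq> {}" and integrable_Psi: "\<And>b. b \<in> C \<Longrightarrow> integrable M (\<Psi> b)"
  obtains s :: "nat \<Rightarrow> 'a \<Rightarrow> 'b" where "\<And>n. simple_function M (s n)" "\<And>n \<omega>. s n \<omega> \<in> C"
    "\<And>\<omega>. incseq (\<lambda>n. \<Psi> (s n \<omega>) \<omega>)" "\<And>\<omega>. (SUP b\<in>C. ereal (\<Psi> b \<omega>)) = (SUP n. ereal (\<Psi> (s n \<omega>) \<omega>))"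
proof -
  define e where "e = from_nat_into C"
  have e_in_C: "e n \<in> C" for n using countable_C by (auto simp: e_def intro!: from_nat_into)
  define s where "s = rec_nat (\<lambda>\<omega>. e 0) (\<lambda>n s \<omega>. if \<Psi> (s \<omega>) \<omega> < \<Psi> (e n) \<omega> then e n else s \<omega>)"
  have s_0: "s 0 = (\<lambda>\<omega>. e 0)"
    and s_Suc: "s (Suc n) = (\<lambda>\<omega>. if \<Psi> (s n \<omega>) \<omega> < \<Psi> (e n) \<omega> then e n else s n \<omega>)" for n
    unfolding s_def by simp_all
  have running_max: "\<Psi> (s (Suc n) \<omega>) \<omega> = max (\<Psi> (s n \<omega>) \<omega>) (\<Psi> (e n) \<omega>)" for n \<omega>
    by (auto simp: s_Suc max_def)
  have s_in_C: "s n \<omega> \<in> C" for n \<omega>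
    by (induction n) (auto simp: s_0 s_Suc e_in_C)
  have simple_s: "simple_function M (s n)" for n
  proof (induction n)
    case (Suc n)
    have [measurable]: "\<Psi> (e n) \<in> borel_measurable M" "(\<lambda>\<omega>. \<Psi> (s n \<omega>) \<omega>) \<in> borel_measurable M"
      using integrable_Psi e_in_C s_in_C integrable_simple_function_compose[OF Suc, of \<Psi>] by auto
    have "{\<omega> \<in> space M. \<Psi> (s n \<omega>) \<omega> < \<Psi> (e n) \<omega>} \<in> sets M" by measurable
    then show ?case unfolding s_Suc using Suc by (intro simple_function_If) auto
  qed (simp add: s_0)
  have incseq_Psi: "incseq (\<lambda>n. \<Psi> (s n \<omega>) \<omega>)" for \<omega>
    by (rule incseq_SucI) (simp add: running_max)
  have SUP_eq: "(SUP b\<in>C. ereal (\<Psi> b \<omega>)) = (SUP n. ereal (\<Psi> (s n \<omega>) \<omega>))" for \<omega>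
  proof (rule antisym)
    show "(SUP b\<in>C. ereal (\<Psi> b \<omega>)) \<le> (SUP n. ereal (\<Psi> (s n \<omega>) \<omega>))"
    proof (rule SUP_least)
      fix b assume "b \<in> C"
      then obtain n where "b = e n" using countable_C(1) by (metis e_def from_nat_into_surj)
      then show "ereal (\<Psi> b \<omega>) \<le> (SUP n. ereal (\<Psi> (s n \<omega>) \<omega>))"
        by (intro SUP_upper2[of "Suc n"]) (auto simp: running_max)
    qed
  qed (use s_in_C in \<open>auto intro!: SUP_mono\<close>)
  show thesis by (rule that[OF simple_s s_in_C incseq_Psi SUP_eq])
qed

lemma eexpect_SUP_le_of_simple_selectors:
  fixes \<Psi> :: "'b \<Rightarrow> 'a \<Rightarrow> real"
  assumes countable_C: "countable C" "C \<noteq> {}" and integrable_Psi: "\<And>b. b \<in> C \<Longrightarrow> integrable M (\<Psi> b)"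
    and bound: "\<And>s. simple_function M s \<Longrightarrow> (\<And>\<omega>. s \<omega> \<in> C) \<Longrightarrow> (\<integral>\<omega>. \<Psi> (s \<omega>) \<omega> \<partial>M) \<le> V"
  shows "eexpect M (\<lambda>\<omega>. SUP b\<in>C. ereal (\<Psi> b \<omega>)) \<le> ereal V"
proof (rule SUP_countable_simple_selectors[OF countable_C integrable_Psi])
  fix s :: "nat \<Rightarrow> 'a \<Rightarrow> 'b"
  assume selectors: "\<And>n. simple_function M (s n)" "\<And>n \<omega>. s n \<omega> \<in> C"
    and incseq_Psi: "\<And>\<omega>. incseq (\<lambda>n. \<Psi> (s n \<omega>) \<omega>)"
    and SUP_eq: "\<And>\<omega>. (SUP b\<in>C. ereal (\<Psi> b \<omega>)) = (SUP n. ereal (\<Psi> (s n \<omega>) \<omega>))"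
  have "integrable M (\<lambda>\<omega>. \<Psi> (s n \<omega>) \<omega>)" for n
    by (rule integrable_simple_function_compose) (use selectors integrable_Psi in auto)
  then have "eexpect M (\<lambda>\<omega>. SUP n. ereal (\<Psi> (s n \<omega>) \<omega>)) \<le> ereal V"
    by (rule eexpect_SUP_incseq_le[OF _ incseq_Psi bound[OF selectors]])
  then show ?thesis by (simp only: SUP_eq)
qed

section \<open>Convex analysis\<close>

lemma inner_maximal_at_interior_imp_0:
  fixes a :: "'b::euclidean_space"
  assumes "x0 \<in> interior S" and "\<And>x. x \<in> S \<Longrightarrow> a \<bullet> x \<le> a \<bullet> x0"
  shows "a = 0"
proof (rule ccontr)
  assume "a \<noteq> 0"
  have "interior S \<subseteq> interior {x. a \<bullet> x \<le> a \<bullet> x0}" using assms(2) by (intro interior_mono) auto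
  also have "\<dots> = {x. a \<bullet> x < a \<bullet> x0}" using \<open>a \<noteq> 0\<close> by simp
  finally show False using assms(1) by auto
qed

lemma convex_hypograph_supergradient:
  fixes A :: "('b::euclidean_space \<times> real) set"
  assumes "convex A" and x0_interior: "x0 \<in> interior (fst ` A)" and V_upper: "\<And>c. (x0, c) \<in> A \<Longrightarrow> c \<le> V"
  obtains \<theta> where "\<And>x c. (x, c) \<in> A \<Longrightarrow> c + \<theta> \<bullet> x \<le> V + \<theta> \<bullet> x0"
proof -
  obtain c0 where c0_in_A: "(x0, c0) \<in> A" using x0_interior interior_subset by fastforce
  have "convex ({x0} \<times> {V<..})" "{x0} \<times> {V<..} \<noteq> {}" by (auto intro!: convex_Times simp: gt_ex)
  moreover have "A \<inter> ({x0} \<times> {V<..}) = {}" using V_upper by force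
  ultimately obtain a b where hyperplane: "a \<noteq> 0" "\<And>x. x \<in> A \<Longrightarrow> a \<bullet> x \<le> b"
    and "\<And>x. x \<in> {x0} \<times> {V<..} \<Longrightarrow> b \<le> a \<bullet> x"
    using separating_hyperplane_sets[OF \<open>convex A\<close>] c0_in_A by (metis empty_iff)
  moreover obtain \<eta> \<gamma> where a_eq: "a = (\<eta>, \<gamma>)" by (cases a)
  ultimately have upper: "b \<le> \<eta> \<bullet> x0 + \<gamma> * c" if "V < c" for c using that by fastforce
  have lower: "\<eta> \<bullet> x + \<gamma> * c \<le> b" if "(x, c) \<in> A" for x c using hyperplane(2)[OF that] by (simp add: a_eq)
  have "((\<lambda>c. \<eta> \<bullet> x0 + \<gamma> * c) \<longlongrightarrow> \<eta> \<bullet> x0 + \<gamma> * V) (at_right V)" by (intro tendsto_intros)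
  then have "b \<le> \<eta> \<bullet> x0 + \<gamma> * V"
    by (rule tendsto_lowerbound) (auto simp: eventually_at_filter upper)
  with lower have separated: "\<eta> \<bullet> x + \<gamma> * c \<le> \<eta> \<bullet> x0 + \<gamma> * V" if "(x, c) \<in> A" for x c
    using that order_trans by blast
  have "0 \<le> \<gamma> * (V + 1 - c0)" using lower[OF c0_in_A] upper[of "V + 1"] by (simp add: algebra_simps)
  then have "0 \<le> \<gamma>" using V_upper[OF c0_in_A] by (simp add: zero_le_mult_iff)
  moreover have "\<gamma> \<noteq> 0"
  proof
    assume "\<gamma> = 0"
    then have "\<eta> = 0" using separated by (intro inner_maximal_at_interior_imp_0[OF x0_interior]) auto
    then show False using hyperplane(1) \<open>\<gamma> = 0\<close> by (simp add: a_eq zero_prod_def)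
  qed
  ultimately have "0 < \<gamma>" by simp
  have "c + ((1 / \<gamma>) *\<^sub>R \<eta>) \<bullet> x \<le> V + ((1 / \<gamma>) *\<^sub>R \<eta>) \<bullet> x0" if "(x, c) \<in> A" for x c
    using divide_right_mono[OF separated[OF that], of \<gamma>] \<open>0 < \<gamma>\<close> by (simp add: add_divide_distrib)
  then show thesis by (rule that)
qed

lemma concave_on_le_of_interior_dense:
  fixes g :: "'b::euclidean_space \<Rightarrow> real"
  assumes concave_g: "concave_on K g" and "interior K \<noteq> {}"
    and dense: "\<And>U. open U \<Longrightarrow> U \<noteq> {} \<Longrightarrow> \<exists>d\<in>D. d \<in> U"
    and le_on_dense: "\<And>k. k \<in> interior K \<inter> D \<Longrightarrow> g k \<le> a" and k_in_K: "k \<in> K"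
  shows "g k \<le> a"
proof -
  have convex_K: "convex K" using concave_g by (rule concave_on_imp_convex)
  have "convex_on (interior K) (\<lambda>x. - g x)"
    using concave_g convex_K by (auto simp: concave_on_def
        intro: convex_on_subset[OF _ interior_subset convex_interior])
  then have continuous_g: "continuous_on (interior K) g"
    using continuous_on_minus[OF convex_on_continuous[OF open_interior]] by fastforce
  have le_on_interior: "g x \<le> a" if "x \<in> interior K" for x
  proof (rule ccontr)
    assume "\<not> g x \<le> a"
    moreover have "open (interior K \<inter> g -` {a<..})"
      using continuous_g by (rule continuous_open_preimage) auto
    ultimately have "\<exists>d\<in>D. d \<in> interior K \<inter> g -` {a<..}" using that by (intro dense) auto
    then show False using le_on_dense by fastforce
  qed
  obtain x0 where x0_interior: "x0 \<in> interior K" using assms(2) by auto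
  have "((\<lambda>u. (1 - u) * g k + u * g x0) \<longlongrightarrow> (1 - 0) * g k + 0 * g x0) (at_right 0)"
    by (intro tendsto_intros)
  moreover have "(1 - u) * g k + u * g x0 \<le> a" if u_bounds: "0 < u" "u < 1" for u
  proof -
    have "k - u *\<^sub>R (k - x0) \<in> interior K"
      using convex_K x0_interior k_in_K u_bounds
      by (intro mem_interior_closure_convex_shrink) (auto intro: closure_subset[THEN subsetD])
    then have "g ((1 - u) *\<^sub>R k + u *\<^sub>R x0) \<le> a" by (intro le_on_interior) (simp add: algebra_simps)
    moreover have "(1 - u) * g k + u * g x0 \<le> g ((1 - u) *\<^sub>R k + u *\<^sub>R x0)"
      using concave_onD[OF concave_g, of u k x0] u_bounds k_in_K x0_interior interior_subset by auto
    ultimately show ?thesis by simp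
  qed
  then have "\<forall>\<^sub>F u in at_right 0. (1 - u) * g k + u * g x0 \<le> a"
    unfolding eventually_at_right_field by (auto intro!: exI[of _ 1])
  ultimately show ?thesis using tendsto_upperbound by fastforce
qed

lemma convex_on_SUP_affine:
  fixes g :: "'b::real_inner \<Rightarrow> real"
  assumes "convex S" and g_eq_SUP: "\<And>x. x \<in> S \<Longrightarrow> ereal (g x) = (SUP i\<in>I. ereal (p i + q i \<bullet> x))"
  shows "convex_on S g"
proof (rule convex_onI)
  fix t x y assume t_bounds: "0 < t" "t < (1::real)" and xy_in_S: "x \<in> S" "y \<in> S"
  have affine_le: "p i + q i \<bullet> x \<le> g x" if "i \<in> I" "x \<in> S" for i x
  proof -
    have "ereal (p i + q i \<bullet> x) \<le> ereal (g x)" unfolding g_eq_SUP[OF that(2)] using that(1) by (rule SUP_upper)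
    then show ?thesis by simp
  qed
  have "(1 - t) *\<^sub>R x + t *\<^sub>R y \<in> S" using convexD[OF \<open>convex S\<close> xy_in_S, of "1 - t" t] t_bounds by simp
  from g_eq_SUP[OF this] have "ereal (g ((1 - t) *\<^sub>R x + t *\<^sub>R y)) \<le> ereal ((1 - t) * g x + t * g y)"
  proof (simp only:, intro SUP_least)
    fix i assume "i \<in> I"
    have "p i + q i \<bullet> ((1 - t) *\<^sub>R x + t *\<^sub>R y) = (1 - t) * (p i + q i \<bullet> x) + t * (p i + q i \<bullet> y)"
      by (simp add: algebra_simps)
    also have "\<dots> \<le> (1 - t) * g x + t * g y"
      using t_bounds affine_le[OF \<open>i \<in> I\<close>] xy_in_S by (intro add_mono mult_left_mono) auto
    finally show "ereal (p i + q i \<bullet> ((1 - t) *\<^sub>R x + t *\<^sub>R y)) \<le> ereal ((1 - t) * g x + t * g y)" by simp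
  qed
  then show "g ((1 - t) *\<^sub>R x + t *\<^sub>R y) \<le> (1 - t) * g x + t * g y" by simp
qed (rule assms(1))

subsection \<open>Perspective functions\<close>

text \<open>In \<open>perspective_domain T D\<close> the value \<open>t = 0\<close> only occurs with \<open>w = 0\<close>, where \<open>perspective f\<close> is \<open>0\<close>.\<close>

definition perspective_domain :: "real set \<Rightarrow> 'b::real_vector set \<Rightarrow> (real \<times> 'b) set" where
  "perspective_domain T D = (\<lambda>(t, y). (t, t *\<^sub>R y)) ` (T \<times> D)"

definition perspective :: "('b::real_vector \<Rightarrow> real) \<Rightarrow> real \<times> 'b \<Rightarrow> real" where
  "perspective f = (\<lambda>(t, w). t * f (w /\<^sub>R t))"

lemma perspective_scaleR [simp]: "perspective f (t, t *\<^sub>R y) = t * f y"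
  by (cases "t = 0") (simp_all add: perspective_def)

lemma convex_on_weighted_mean:
  assumes convex_f: "convex_on D f" and yy'_in_D: "y \<in> D" "y' \<in> D" and ab_nonneg: "0 \<le> a" "0 \<le> b"
  obtains x where "x \<in> D" "a *\<^sub>R y + b *\<^sub>R y' = (a + b) *\<^sub>R x" "(a + b) * f x \<le> a * f y + b * f y'"
proof (cases "a + b = 0")
  case True
  then have "a = 0" "b = 0" using ab_nonneg by auto
  then show thesis using that[of y] yy'_in_D by simp
next
  case False
  define x where "x = (a / (a + b)) *\<^sub>R y + (b / (a + b)) *\<^sub>R y'"
  have weights: "0 \<le> a / (a + b)" "0 \<le> b / (a + b)" "a / (a + b) + b / (a + b) = 1"
    using ab_nonneg False by (auto simp flip: add_divide_distrib)
  have "x \<in> D"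
    unfolding x_def using convex_on_imp_convex[OF convex_f] yy'_in_D weights by (rule convexD)
  moreover have "a *\<^sub>R y + b *\<^sub>R y' = (a + b) *\<^sub>R x"
    using False by (simp add: x_def scaleR_add_right)
  moreover have "f x \<le> a / (a + b) * f y + b / (a + b) * f y'"
    unfolding x_def using convex_f yy'_in_D weights unfolding convex_on_def by blast
  then have "(a + b) * f x \<le> (a + b) * (a / (a + b) * f y + b / (a + b) * f y')"
    using ab_nonneg by (intro mult_left_mono) auto
  then have "(a + b) * f x \<le> a * f y + b * f y'"
    using False by (simp add: distrib_left)
  ultimately show thesis by (rule that)
qed

lemma convex_on_perspective:
  assumes convex_T: "convex T" "T \<subseteq> {0..}" and convex_f: "convex_on D f"
  shows "convex_on (perspective_domain T D) (perspective f)"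
proof -
  have "u *\<^sub>R p + v *\<^sub>R q \<in> perspective_domain T D
      \<and> perspective f (u *\<^sub>R p + v *\<^sub>R q) \<le> u * perspective f p + v * perspective f q"
    if "p \<in> perspective_domain T D" "q \<in> perspective_domain T D"
      and weights: "0 \<le> u" "0 \<le> v" "u + v = 1" for p q u v
  proof -
    obtain t y t' y' where p_eq: "p = (t, t *\<^sub>R y)" "t \<in> T" "y \<in> D"
      and q_eq: "q = (t', t' *\<^sub>R y')" "t' \<in> T" "y' \<in> D"
      using \<open>p \<in> _\<close> \<open>q \<in> _\<close> by (auto simp: perspective_domain_def)
    have "0 \<le> u * t" "0 \<le> v * t'" using p_eq q_eq weights convex_T(2) by auto
    then obtain x where x_mean: "x \<in> D" "(u * t) *\<^sub>R y + (v * t') *\<^sub>R y' = (u * t + v * t') *\<^sub>R x"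
      "(u * t + v * t') * f x \<le> (u * t) * f y + (v * t') * f y'"
      using convex_on_weighted_mean[OF convex_f p_eq(3) q_eq(3)] by blast
    have "u * t + v * t' \<in> T" using convexD[OF convex_T(1) p_eq(2) q_eq(2) weights] by simp
    moreover have "u *\<^sub>R p + v *\<^sub>R q = (u * t + v * t', (u * t + v * t') *\<^sub>R x)"
      using x_mean(2) by (simp add: p_eq q_eq)
    ultimately show ?thesis using x_mean(1,3) by (auto simp: perspective_domain_def p_eq q_eq mult.assoc)
  qed
  then show ?thesis unfolding convex_on_def convex_def by blast
qed

lemma interior_perspective_domain:
  fixes D :: "'b::real_normed_vector set"
  assumes t_interior: "t \<in> interior T" "t \<noteq> 0" and y_interior: "y \<in> interior D"
  shows "(t, t *\<^sub>R y) \<in> interior (perspective_domain T D)"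
proof -
  have tendsto_id: "((\<lambda>x. x) \<longlongrightarrow> (t, t *\<^sub>R y)) (nhds (t, t *\<^sub>R y))" by (rule filterlim_ident)
  have fst_tendsto: "(fst \<longlongrightarrow> t) (nhds (t, t *\<^sub>R y))"
    using tendsto_fst[OF tendsto_id] by simp
  have "((\<lambda>x. snd x /\<^sub>R fst x) \<longlongrightarrow> (t *\<^sub>R y) /\<^sub>R t) (nhds (t, t *\<^sub>R y))"
    using tendsto_snd[OF tendsto_id] fst_tendsto t_interior(2) by (intro tendsto_intros) auto
  then have snd_tendsto: "((\<lambda>x. snd x /\<^sub>R fst x) \<longlongrightarrow> y) (nhds (t, t *\<^sub>R y))" using t_interior(2) by simp
  have "\<forall>\<^sub>F x in nhds (t, t *\<^sub>R y). fst x \<in> interior T"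
    using t_interior(1) by (intro topological_tendstoD[OF fst_tendsto]) auto
  moreover have "\<forall>\<^sub>F x in nhds (t, t *\<^sub>R y). fst x \<noteq> 0"
    using fst_tendsto t_interior(2) by (rule tendsto_imp_eventually_ne)
  moreover have "\<forall>\<^sub>F x in nhds (t, t *\<^sub>R y). snd x /\<^sub>R fst x \<in> interior D"
    using y_interior by (intro topological_tendstoD[OF snd_tendsto]) auto
  ultimately have "\<forall>\<^sub>F x in nhds (t, t *\<^sub>R y). x \<in> perspective_domain T D"
  proof eventually_elim
    case (elim x)
    then have "fst x \<in> T" "snd x /\<^sub>R fst x \<in> D" using interior_subset by blast+
    moreover have "x = (fst x, fst x *\<^sub>R (snd x /\<^sub>R fst x))" using elim by (simp add: prod_eq_iff)
    ultimately show ?case unfolding perspective_domain_def by force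
  qed
  then show ?thesis unfolding eventually_nhds by (meson interiorI subsetI)
qed

subsection \<open>Derivatives of integrals of convex functions\<close>

lemma convex_on_abs_difference_quotient_le:
  fixes f :: "real \<Rightarrow> real"
  assumes convex_f: "convex_on {t - \<epsilon>..t + \<epsilon>} f" and h_small: "h \<noteq> 0" "\<bar>h\<bar> < \<epsilon>"
  shows "\<bar>(f (t + h) - f t) / h\<bar> \<le> \<bar>(f (t + \<epsilon>) - f t) / \<epsilon>\<bar> + \<bar>(f t - f (t - \<epsilon>)) / \<epsilon>\<bar>"
proof -
  define slope where "slope x y = (f x - f y) / (x - y)" for x y
  have slope_mono: "slope x y \<le> slope x z" "slope x z \<le> slope y z"
    if "t - \<epsilon> \<le> x" "x < y" "y < z" "z \<le> t + \<epsilon>" for x y z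
    using convex_on_slope_le[OF convex_f, of x z y] that unfolding slope_def by auto
  have "slope (t - \<epsilon>) t \<le> slope t (t + h) \<and> slope t (t + h) \<le> slope t (t + \<epsilon>)" if "0 < h"
    using slope_mono(1)[of t "t + h" "t + \<epsilon>"] slope_mono[of "t - \<epsilon>" t "t + h"] that h_small by auto
  moreover have "slope (t - \<epsilon>) t \<le> slope (t + h) t \<and> slope (t + h) t \<le> slope t (t + \<epsilon>)" if "h < 0"
    using slope_mono(2)[of "t - \<epsilon>" "t + h" t] slope_mono[of "t + h" t "t + \<epsilon>"] that h_small by auto
  moreover have "slope t (t + h) = (f (t + h) - f t) / h" "slope (t + h) t = (f (t + h) - f t) / h"
    "slope (t - \<epsilon>) t = (f t - f (t - \<epsilon>)) / \<epsilon>" "slope t (t + \<epsilon>) = (f (t + \<epsilon>) - f t) / \<epsilon>"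
    by (simp_all add: slope_def minus_divide_left flip: minus_divide_right)
  ultimately have "(f t - f (t - \<epsilon>)) / \<epsilon> \<le> (f (t + h) - f t) / h"
    and "(f (t + h) - f t) / h \<le> (f (t + \<epsilon>) - f t) / \<epsilon>" using h_small(1) by (cases "0 < h"; simp)+
  then show ?thesis by linarith
qed

lemma integral_difference_quotient_tendsto_convex:
  fixes f :: "'a \<Rightarrow> real \<Rightarrow> real" and h :: "nat \<Rightarrow> real"
  assumes integrable_f: "\<And>s. \<bar>s - t\<bar> \<le> \<epsilon> \<Longrightarrow> integrable M (\<lambda>\<omega>. f \<omega> s)"
    and convex_f: "\<And>\<omega>. \<omega> \<in> space M \<Longrightarrow> convex_on {t - \<epsilon>..t + \<epsilon>} (f \<omega>)"
    and deriv_f: "\<And>\<omega>. \<omega> \<in> space M \<Longrightarrow> (f \<omega> has_real_derivative f' \<omega>) (at t)"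
    and h_small: "\<And>n. h n \<noteq> 0" "\<And>n. \<bar>h n\<bar> < \<epsilon>" "h \<longlonglongrightarrow> 0"
  shows "integrable M f'"
    and "(\<lambda>n. ((\<integral>\<omega>. f \<omega> (t + h n) \<partial>M) - (\<integral>\<omega>. f \<omega> t \<partial>M)) / h n) \<longlonglongrightarrow> (\<integral>\<omega>. f' \<omega> \<partial>M)"
proof -
  define q where "q n \<omega> = (f \<omega> (t + h n) - f \<omega> t) / h n" for n \<omega>
  define w where "w \<omega> = \<bar>(f \<omega> (t + \<epsilon>) - f \<omega> t) / \<epsilon>\<bar> + \<bar>(f \<omega> t - f \<omega> (t - \<epsilon>)) / \<epsilon>\<bar>" for \<omega>
  have "0 < \<epsilon>" using h_small(2)[of 0] by simp
  then have "integrable M w"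
    unfolding w_def using integrable_f[of "t + \<epsilon>"] integrable_f[of "t - \<epsilon>"] integrable_f[of t] by simp
  have integrable_shift: "integrable M (\<lambda>\<omega>. f \<omega> (t + h n))" for n
    using h_small(2)[of n] by (intro integrable_f) simp
  have "integrable M (q n)" for n
    unfolding q_def using integrable_shift[of n] integrable_f[of t] \<open>0 < \<epsilon>\<close> by simp
  then have measurable_q: "q n \<in> borel_measurable M" for n by auto
  have q_tendsto: "(\<lambda>n. q n \<omega>) \<longlonglongrightarrow> f' \<omega>" if "\<omega> \<in> space M" for \<omega>
    using deriv_f[OF that] h_small(1,3)
      filterlim_compose[of "\<lambda>h. (f \<omega> (t + h) - f \<omega> t) / h" _ "at 0" h sequentially]
    by (simp add: DERIV_def q_def filterlim_at)
  have "norm (q n \<omega>) \<le> w \<omega>" if "\<omega> \<in> space M" for n \<omega>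
    unfolding q_def w_def real_norm_def
    by (rule convex_on_abs_difference_quotient_le[OF convex_f[OF that] h_small(1,2)])
  then have dominated: "AE \<omega> in M. (\<lambda>n. q n \<omega>) \<longlonglongrightarrow> f' \<omega>" "\<And>n. AE \<omega> in M. norm (q n \<omega>) \<le> w \<omega>"
    using q_tendsto by auto
  have measurable_f': "f' \<in> borel_measurable M"
    by (rule borel_measurable_LIMSEQ_real[OF q_tendsto measurable_q])
  show "integrable M f'"
    by (rule integrable_dominated_convergence[OF measurable_f' measurable_q \<open>integrable M w\<close> dominated])
  have "(\<lambda>n. \<integral>\<omega>. q n \<omega> \<partial>M) \<longlonglongrightarrow> (\<integral>\<omega>. f' \<omega> \<partial>M)"
    by (rule integral_dominated_convergence[OF measurable_f' measurable_q \<open>integrable M w\<close> dominated])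
  then show "(\<lambda>n. ((\<integral>\<omega>. f \<omega> (t + h n) \<partial>M) - (\<integral>\<omega>. f \<omega> t \<partial>M)) / h n) \<longlonglongrightarrow> (\<integral>\<omega>. f' \<omega> \<partial>M)"
    unfolding q_def using integrable_shift integrable_f[of t] \<open>0 < \<epsilon>\<close> by simp
qed

lemma has_real_derivative_integral_convex:
  fixes f :: "'a \<Rightarrow> real \<Rightarrow> real"
  assumes S_nhd: "open S" "t \<in> S"
    and integrable_f: "\<And>s. s \<in> S \<Longrightarrow> integrable M (\<lambda>\<omega>. f \<omega> s)"
    and convex_f: "\<And>\<omega>. \<omega> \<in> space M \<Longrightarrow> convex_on S (f \<omega>)"
    and deriv_f: "\<And>\<omega>. \<omega> \<in> space M \<Longrightarrow> (f \<omega> has_real_derivative f' \<omega>) (at t)"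
  shows "integrable M f'" "((\<lambda>s. \<integral>\<omega>. f \<omega> s \<partial>M) has_real_derivative (\<integral>\<omega>. f' \<omega> \<partial>M)) (at t)"
proof -
  obtain \<epsilon> where \<epsilon>_ball: "0 < \<epsilon>" "cball t \<epsilon> \<subseteq> S" using S_nhd open_contains_cball by blast
  have integrable_near: "integrable M (\<lambda>\<omega>. f \<omega> s)" if "\<bar>s - t\<bar> \<le> \<epsilon>" for s
    using that \<epsilon>_ball(2) by (intro integrable_f) (auto simp: dist_real_def abs_minus_commute)
  have convex_near: "convex_on {t - \<epsilon>..t + \<epsilon>} (f \<omega>)" if "\<omega> \<in> space M" for \<omega>
    using \<epsilon>_ball(2) by (intro convex_on_subset[OF convex_f[OF that]]) (auto simp: cball_eq_atLeastAtMost)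
  note quotients = integral_difference_quotient_tendsto_convex[OF integrable_near convex_near deriv_f]
  have "(\<lambda>n. \<epsilon> / 2 * inverse (real (Suc n))) \<longlonglongrightarrow> 0"
    by (rule tendsto_mult_right_zero[OF LIMSEQ_inverse_real_of_nat])
  then show "integrable M f'"
    using \<epsilon>_ball(1) by (intro quotients(1)[of "\<lambda>n. \<epsilon> / 2 * inverse (real (Suc n))"])
      (auto simp: field_simps add_pos_nonneg)
  have "((\<lambda>h. ((\<integral>\<omega>. f \<omega> (t + h) \<partial>M) - (\<integral>\<omega>. f \<omega> t \<partial>M)) / h) \<longlongrightarrow> (\<integral>\<omega>. f' \<omega> \<partial>M)) (at 0 within {- \<epsilon><..<\<epsilon>})"
    unfolding tendsto_at_iff_sequentially o_def
    by (intro allI impI quotients(2)) (auto simp: abs_less_iff minus_less_iff)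
  then show "((\<lambda>s. \<integral>\<omega>. f \<omega> s \<partial>M) has_real_derivative (\<integral>\<omega>. f' \<omega> \<partial>M)) (at t)"
    using \<epsilon>_ball(1) by (simp add: DERIV_def at_within_open[of 0 "{- \<epsilon><..<\<epsilon>}"])
qed

lemma integral_gradient_convex_minimizer:
  fixes F :: "'a \<Rightarrow> 'b::real_inner \<Rightarrow> real"
  assumes S_nhd: "open S" "x0 \<in> S"
    and integrable_F: "\<And>x. x \<in> S \<Longrightarrow> integrable M (\<lambda>\<omega>. F \<omega> x)"
    and convex_F: "\<And>\<omega>. \<omega> \<in> space M \<Longrightarrow> convex_on S (F \<omega>)"
    and gradient_F: "\<And>\<omega>. \<omega> \<in> space M \<Longrightarrow> (F \<omega> has_derivative (\<lambda>v. g \<omega> \<bullet> v)) (at x0)"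
    and minimal: "\<And>x. x \<in> S \<Longrightarrow> (\<integral>\<omega>. F \<omega> x0 \<partial>M) - a \<bullet> x0 \<le> (\<integral>\<omega>. F \<omega> x \<partial>M) - a \<bullet> x"
  shows "integrable M (\<lambda>\<omega>. g \<omega> \<bullet> v)" "(\<integral>\<omega>. g \<omega> \<bullet> v \<partial>M) = a \<bullet> v"
proof -
  define l where "l s = x0 + s *\<^sub>R v" for s :: real
  have l_combination: "l ((1 - u) * s + u * t) = (1 - u) *\<^sub>R l s + u *\<^sub>R l t" for u s t
    by (simp add: l_def algebra_simps)
  have "open (l -` S)" unfolding l_def using S_nhd(1) by (intro open_vimage continuous_intros)
  have "0 \<in> l -` S" using S_nhd(2) by (simp add: l_def)
  have convex_l: "convex_on (l -` S) (\<lambda>s. F \<omega> (l s))" if "\<omega> \<in> space M" for \<omega>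
  proof (rule convex_onI)
    note convex_F_\<omega> = convex_F[OF that]
    show "convex (l -` S)"
      using convexD_alt[OF convex_on_imp_convex[OF convex_F_\<omega>]]
      by (auto simp: convex_alt l_combination)
    fix u s t :: real assume "0 < u" "u < 1" "s \<in> l -` S" "t \<in> l -` S"
    then show "F \<omega> (l ((1 - u) *\<^sub>R s + u *\<^sub>R t)) \<le> (1 - u) * F \<omega> (l s) + u * F \<omega> (l t)"
      using convex_onD[OF convex_F_\<omega>, of u "l s" "l t"] by (simp add: l_combination)
  qed
  have derivative_l: "((\<lambda>s. F \<omega> (l s)) has_real_derivative g \<omega> \<bullet> v) (at 0)" if "\<omega> \<in> space M" for \<omega>
  proof -
    have "(l has_derivative (\<lambda>s. s *\<^sub>R v)) (at 0)"
      unfolding l_def[abs_def] by (auto intro!: derivative_eq_intros)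
    moreover have "(F \<omega> has_derivative (\<lambda>v. g \<omega> \<bullet> v)) (at (l 0))" using gradient_F[OF that] by (simp add: l_def)
    ultimately have "((\<lambda>s. F \<omega> (l s)) has_derivative (\<lambda>s. g \<omega> \<bullet> (s *\<^sub>R v))) (at 0)"
      by (rule has_derivative_compose)
    then show ?thesis by (simp add: has_field_derivative_def mult_commute_abs)
  qed
  have integrable_l: "integrable M (\<lambda>\<omega>. F \<omega> (l s))" if "s \<in> l -` S" for s using integrable_F that by simp
  note derivative_integral = has_real_derivative_integral_convex[of "l -` S" 0 M "\<lambda>\<omega> s. F \<omega> (l s)"
        "\<lambda>\<omega>. g \<omega> \<bullet> v",
      OF \<open>open (l -` S)\<close> \<open>0 \<in> l -` S\<close> integrable_l convex_l derivative_l]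
  show "integrable M (\<lambda>\<omega>. g \<omega> \<bullet> v)" by (rule derivative_integral(1))
  obtain \<epsilon> where \<epsilon>_ball: "0 < \<epsilon>" "ball 0 \<epsilon> \<subseteq> l -` S"
    using \<open>open (l -` S)\<close> \<open>0 \<in> l -` S\<close> open_contains_ball by blast
  have "((\<lambda>s. (\<integral>\<omega>. F \<omega> (l s) \<partial>M) - a \<bullet> l s) has_real_derivative (\<integral>\<omega>. g \<omega> \<bullet> v \<partial>M) - a \<bullet> v) (at 0)"
    using derivative_integral(2) by (auto simp: l_def inner_add_right intro!: derivative_eq_intros)
  then have "(\<integral>\<omega>. g \<omega> \<bullet> v \<partial>M) - a \<bullet> v = 0"
    using \<epsilon>_ball(1)
  proof (rule DERIV_local_min)
    show "\<forall>s. \<bar>0 - s\<bar> < \<epsilon> \<longrightarrow> (\<integral>\<omega>. F \<omega> (l 0) \<partial>M) - a \<bullet> l 0 \<le> (\<integral>\<omega>. F \<omega> (l s) \<partial>M) - a \<bullet> l s"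
      using minimal \<epsilon>_ball(2) by (auto simp: l_def subset_iff)
  qed
  then show "(\<integral>\<omega>. g \<omega> \<bullet> v \<partial>M) = a \<bullet> v" by simp
qed

section \<open>Concave programs over random vectors\<close>

lemma eexpect_SUP_concave_le:
  fixes g :: "'a \<Rightarrow> 'b::euclidean_space \<Rightarrow> real"
  assumes concave_g: "\<And>\<omega>. concave_on K (g \<omega>)" and "interior K \<noteq> {}"
    and integrable_g: "\<And>k. k \<in> K \<Longrightarrow> integrable M (\<lambda>\<omega>. g \<omega> k)"
    and bound: "\<And>s. simple_function M s \<Longrightarrow> range s \<subseteq> K \<Longrightarrow> (\<integral>\<omega>. g \<omega> (s \<omega>) \<partial>M) \<le> W"
  shows "eexpect M (\<lambda>\<omega>. SUP k\<in>K. ereal (g \<omega> k)) \<le> ereal W"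
proof -
  obtain D :: "'b set" where dense_D: "countable D" "\<And>U. open U \<Longrightarrow> U \<noteq> {} \<Longrightarrow> \<exists>d\<in>D. d \<in> U"
    using countable_dense_setE by blast
  define C where "C = interior K \<inter> D"
  have countable_C: "countable C" "C \<noteq> {}" "C \<subseteq> K"
    using dense_D(1) dense_D(2)[OF open_interior, of K] assms(2) interior_subset by (auto simp: C_def)
  have "(SUP k\<in>K. ereal (g \<omega> k)) \<le> (SUP k\<in>C. ereal (g \<omega> k))" for \<omega>
  proof (rule ereal_le_real)
    fix a assume "(SUP k\<in>C. ereal (g \<omega> k)) \<le> ereal a"
    then have "g \<omega> k \<le> a" if "k \<in> interior K \<inter> D" for k
      using that by (simp add: SUP_le_iff C_def)
    then have "g \<omega> k \<le> a" if "k \<in> K" for k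
      using concave_on_le_of_interior_dense[OF concave_g assms(2) dense_D(2)] that by blast
    then show "(SUP k\<in>K. ereal (g \<omega> k)) \<le> ereal a" by (intro SUP_least) simp
  qed
  then have "eexpect M (\<lambda>\<omega>. SUP k\<in>K. ereal (g \<omega> k)) \<le> eexpect M (\<lambda>\<omega>. SUP k\<in>C. ereal (g \<omega> k))"
    by (intro eexpect_mono_AE) simp
  also have "\<dots> \<le> ereal W"
  proof (rule eexpect_SUP_le_of_simple_selectors[OF countable_C(1,2)])
    show "integrable M (\<lambda>\<omega>. g \<omega> k)" if "k \<in> C" for k using integrable_g that countable_C(3) by auto
    show "(\<integral>\<omega>. g \<omega> (s \<omega>) \<partial>M) \<le> W" if "simple_function M s" "\<And>\<omega>. s \<omega> \<in> C" for s
      using that countable_C(3) by (intro bound) auto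
  qed
  finally show ?thesis .
qed

locale concave_program = prob_space M for M :: "'a measure" +
  fixes K :: "'b::euclidean_space set" and reward :: "'a \<Rightarrow> 'b \<Rightarrow> real" and cost :: "'b \<Rightarrow> real"
  assumes concave_reward: "\<And>\<omega>. concave_on K (reward \<omega>)" and convex_cost: "convex_on K cost"
    and integrable_reward: "\<And>k. k \<in> K \<Longrightarrow> integrable M (\<lambda>\<omega>. reward \<omega> k)"
begin

definition selections :: "('a \<Rightarrow> 'b) set" where
  "selections = {s. simple_function M s \<and> range s \<subseteq> K}"

lemma const_selection: "k \<in> K \<Longrightarrow> (\<lambda>_. k) \<in> selections"
  by (auto simp: selections_def)

lemma integrable_selection:
  assumes "s \<in> selections"
  shows "integrable M s" "integrable M (\<lambda>\<omega>. cost (s \<omega>))" "integrable M (\<lambda>\<omega>. reward \<omega> (s \<omega>))"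
proof -
  have simple_s: "simple_function M s" "range s \<subseteq> K" using assms by (auto simp: selections_def)
  have "simple_function M (\<lambda>\<omega>. cost (s \<omega>))" using simple_s(1) by (rule simple_function_compose1)
  with simple_s(1) show "integrable M s" "integrable M (\<lambda>\<omega>. cost (s \<omega>))"
    by (auto intro!: integrable_simple_function simp: emeasure_eq_measure)
  show "integrable M (\<lambda>\<omega>. reward \<omega> (s \<omega>))"
    using integrable_simple_function_compose[OF simple_s(1), of "\<lambda>k \<omega>. reward \<omega> k"]
      simple_s(2) integrable_reward by auto
qed

lemma selection_combination:
  assumes selected: "s \<in> selections" "s' \<in> selections" and weights: "0 \<le> u" "0 \<le> v" "u + v = 1"
  defines "s'' \<equiv> \<lambda>\<omega>. u *\<^sub>R s \<omega> + v *\<^sub>R s' \<omega>"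
  shows "s'' \<in> selections" "(\<integral>\<omega>. s'' \<omega> \<partial>M) = u *\<^sub>R (\<integral>\<omega>. s \<omega> \<partial>M) + v *\<^sub>R (\<integral>\<omega>. s' \<omega> \<partial>M)"
    "(\<integral>\<omega>. cost (s'' \<omega>) \<partial>M) \<le> u * (\<integral>\<omega>. cost (s \<omega>) \<partial>M) + v * (\<integral>\<omega>. cost (s' \<omega>) \<partial>M)"
    "u * (\<integral>\<omega>. reward \<omega> (s \<omega>) \<partial>M) + v * (\<integral>\<omega>. reward \<omega> (s' \<omega>) \<partial>M) \<le> (\<integral>\<omega>. reward \<omega> (s'' \<omega>) \<partial>M)"
proof -
  have in_K: "s \<omega> \<in> K" "s' \<omega> \<in> K" for \<omega> using selected by (auto simp: selections_def)
  have "simple_function M s''"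
    unfolding s''_def by (rule simple_function_compose2) (use selected in \<open>auto simp: selections_def\<close>)
  moreover have "s'' \<omega> \<in> K" for \<omega>
    unfolding s''_def using convex_on_imp_convex[OF convex_cost] in_K weights by (rule convexD)
  ultimately show combination: "s'' \<in> selections" by (auto simp: selections_def)
  note integrable_parts = integrable_selection[OF selected(1)] integrable_selection[OF selected(2)]
    integrable_selection[OF combination]
  show "(\<integral>\<omega>. s'' \<omega> \<partial>M) = u *\<^sub>R (\<integral>\<omega>. s \<omega> \<partial>M) + v *\<^sub>R (\<integral>\<omega>. s' \<omega> \<partial>M)"
    unfolding s''_def using integrable_parts by simp
  have "(\<integral>\<omega>. cost (s'' \<omega>) \<partial>M) \<le> (\<integral>\<omega>. u * cost (s \<omega>) + v * cost (s' \<omega>) \<partial>M)"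
  proof (rule integral_mono)
    show "cost (s'' \<omega>) \<le> u * cost (s \<omega>) + v * cost (s' \<omega>)" for \<omega>
      unfolding s''_def using convex_cost in_K weights unfolding convex_on_def by blast
  qed (use integrable_parts in auto)
  then show "(\<integral>\<omega>. cost (s'' \<omega>) \<partial>M) \<le> u * (\<integral>\<omega>. cost (s \<omega>) \<partial>M) + v * (\<integral>\<omega>. cost (s' \<omega>) \<partial>M)"
    using integrable_parts by simp
  have "(\<integral>\<omega>. u * reward \<omega> (s \<omega>) + v * reward \<omega> (s' \<omega>) \<partial>M) \<le> (\<integral>\<omega>. reward \<omega> (s'' \<omega>) \<partial>M)"
  proof (rule integral_mono)
    show "u * reward \<omega> (s \<omega>) + v * reward \<omega> (s' \<omega>) \<le> reward \<omega> (s'' \<omega>)" for \<omega>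
      unfolding s''_def using concave_reward[of \<omega>] in_K weights unfolding concave_on_iff by blast
  qed (use integrable_parts in auto)
  then show "u * (\<integral>\<omega>. reward \<omega> (s \<omega>) \<partial>M) + v * (\<integral>\<omega>. reward \<omega> (s' \<omega>) \<partial>M) \<le> (\<integral>\<omega>. reward \<omega> (s'' \<omega>) \<partial>M)"
    using integrable_parts by simp
qed

definition value_hypograph :: "(('b \<times> real) \<times> real) set" where
  "value_hypograph = {((\<integral>\<omega>. s \<omega> \<partial>M, d), c) | s d c.
    s \<in> selections \<and> (\<integral>\<omega>. cost (s \<omega>) \<partial>M) \<le> d \<and> c \<le> (\<integral>\<omega>. reward \<omega> (s \<omega>) \<partial>M)}"

lemma value_hypographI:
  "s \<in> selections \<Longrightarrow> (\<integral>\<omega>. s \<omega> \<partial>M) = x \<Longrightarrow> (\<integral>\<omega>. cost (s \<omega>) \<partial>M) \<le> d \<Longrightarrow> c \<le> (\<integral>\<omega>. reward \<omega> (s \<omega>) \<partial>M)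
    \<Longrightarrow> ((x, d), c) \<in> value_hypograph"
  by (auto simp: value_hypograph_def)

lemma value_hypographE:
  assumes "p \<in> value_hypograph"
  obtains s d c where "p = ((\<integral>\<omega>. s \<omega> \<partial>M, d), c)" "s \<in> selections"
    "(\<integral>\<omega>. cost (s \<omega>) \<partial>M) \<le> d" "c \<le> (\<integral>\<omega>. reward \<omega> (s \<omega>) \<partial>M)"
  using assms by (auto simp: value_hypograph_def)

lemma convex_value_hypograph: "convex value_hypograph"
proof (rule convexI)
  fix p q :: "('b \<times> real) \<times> real" and u v :: real
  assume p_in: "p \<in> value_hypograph" and q_in: "q \<in> value_hypograph" and weights: "0 \<le> u" "0 \<le> v" "u + v = 1"
  obtain s d c where p_parts: "p = ((\<integral>\<omega>. s \<omega> \<partial>M, d), c)" "s \<in> selections"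
    "(\<integral>\<omega>. cost (s \<omega>) \<partial>M) \<le> d" "c \<le> (\<integral>\<omega>. reward \<omega> (s \<omega>) \<partial>M)" using p_in by (rule value_hypographE)
  obtain s' d' c' where q_parts: "q = ((\<integral>\<omega>. s' \<omega> \<partial>M, d'), c')" "s' \<in> selections"
    "(\<integral>\<omega>. cost (s' \<omega>) \<partial>M) \<le> d'" "c' \<le> (\<integral>\<omega>. reward \<omega> (s' \<omega>) \<partial>M)" using q_in by (rule value_hypographE)
  note combination = selection_combination[OF p_parts(2) q_parts(2) weights]
  have "((u *\<^sub>R (\<integral>\<omega>. s \<omega> \<partial>M) + v *\<^sub>R (\<integral>\<omega>. s' \<omega> \<partial>M), u * d + v * d'), u * c + v * c') \<in> value_hypograph"
  proof (rule value_hypographI[OF combination(1,2)])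
    have "u * (\<integral>\<omega>. cost (s \<omega>) \<partial>M) + v * (\<integral>\<omega>. cost (s' \<omega>) \<partial>M) \<le> u * d + v * d'"
      using p_parts(3) q_parts(3) weights by (intro add_mono mult_left_mono) auto
    with combination(3) show "(\<integral>\<omega>. cost (u *\<^sub>R s \<omega> + v *\<^sub>R s' \<omega>) \<partial>M) \<le> u * d + v * d'" by simp
    have "u * c + v * c' \<le> u * (\<integral>\<omega>. reward \<omega> (s \<omega>) \<partial>M) + v * (\<integral>\<omega>. reward \<omega> (s' \<omega>) \<partial>M)"
      using p_parts(4) q_parts(4) weights by (intro add_mono mult_left_mono) auto
    with combination(4) show "u * c + v * c' \<le> (\<integral>\<omega>. reward \<omega> (u *\<^sub>R s \<omega> + v *\<^sub>R s' \<omega>) \<partial>M)" by simp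
  qed
  then show "u *\<^sub>R p + v *\<^sub>R q \<in> value_hypograph" by (simp add: p_parts(1) q_parts(1))
qed

lemma interior_fst_value_hypograph:
  assumes x0_interior: "x0 \<in> interior K" and slack: "cost x0 < r"
  shows "(x0, r) \<in> interior (fst ` value_hypograph)"
proof -
  have "convex_on (interior K) cost"
    by (rule convex_on_subset[OF convex_cost interior_subset
          convex_interior[OF convex_on_imp_convex[OF convex_cost]]])
  then have "isCont cost x0"
    using x0_interior convex_on_continuous[OF open_interior]
      continuous_on_eq_continuous_at[OF open_interior] by blast
  have tendsto_id: "((\<lambda>p. p) \<longlongrightarrow> (x0, r)) (nhds (x0, r))" by (rule filterlim_ident)
  have fst_tendsto: "(fst \<longlongrightarrow> x0) (nhds (x0, r))" and snd_tendsto: "(snd \<longlongrightarrow> r) (nhds (x0, r))"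
    using tendsto_fst[OF tendsto_id] tendsto_snd[OF tendsto_id] by simp_all
  have "((\<lambda>p. snd p - cost (fst p)) \<longlongrightarrow> r - cost x0) (nhds (x0, r))"
    by (rule tendsto_diff[OF snd_tendsto isCont_tendsto_compose[OF \<open>isCont cost x0\<close> fst_tendsto]])
  then have "\<forall>\<^sub>F p in nhds (x0, r). 0 < snd p - cost (fst p)" using slack by (intro order_tendstoD(1)) auto
  moreover have "\<forall>\<^sub>F p in nhds (x0, r). fst p \<in> interior K"
    using x0_interior by (intro topological_tendstoD[OF fst_tendsto]) auto
  ultimately have "\<forall>\<^sub>F p in nhds (x0, r). p \<in> fst ` value_hypograph"
  proof eventually_elim
    case (elim p)
    then have "((fst p, snd p), \<integral>\<omega>. reward \<omega> (fst p) \<partial>M) \<in> value_hypograph"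
      using interior_subset by (intro value_hypographI[of "\<lambda>_. fst p"] const_selection) (auto simp: prob_space)
    then show ?case by force
  qed
  then show ?thesis unfolding eventually_nhds by (meson interiorI subsetI)
qed

lemma Lagrange_multipliers:
  assumes x0_interior: "x0 \<in> interior K" and slack: "cost x0 < r"
    and V_upper: "\<And>s. s \<in> selections \<Longrightarrow> (\<integral>\<omega>. s \<omega> \<partial>M) = x0 \<Longrightarrow> (\<integral>\<omega>. cost (s \<omega>) \<partial>M) \<le> r
      \<Longrightarrow> (\<integral>\<omega>. reward \<omega> (s \<omega>) \<partial>M) \<le> V"
  obtains \<theta> lam where "0 \<le> lam"
    "\<forall>s\<in>selections. (\<integral>\<omega>. reward \<omega> (s \<omega>) + \<theta> \<bullet> s \<omega> - lam * cost (s \<omega>) \<partial>M) \<le> V + \<theta> \<bullet> x0 - lam * r"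
proof -
  have "c \<le> V" if "((x0, r), c) \<in> value_hypograph" for c
    using that V_upper by (force simp: value_hypograph_def)
  then obtain \<eta> where supergradient: "\<And>p c. (p, c) \<in> value_hypograph \<Longrightarrow> c + \<eta> \<bullet> p \<le> V + \<eta> \<bullet> (x0, r)"
    using convex_hypograph_supergradient[OF convex_value_hypograph interior_fst_value_hypograph[OF x0_interior slack]]
    by metis
  define \<theta> lam where "\<theta> = fst \<eta>" and "lam = - snd \<eta>"
  have bound: "c + \<theta> \<bullet> x - lam * d \<le> V + \<theta> \<bullet> x0 - lam * r" if "((x, d), c) \<in> value_hypograph" for x d c
    using supergradient[OF that] by (simp add: \<theta>_def lam_def inner_prod_def)
  have "0 \<le> lam"
  proof (rule ccontr)
    assume "\<not> 0 \<le> lam"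
    define c where "c = (\<integral>\<omega>. reward \<omega> x0 \<partial>M)"
    define d where "d = r + (\<bar>V - c\<bar> + 1) / (- lam)"
    have "r \<le> d" using \<open>\<not> 0 \<le> lam\<close> by (simp add: d_def divide_nonneg_neg)
    then have "((x0, d), c) \<in> value_hypograph"
      using x0_interior slack interior_subset
      by (intro value_hypographI[of "\<lambda>_. x0"] const_selection) (auto simp: c_def prob_space)
    from bound[OF this] have "- (lam * (d - r)) \<le> V - c" by (simp add: right_diff_distrib)
    moreover have "lam * (d - r) = - (\<bar>V - c\<bar> + 1)" using \<open>\<not> 0 \<le> lam\<close> by (simp add: d_def)
    ultimately show False by simp
  qed
  moreover have "(\<integral>\<omega>. reward \<omega> (s \<omega>) + \<theta> \<bullet> s \<omega> - lam * cost (s \<omega>) \<partial>M) \<le> V + \<theta> \<bullet> x0 - lam * r"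
    if selected: "s \<in> selections" for s
    using bound[OF value_hypographI[OF selected refl order_refl order_refl]] integrable_selection[OF selected]
    by simp
  ultimately show thesis by (intro that ballI)
qed

theorem strong_duality:
  fixes V :: ereal
  assumes x0_interior: "x0 \<in> interior K" and slack: "cost x0 < r"
    and V_upper: "\<And>s. s \<in> selections \<Longrightarrow> (\<integral>\<omega>. s \<omega> \<partial>M) = x0 \<Longrightarrow> (\<integral>\<omega>. cost (s \<omega>) \<partial>M) \<le> r
      \<Longrightarrow> ereal (\<integral>\<omega>. reward \<omega> (s \<omega>) \<partial>M) \<le> V"
  obtains \<theta> lam where "0 \<le> lam"
    "eexpect M (\<lambda>\<omega>. SUP k\<in>K. ereal (reward \<omega> k + \<theta> \<bullet> k - lam * cost k)) + ereal (lam * r - \<theta> \<bullet> x0) \<le> V"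
proof (cases V)
  case PInf
  then show thesis using that[of 0 0] by simp
next
  case MInf
  have "x0 \<in> K" using x0_interior interior_subset by blast
  then show thesis using V_upper[of "\<lambda>_. x0"] slack MInf by (simp add: const_selection prob_space)
next
  case (real v)
  have "(\<integral>\<omega>. reward \<omega> (s \<omega>) \<partial>M) \<le> v"
    if "s \<in> selections" "(\<integral>\<omega>. s \<omega> \<partial>M) = x0" "(\<integral>\<omega>. cost (s \<omega>) \<partial>M) \<le> r" for s
    using V_upper[OF that] by (simp add: real)
  then obtain \<theta> lam where lam_nonneg: "0 \<le> lam" and bound: "\<forall>s\<in>selections.
      (\<integral>\<omega>. reward \<omega> (s \<omega>) + \<theta> \<bullet> s \<omega> - lam * cost (s \<omega>) \<partial>M) \<le> v + \<theta> \<bullet> x0 - lam * r"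
    by (rule Lagrange_multipliers[OF x0_interior slack])
  have "concave_on K (\<lambda>k. \<theta> \<bullet> k)"
    using convex_on_imp_convex[OF convex_cost] by (simp add: concave_on_iff inner_add_right)
  then have "concave_on K (\<lambda>k. reward \<omega> k + \<theta> \<bullet> k - lam * cost k)" for \<omega>
    using concave_reward convex_cost lam_nonneg by (intro concave_on_diff concave_on_add convex_on_cmul)
  then have "eexpect M (\<lambda>\<omega>. SUP k\<in>K. ereal (reward \<omega> k + \<theta> \<bullet> k - lam * cost k))
      \<le> ereal (v + \<theta> \<bullet> x0 - lam * r)"
    using x0_interior integrable_reward bound by (intro eexpect_SUP_concave_le) (auto simp: selections_def)
  then have "eexpect M (\<lambda>\<omega>. SUP k\<in>K. ereal (reward \<omega> k + \<theta> \<bullet> k - lam * cost k)) + ereal (lam * r - \<theta> \<bullet> x0) \<le> V"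
    by (cases "eexpect M (\<lambda>\<omega>. SUP k\<in>K. ereal (reward \<omega> k + \<theta> \<bullet> k - lam * cost k))") (auto simp: real)
  then show thesis by (rule that[OF lam_nonneg])
qed

end

section \<open>Divergence functions and their conjugates\<close>

definition real_phi :: "(real \<Rightarrow> ennreal) \<Rightarrow> real \<Rightarrow> real" where
  "real_phi \<phi> t = enn2real (\<phi> t)"

definition real_conjugate :: "(real \<Rightarrow> ennreal) \<Rightarrow> real \<Rightarrow> real" where
  "real_conjugate \<phi> s = real_of_ereal (conjugate \<phi> s)"

lemma real_phi_nonneg [simp]: "0 \<le> real_phi \<phi> t"
  by (simp add: real_phi_def)

lemma phi_eq_ennreal: "t \<in> effdom \<phi> \<Longrightarrow> \<phi> t = ennreal (real_phi \<phi> t)"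
  by (simp add: effdom_def real_phi_def)

lemma phi_eq_infinity: "t \<notin> effdom \<phi> \<Longrightarrow> \<phi> t = \<infinity>"
  by (simp add: effdom_def less_top[symmetric])

locale divergence_function =
  fixes \<phi> :: "real \<Rightarrow> ennreal"
  assumes Phi0: "\<phi> \<in> Phi0" and lower_semicont: "lower_semicont \<phi>"
begin

lemma real_phi_one [simp]: "real_phi \<phi> 1 = 0"
  using Phi0 by (simp add: real_phi_def Phi0_def)

lemma one_in_interior_effdom: "1 \<in> interior (effdom \<phi>)"
  using Phi0 by (simp add: Phi0_def)

lemma one_in_effdom: "1 \<in> effdom \<phi>"
  using one_in_interior_effdom interior_subset by blast

lemma effdom_nonneg: "t \<in> effdom \<phi> \<Longrightarrow> 0 \<le> t"
  using Phi0 by (auto simp: Phi0_def)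

lemma convex_on_real_phi: "convex_on (effdom \<phi>) (real_phi \<phi>)"
proof -
  have "u * x + v * y \<in> effdom \<phi> \<and> real_phi \<phi> (u * x + v * y) \<le> u * real_phi \<phi> x + v * real_phi \<phi> y"
    if xy_in_effdom: "x \<in> effdom \<phi>" "y \<in> effdom \<phi>" and weights: "0 \<le> u" "0 \<le> v" "u + v = 1" for x y u v
  proof -
    have "\<phi> (u * x + v * y) \<le> ennreal u * \<phi> x + ennreal v * \<phi> y"
    proof -
      have "u = 1 - v" "v \<le> 1" using weights by auto
      then show ?thesis using Phi0 weights(2) by (auto simp: Phi0_def convex_ext_def)
    qed
    also have "\<dots> = ennreal (u * real_phi \<phi> x + v * real_phi \<phi> y)"
      using xy_in_effdom weights by (simp add: phi_eq_ennreal ennreal_mult)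
    finally have phi_le: "\<phi> (u * x + v * y) \<le> ennreal (u * real_phi \<phi> x + v * real_phi \<phi> y)" .
    then have "u * x + v * y \<in> effdom \<phi>" by (auto simp: effdom_def intro: le_less_trans)
    moreover have "0 \<le> u * real_phi \<phi> x + v * real_phi \<phi> y" using weights by simp
    ultimately show ?thesis using phi_le by (simp add: phi_eq_ennreal del: ennreal_plus)
  qed
  then show ?thesis by (simp add: convex_on_def convex_def)
qed

lemma eventually_less_phi:
  assumes "a < \<phi> t"
  shows "\<forall>\<^sub>F s in nhds t. a < \<phi> s"
proof -
  have "a < Liminf (at t) \<phi>"
    using assms lower_semicont by (auto simp: lower_semicont_def intro: less_le_trans)
  then have "\<forall>\<^sub>F s in at t. a < \<phi> s" by (rule less_LiminfD)
  then show ?thesis using assms by (auto simp: eventually_at_filter elim: eventually_mono)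
qed

lemma measurable_phi [measurable]: "\<phi> \<in> borel_measurable borel"
proof (rule borel_measurableI_greater)
  fix a
  have "open {t. a < \<phi> t}"
    using eventually_less_phi by (subst open_subopen) (fastforce simp: eventually_nhds)
  then show "{t \<in> space borel. a < \<phi> t} \<in> sets borel" by simp
qed

lemma measurable_real_phi [measurable]: "real_phi \<phi> \<in> borel_measurable borel"
  unfolding real_phi_def by measurable

definition epigraph :: "(real \<times> real) set" where
  "epigraph = {(t, a). t \<in> effdom \<phi> \<and> real_phi \<phi> t \<le> a}"

lemma mem_epigraph_iff: "(t, a) \<in> epigraph \<longleftrightarrow> 0 \<le> a \<and> \<phi> t \<le> ennreal a"
proof (cases "t \<in> effdom \<phi>")
  case True
  then show ?thesis
    by (auto simp: epigraph_def phi_eq_ennreal intro: ennreal_leI order_trans[OF real_phi_nonneg])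
qed (auto simp: epigraph_def phi_eq_infinity top_unique)

lemma closed_epigraph: "closed epigraph"
  unfolding closed_sequential_limits
proof (intro allI impI, elim conjE)
  fix p :: "nat \<Rightarrow> real \<times> real" and q
  assume "\<forall>n. p n \<in> epigraph" and p_tendsto: "p \<longlonglongrightarrow> q"
  then have p_in_epigraph: "0 \<le> snd (p n)" "\<phi> (fst (p n)) \<le> ennreal (snd (p n))" for n
    using mem_epigraph_iff[of "fst (p n)" "snd (p n)"] by auto
  then have "0 \<le> snd q" by (intro LIMSEQ_le_const[OF tendsto_snd[OF p_tendsto]]) auto
  moreover have "\<phi> (fst q) \<le> ennreal (snd q)"
  proof (rule ccontr)
    assume "\<not> \<phi> (fst q) \<le> ennreal (snd q)"
    then have "ennreal (snd q) < \<phi> (fst q)" by simp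
    then obtain a where between: "ennreal (snd q) < a" "a < \<phi> (fst q)" by (blast dest: dense)
    have "\<forall>\<^sub>F n in sequentially. a < \<phi> (fst (p n))"
      by (rule eventually_compose_filterlim[OF eventually_less_phi[OF between(2)] tendsto_fst[OF p_tendsto]])
    moreover have "\<forall>\<^sub>F n in sequentially. ennreal (snd (p n)) < a"
      using between(1) by (intro order_tendstoD(2)[OF tendsto_ennrealI[OF tendsto_snd[OF p_tendsto]]])
    ultimately have "\<forall>\<^sub>F n in sequentially. False"
      by eventually_elim (use p_in_epigraph in \<open>meson less_le_trans less_asym\<close>)
    then show False by simp
  qed
  ultimately show "q \<in> epigraph" using mem_epigraph_iff[of "fst q" "snd q"] by simp
qed

lemma conjugate_eq_SUP: "conjugate \<phi> s = (SUP t\<in>effdom \<phi>. ereal (s * t - real_phi \<phi> t))"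
proof (rule antisym)
  show "conjugate \<phi> s \<le> (SUP t\<in>effdom \<phi>. ereal (s * t - real_phi \<phi> t))"
    unfolding conjugate_def
  proof (rule SUP_least)
    fix t
    show "ereal (s * t) - enn2ereal (\<phi> t) \<le> (SUP t\<in>effdom \<phi>. ereal (s * t - real_phi \<phi> t))"
      by (cases "t \<in> effdom \<phi>") (auto simp: phi_eq_ennreal phi_eq_infinity intro!: SUP_upper2[of t])
  qed
  show "(SUP t\<in>effdom \<phi>. ereal (s * t - real_phi \<phi> t)) \<le> conjugate \<phi> s"
    unfolding conjugate_def
  proof (rule SUP_least)
    fix t assume "t \<in> effdom \<phi>"
    then show "ereal (s * t - real_phi \<phi> t) \<le> (SUP t. ereal (s * t) - enn2ereal (\<phi> t))"
      by (intro SUP_upper2[of t]) (auto simp: phi_eq_ennreal)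
  qed
qed

lemma conjugate_ge: "t \<in> effdom \<phi> \<Longrightarrow> ereal (s * t - real_phi \<phi> t) \<le> conjugate \<phi> s"
  unfolding conjugate_eq_SUP by (rule SUP_upper)

lemma conjugate_not_MInf: "conjugate \<phi> s \<noteq> - \<infinity>"
  using conjugate_ge[OF one_in_effdom, of s] by auto

lemma conjugate_persp_pos_eq_SUP:
  assumes "0 < lam" "u \<noteq> - \<infinity>"
  shows "conjugate_persp \<phi> lam u = (SUP t\<in>effdom \<phi>. u * ereal t - ereal (lam * real_phi \<phi> t))"
proof (cases u)
  case PInf
  have "\<infinity> \<le> (SUP t\<in>effdom \<phi>. u * ereal t - ereal (lam * real_phi \<phi> t))"
    by (rule SUP_upper2[OF one_in_effdom]) (simp add: PInf)
  then show ?thesis using assms by (simp add: PInf conjugate_persp_def conjugate_ext_def)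
next
  case (real v)
  have "ereal lam * conjugate \<phi> (v / lam) = (SUP t\<in>effdom \<phi>. u * ereal t - ereal (lam * real_phi \<phi> t))"
    unfolding conjugate_eq_SUP using assms(1) real one_in_effdom
    by (subst Sup_ereal_mult_left') (auto simp: algebra_simps)
  then show ?thesis using assms by (simp add: real conjugate_persp_def conjugate_ext_def)
qed (use assms in simp)

lemma SUP_le_conjugate_persp_0: "(SUP t\<in>effdom \<phi>. u * ereal t) \<le> conjugate_persp \<phi> 0 u"
proof (cases "u \<le> 0")
  case True
  then have "(SUP t\<in>effdom \<phi>. u * ereal t) \<le> 0"
    by (intro SUP_least) (auto simp: ereal_mult_le_0_iff effdom_nonneg)
  then show ?thesis using True by (simp add: conjugate_persp_def)
qed (simp add: conjugate_persp_def)

lemma conjugate_persp_0_eq_SUP: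
  assumes "{0<..} \<subseteq> effdom \<phi>" "u \<noteq> - \<infinity>"
  shows "conjugate_persp \<phi> 0 u = (SUP t\<in>effdom \<phi>. u * ereal t)"
proof (rule antisym[OF _ SUP_le_conjugate_persp_0])
  show "conjugate_persp \<phi> 0 u \<le> (SUP t\<in>effdom \<phi>. u * ereal t)"
  proof (cases u)
    case PInf
    show ?thesis by (rule SUP_upper2[OF one_in_effdom]) (simp add: PInf)
  next
    case (real v)
    have scaled_le_SUP: "ereal (v * t) \<le> (SUP t\<in>effdom \<phi>. u * ereal t)" if "0 < t" for t
      using assms(1) that by (intro SUP_upper2[of t]) (auto simp: real)
    show ?thesis
    proof (cases "v \<le> 0")
      case True
      have "(\<lambda>n. ereal (v * inverse (real (Suc n)))) \<longlonglongrightarrow> ereal (v * 0)"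
        by (intro tendsto_intros LIMSEQ_inverse_real_of_nat)
      then have "ereal (v * 0) \<le> (SUP t\<in>effdom \<phi>. u * ereal t)"
        by (rule LIMSEQ_le_const2) (use scaled_le_SUP in auto)
      then show ?thesis using True by (simp add: conjugate_persp_def real flip: zero_ereal_def)
    next
      case False
      have "ereal b \<le> (SUP t\<in>effdom \<phi>. u * ereal t)" for b
        using False by (intro order_trans[OF _ scaled_le_SUP[of "max b 1 / v"]]) auto
      then have "(SUP t\<in>effdom \<phi>. u * ereal t) = \<infinity>" by (rule ereal_top)
      then show ?thesis by simp
    qed
  qed (use assms in simp)
qed

end

locale smooth_divergence_function = divergence_function +
  assumes conjugate_differentiable: "conjugate_differentiable \<phi>"
begin

lemma conjugate_eq_ereal: "conjugate \<phi> s = ereal (real_conjugate \<phi> s)"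
  using conjugate_differentiable by (auto simp: conjugate_differentiable_def real_conjugate_def ereal_real')

lemma Fenchel_Young: "t \<in> effdom \<phi> \<Longrightarrow> s * t - real_phi \<phi> t \<le> real_conjugate \<phi> s"
  using conjugate_ge[of t s] by (simp add: conjugate_eq_ereal)

lemma real_conjugate_has_real_derivative:
  "(real_conjugate \<phi> has_real_derivative deriv (real_conjugate \<phi>) s) (at s)"
proof -
  have "real_conjugate \<phi> differentiable (at s)"
    using conjugate_differentiable
    by (simp add: conjugate_differentiable_def differentiable_on_def real_conjugate_def[abs_def])
  then show ?thesis by (simp add: DERIV_deriv_iff_real_differentiable)
qed

text \<open>Finiteness of the conjugate at \<open>s + 1\<close> bounds \<open>t\<close>.\<close>

lemma compact_epigraph_superlevel: "compact (epigraph \<inter> {p. m \<le> s * fst p - snd p})"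
proof -
  define T where "T = real_conjugate \<phi> (s + 1) - m"
  have "t \<in> {0..T} \<and> a \<in> {0..\<bar>s\<bar> * T - m}"
    if in_superlevel: "t \<in> effdom \<phi>" "real_phi \<phi> t \<le> a" "m \<le> s * t - a" for t a
  proof -
    have "(s + 1) * t - real_phi \<phi> t \<le> real_conjugate \<phi> (s + 1)" using in_superlevel(1) by (rule Fenchel_Young)
    then have "t \<le> T" using in_superlevel by (simp add: T_def algebra_simps)
    moreover have "0 \<le> t" using in_superlevel(1) by (rule effdom_nonneg)
    ultimately have "s * t \<le> \<bar>s\<bar> * T" by (intro mult_mono) auto
    moreover have "0 \<le> a" using real_phi_nonneg in_superlevel(2) by (rule order_trans)
    ultimately show ?thesis using in_superlevel(3) \<open>t \<le> T\<close> \<open>0 \<le> t\<close> by auto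
  qed
  then have "epigraph \<inter> {p. m \<le> s * fst p - snd p} \<subseteq> {0..T} \<times> {0..\<bar>s\<bar> * T - m}"
    by (auto simp: epigraph_def)
  moreover have "closed (epigraph \<inter> {p. m \<le> s * fst p - snd p})"
    by (intro closed_Int closed_epigraph closed_Collect_le continuous_intros)
  moreover have "bounded ({0..T} \<times> {0..\<bar>s\<bar> * T - m})"
    by (intro bounded_Times bounded_closed_interval)
  ultimately show ?thesis by (auto simp: compact_eq_bounded_closed intro: bounded_subset)
qed

lemma conjugate_attained:
  obtains t where "t \<in> effdom \<phi>" "real_conjugate \<phi> s = s * t - real_phi \<phi> t"
proof -
  define A where "A = epigraph \<inter> {p. real_conjugate \<phi> s - 1 \<le> s * fst p - snd p}"
  have in_A: "(t, real_phi \<phi> t) \<in> A" if "t \<in> effdom \<phi>" "real_conjugate \<phi> s - 1 < s * t - real_phi \<phi> t" for t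
    using that by (simp add: A_def epigraph_def)
  have "ereal (real_conjugate \<phi> s - 1) < (SUP t\<in>effdom \<phi>. ereal (s * t - real_phi \<phi> t))"
    by (simp flip: conjugate_eq_SUP add: conjugate_eq_ereal)
  then have "A \<noteq> {}" using in_A by (auto simp: less_SUP_iff)
  moreover have "compact A" unfolding A_def by (rule compact_epigraph_superlevel)
  moreover have "continuous_on A (\<lambda>p. s * fst p - snd p)" by (intro continuous_intros)
  ultimately obtain p where "p \<in> A" and maximal: "\<forall>q\<in>A. s * fst q - snd q \<le> s * fst p - snd p"
    using continuous_attains_sup by blast
  define t where "t = fst p"
  have t_maximal: "t \<in> effdom \<phi>" "s * fst p - snd p \<le> s * t - real_phi \<phi> t"
    "real_conjugate \<phi> s - 1 \<le> s * fst p - snd p"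
    using \<open>p \<in> A\<close> by (auto simp: t_def A_def epigraph_def)
  have "s * t' - real_phi \<phi> t' \<le> s * t - real_phi \<phi> t" if "t' \<in> effdom \<phi>" for t'
    using in_A[OF that] maximal t_maximal by fastforce
  then have "conjugate \<phi> s \<le> ereal (s * t - real_phi \<phi> t)"
    unfolding conjugate_eq_SUP by (intro SUP_least) simp
  then show thesis using that[OF t_maximal(1)] Fenchel_Young[OF t_maximal(1), of s]
    by (simp add: conjugate_eq_ereal)
qed

lemma deriv_conjugate_in_effdom: "deriv (real_conjugate \<phi>) s \<in> effdom \<phi>"
  and Fenchel_Young_deriv: "real_conjugate \<phi> s
    = s * deriv (real_conjugate \<phi>) s - real_phi \<phi> (deriv (real_conjugate \<phi>) s)"
proof -
  obtain t where attained: "t \<in> effdom \<phi>" "real_conjugate \<phi> s = s * t - real_phi \<phi> t"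
    by (rule conjugate_attained)
  have "((\<lambda>s. real_conjugate \<phi> s - t * s) has_real_derivative deriv (real_conjugate \<phi>) s - t) (at s)"
    by (auto intro!: derivative_eq_intros real_conjugate_has_real_derivative)
  moreover have "\<forall>s'. \<bar>s - s'\<bar> < 1 \<longrightarrow> real_conjugate \<phi> s - t * s \<le> real_conjugate \<phi> s' - t * s'"
    using Fenchel_Young[OF attained(1)] by (simp add: attained(2) algebra_simps)
  ultimately have "deriv (real_conjugate \<phi>) s - t = 0" by (rule DERIV_local_min[OF _ zero_less_one])
  then have "deriv (real_conjugate \<phi>) s = t" by simp
  then show "deriv (real_conjugate \<phi>) s \<in> effdom \<phi>"
    "real_conjugate \<phi> s = s * deriv (real_conjugate \<phi>) s - real_phi \<phi> (deriv (real_conjugate \<phi>) s)"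
    using attained by auto
qed

lemma measurable_real_conjugate [measurable]: "real_conjugate \<phi> \<in> borel_measurable borel"
  using real_conjugate_has_real_derivative DERIV_isCont
  by (intro borel_measurable_continuous_onI continuous_at_imp_continuous_on) blast

lemma measurable_deriv_real_conjugate [measurable]: "deriv (real_conjugate \<phi>) \<in> borel_measurable borel"
proof (rule borel_measurable_LIMSEQ_real)
  fix s
  have "filterlim (\<lambda>n. inverse (real (Suc n))) (at 0) sequentially"
    using LIMSEQ_inverse_real_of_nat by (simp add: filterlim_at)
  with real_conjugate_has_real_derivative[of s]
  show "(\<lambda>n. (real_conjugate \<phi> (s + inverse (real (Suc n))) - real_conjugate \<phi> s) / inverse (real (Suc n)))
      \<longlonglongrightarrow> deriv (real_conjugate \<phi>) s"
    unfolding DERIV_def by (rule filterlim_compose)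
qed measurable

end

section \<open>Densities\<close>

lemma RN_deriv_real_density:
  fixes y :: "'a \<Rightarrow> real"
  assumes "sigma_finite_measure P" "y \<in> borel_measurable P" "\<And>\<omega>. 0 \<le> y \<omega>"
  shows "AE \<omega> in P. enn2real (RN_deriv P (density P (\<lambda>\<omega>. ennreal (y \<omega>))) \<omega>) = y \<omega>"
proof -
  have "AE \<omega> in P. ennreal (y \<omega>) = RN_deriv P (density P (\<lambda>\<omega>. ennreal (y \<omega>))) \<omega>"
    by (rule sigma_finite_measure.RN_deriv_unique[OF assms(1)]) (use assms(2) in auto)
  then show ?thesis by eventually_elim (metis assms(3) enn2real_ennreal)
qed

lemma phi_div_density:
  fixes y :: "'a \<Rightarrow> real"
  assumes "sigma_finite_measure P" "y \<in> borel_measurable P" "\<And>\<omega>. 0 \<le> y \<omega>"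
  shows "phi_div \<phi> (density P (\<lambda>\<omega>. ennreal (y \<omega>))) P = (\<integral>\<^sup>+\<omega>. \<phi> (y \<omega>) \<partial>P)"
proof -
  have "absolutely_continuous P (density P (\<lambda>\<omega>. ennreal (y \<omega>)))"
    using assms(2) by (intro absolutely_continuousI_density) auto
  moreover have "(\<integral>\<^sup>+\<omega>. \<phi> (enn2real (RN_deriv P (density P (\<lambda>\<omega>. ennreal (y \<omega>))) \<omega>)) \<partial>P) = (\<integral>\<^sup>+\<omega>. \<phi> (y \<omega>) \<partial>P)"
    by (intro nn_integral_cong_AE) (use RN_deriv_real_density[OF assms] in eventually_elim, simp)
  ultimately show ?thesis by (simp add: phi_div_def)
qed

lemma prob_space_density_iff:
  fixes z :: "'a \<Rightarrow> real"
  assumes [measurable]: "z \<in> borel_measurable P" and z_nonneg: "\<And>\<omega>. 0 \<le> z \<omega>"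
  shows "prob_space (density P (\<lambda>\<omega>. ennreal (z \<omega>))) \<longleftrightarrow> integrable P z \<and> (\<integral>\<omega>. z \<omega> \<partial>P) = 1"
proof -
  have "emeasure (density P (\<lambda>\<omega>. ennreal (z \<omega>))) (space (density P (\<lambda>\<omega>. ennreal (z \<omega>))))
      = (\<integral>\<^sup>+\<omega>. ennreal (z \<omega>) \<partial>P)"
    by (simp add: emeasure_density cong: nn_integral_cong)
  then have "prob_space (density P (\<lambda>\<omega>. ennreal (z \<omega>))) \<longleftrightarrow> (\<integral>\<^sup>+\<omega>. ennreal (z \<omega>) \<partial>P) = 1"
    using prob_spaceI prob_space.emeasure_space_1 by metis
  also have "\<dots> \<longleftrightarrow> integrable P z \<and> (\<integral>\<omega>. z \<omega> \<partial>P) = 1"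
    using z_nonneg by (auto simp: nn_integral_eq_integral integral_eq_nn_integral intro!: integrableI_nonneg)
  finally show ?thesis .
qed

lemma feasible_l_density:
  assumes "sigma_finite_measure P" and Q_feasible: "Q \<in> feasible_l P"
  obtains z :: "'a \<Rightarrow> real" where "z \<in> borel_measurable P" "\<And>\<omega>. 0 \<le> z \<omega>" "Q = density P (\<lambda>\<omega>. ennreal (z \<omega>))"
proof -
  interpret P: sigma_finite_measure P by fact
  have Q_parts: "absolutely_continuous P Q" "sets Q = sets P" "prob_space Q"
    using Q_feasible by (auto simp: feasible_l_def prob_on_def)
  then obtain z where z_density: "z \<in> borel_measurable P" "AE \<omega> in P. RN_deriv P Q \<omega> = ennreal (z \<omega>)"
      "\<And>\<omega>. 0 \<le> z \<omega>"
    using P.real_RN_deriv[of Q] prob_space.finite_measure by metis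
  have "density P (RN_deriv P Q) = density P (\<lambda>\<omega>. ennreal (z \<omega>))"
    using z_density(1,2) by (intro density_cong) auto
  then show thesis using that[OF z_density(1,3)] P.density_RN_deriv[OF Q_parts(1,2)] by simp
qed

lemma density_in_feasible_l:
  fixes z :: "'a \<Rightarrow> real"
  assumes "z \<in> borel_measurable P" "\<And>\<omega>. 0 \<le> z \<omega>" "prob_space (density P (\<lambda>\<omega>. ennreal (z \<omega>)))"
  shows "density P (\<lambda>\<omega>. ennreal (z \<omega>)) \<in> feasible_l P"
  using assms by (auto simp: feasible_l_def prob_on_def intro!: absolutely_continuousI_density)

lemma density_density_mult:
  fixes z y :: "'a \<Rightarrow> real"
  assumes [measurable]: "z \<in> borel_measurable P" "y \<in> borel_measurable P" and "\<And>\<omega>. 0 \<le> z \<omega>"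
  shows "density (density P (\<lambda>\<omega>. ennreal (z \<omega>))) (\<lambda>\<omega>. ennreal (y \<omega>)) = density P (\<lambda>\<omega>. ennreal (z \<omega> * y \<omega>))"
  using assms(3) by (subst density_density_eq) (auto simp: ennreal_mult' intro!: density_cong)

section \<open>The robust optimized certainty equivalent\<close>

locale oce = prob_space P0 + d1: divergence_function \<phi>1 + d2: divergence_function \<phi>2
  for P0 :: "'a measure" and \<phi>1 \<phi>2 +
  fixes X :: "'a \<Rightarrow> real"
  assumes integrable_X: "integrable P0 X"
begin

lemma measurable_X [measurable]: "X \<in> borel_measurable P0"
  using integrable_X by auto

lemma measurable_compose_phi [measurable (raw)]:
  "y \<in> borel_measurable M \<Longrightarrow> (\<lambda>\<omega>. \<phi>1 (y \<omega>)) \<in> borel_measurable M"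
  "y \<in> borel_measurable M \<Longrightarrow> (\<lambda>\<omega>. \<phi>2 (y \<omega>)) \<in> borel_measurable M"
  by (auto intro: measurable_compose d1.measurable_phi d2.measurable_phi)

definition payoff :: "real \<Rightarrow> ('a \<Rightarrow> real) \<Rightarrow> ('a \<Rightarrow> real) \<Rightarrow> 'a \<Rightarrow> ereal" where
  "payoff lam z y \<omega> = ereal (- X \<omega> * (z \<omega> * y \<omega>))
    - enn2ereal (ennreal (z \<omega>) * \<phi>1 (y \<omega>) + ennreal lam * \<phi>2 (z \<omega>))"

lemma measurable_payoff [measurable]:
  assumes [measurable]: "z \<in> borel_measurable P0" "y \<in> borel_measurable P0"
  shows "payoff lam z y \<in> borel_measurable P0"
  unfolding payoff_def by measurable

lemma payoff_eq_ereal: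
  assumes "0 \<le> lam" "0 \<le> z \<omega>" "z \<omega> \<in> effdom \<phi>2" "z \<omega> = 0 \<or> y \<omega> \<in> effdom \<phi>1"
  shows "payoff lam z y \<omega>
    = ereal (- X \<omega> * (z \<omega> * y \<omega>) - z \<omega> * real_phi \<phi>1 (y \<omega>) - lam * real_phi \<phi>2 (z \<omega>))"
proof -
  have "ennreal (z \<omega>) * \<phi>1 (y \<omega>) = ennreal (z \<omega> * real_phi \<phi>1 (y \<omega>))"
    using assms by (auto simp: phi_eq_ennreal ennreal_mult)
  moreover have "ennreal lam * \<phi>2 (z \<omega>) = ennreal (lam * real_phi \<phi>2 (z \<omega>))"
    using assms by (simp add: phi_eq_ennreal ennreal_mult)
  ultimately show ?thesis using assms by (simp add: payoff_def flip: ennreal_plus)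
qed

lemma payoff_eq_MInf:
  assumes "0 < z \<omega> \<and> y \<omega> \<notin> effdom \<phi>1 \<or> 0 < lam \<and> z \<omega> \<notin> effdom \<phi>2"
  shows "payoff lam z y \<omega> = - \<infinity>"
  using assms by (auto simp: payoff_def phi_eq_infinity ennreal_mult_top)

subsection \<open>The dual integrand\<close>

text \<open>The pair \<open>(t, y)\<close> stands for the values of \<open>dQ/dP0\<close> and \<open>dQ'/dQ\<close> at \<open>\<omega>\<close>.\<close>

definition lagrangian :: "(real \<times> real) \<times> real \<Rightarrow> 'a \<Rightarrow> real \<times> real \<Rightarrow> real" where
  "lagrangian = (\<lambda>((\<theta>1, \<theta>2), lam) \<omega> (t, y).
    t * (\<theta>1 + (\<theta>2 - X \<omega>) * y - real_phi \<phi>1 y) - lam * real_phi \<phi>2 t)"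

lemma integrable_lagrangian: "integrable P0 (\<lambda>\<omega>. lagrangian \<theta> \<omega> p)"
  unfolding lagrangian_def using integrable_X by (simp add: case_prod_beta)

lemma inner_conjugate_not_MInf: "conjugate \<phi>1 (\<theta>2 - X \<omega>) + ereal \<theta>1 \<noteq> - \<infinity>"
  using d1.conjugate_not_MInf by (cases "conjugate \<phi>1 (\<theta>2 - X \<omega>)") auto

lemma beta_s_closed_eq_SUP_effdom:
  assumes "0 \<le> lam"
  shows "beta_s_closed \<phi>1 \<phi>2 X \<omega> ((\<theta>1, \<theta>2), lam)
    = (SUP t\<in>effdom \<phi>2. (conjugate \<phi>1 (\<theta>2 - X \<omega>) + ereal \<theta>1) * ereal t - ereal (lam * real_phi \<phi>2 t))"
  using assms d2.conjugate_persp_pos_eq_SUP[OF _ inner_conjugate_not_MInf]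
  by (auto simp: beta_s_closed_def beta_s_def simp flip: zero_ereal_def)

lemma beta_s_closed_eq_SUP_lagrangian:
  assumes "0 \<le> lam"
  shows "beta_s_closed \<phi>1 \<phi>2 X \<omega> (\<theta>, lam)
    = (SUP p\<in>effdom \<phi>2 \<times> effdom \<phi>1. ereal (lagrangian (\<theta>, lam) \<omega> p))"
proof -
  obtain \<theta>1 \<theta>2 where theta_eq: "\<theta> = (\<theta>1, \<theta>2)" by (cases \<theta>)
  have nonempty: "effdom \<phi>1 \<noteq> {}" using d1.one_in_effdom by auto
  have inner_eq_SUP: "conjugate \<phi>1 (\<theta>2 - X \<omega>) + ereal \<theta>1
      = (SUP y\<in>effdom \<phi>1. ereal (\<theta>1 + (\<theta>2 - X \<omega>) * y - real_phi \<phi>1 y))"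
    unfolding d1.conjugate_eq_SUP
    by (subst SUP_ereal_add_left[symmetric]) (auto simp: nonempty algebra_simps)
  have "(conjugate \<phi>1 (\<theta>2 - X \<omega>) + ereal \<theta>1) * ereal t - ereal (lam * real_phi \<phi>2 t)
      = (SUP y\<in>effdom \<phi>1. ereal (lagrangian (\<theta>, lam) \<omega> (t, y)))" if "t \<in> effdom \<phi>2" for t
    unfolding inner_eq_SUP Sup_ereal_mult_right'[OF nonempty d2.effdom_nonneg[OF that]]
    by (subst SUP_ereal_minus_left[OF nonempty, symmetric]) (auto simp: lagrangian_def theta_eq mult.commute)
  then show ?thesis
    unfolding theta_eq beta_s_closed_eq_SUP_effdom[OF assms] by (simp add: SUP_pair flip: Sigma_def)
qed

lemma lagrangian_le_beta_s_closed:
  assumes "0 \<le> lam" "t \<in> effdom \<phi>2" "y \<in> effdom \<phi>1"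
  shows "ereal (lagrangian (\<theta>, lam) \<omega> (t, y)) \<le> beta_s_closed \<phi>1 \<phi>2 X \<omega> (\<theta>, lam)"
  unfolding beta_s_closed_eq_SUP_lagrangian[OF assms(1)] by (rule SUP_upper) (use assms in auto)

lemma beta_s_closed_antimono:
  assumes "0 \<le> lam"
  shows "beta_s_closed \<phi>1 \<phi>2 X \<omega> (\<theta>, lam) \<le> beta_s_closed \<phi>1 \<phi>2 X \<omega> (\<theta>, 0)"
  unfolding beta_s_closed_eq_SUP_lagrangian[OF assms] beta_s_closed_eq_SUP_lagrangian[OF order_refl]
  using assms by (intro SUP_mono') (auto simp: lagrangian_def split: prod.splits)

lemma beta_s_closed_le_beta_s: "beta_s_closed \<phi>1 \<phi>2 X \<omega> (\<theta>, lam) \<le> beta_s \<phi>1 \<phi>2 X \<omega> (\<theta>, lam)"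
  by (cases \<theta>) (simp add: beta_s_closed_def beta_s_def d2.SUP_le_conjugate_persp_0)

lemma beta_s_eq_beta_s_closed:
  assumes "lam \<noteq> 0 \<or> {0<..} \<subseteq> effdom \<phi>2"
  shows "beta_s \<phi>1 \<phi>2 X \<omega> (\<theta>, lam) = beta_s_closed \<phi>1 \<phi>2 X \<omega> (\<theta>, lam)"
  using assms d2.conjugate_persp_0_eq_SUP[OF _ inner_conjugate_not_MInf]
  by (cases \<theta>) (auto simp: beta_s_closed_def beta_s_def)

lemma beta_l_eq_beta_s_closed: "beta_l \<phi>1 \<phi>2 X \<omega> \<theta> = beta_s_closed \<phi>1 \<phi>2 X \<omega> (\<theta>, 1)"
  by (cases \<theta>) (simp add: beta_s_closed_def beta_s_def beta_l_def conjugate_persp_def flip: one_ereal_def)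

lemma eexpect_beta_s_closed_not_MInf:
  assumes "0 \<le> lam"
  shows "eexpect P0 (\<lambda>\<omega>. beta_s_closed \<phi>1 \<phi>2 X \<omega> (\<theta>, lam)) \<noteq> - \<infinity>"
proof -
  have "eexpect P0 (\<lambda>\<omega>. ereal (lagrangian (\<theta>, lam) \<omega> (1, 1)))
      \<le> eexpect P0 (\<lambda>\<omega>. beta_s_closed \<phi>1 \<phi>2 X \<omega> (\<theta>, lam))"
    using assms d1.one_in_effdom d2.one_in_effdom
    by (intro eexpect_mono_AE AE_I2 lagrangian_le_beta_s_closed)
  then show ?thesis by (auto simp: eexpect_ereal integrable_lagrangian)
qed

subsection \<open>The dual objectives\<close>

text \<open>The value \<open>r = 0\<close>, which is not admissible in the constrained problem, gives the dual of \<open>(P_l)\<close>.\<close>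

lemma dual_l_eq_dual_s_closed: "dual_l P0 \<phi>1 \<phi>2 X \<theta> = dual_s_closed P0 \<phi>1 \<phi>2 0 X (\<theta>, 1)"
  by (cases \<theta>) (simp add: dual_l_def dual_s_closed_def beta_l_eq_beta_s_closed)

lemma dual_s_closed_eq: "dual_s_closed P0 \<phi>1 \<phi>2 r X (\<theta>, lam)
    = eexpect P0 (\<lambda>\<omega>. beta_s_closed \<phi>1 \<phi>2 X \<omega> (\<theta>, lam)) + ereal (lam * r - \<theta> \<bullet> (1, 1))"
  by (cases \<theta>) (simp add: dual_s_closed_def algebra_simps)

lemma dual_s_closed_eq_add: "dual_s_closed P0 \<phi>1 \<phi>2 r X (\<theta>, lam)
    = dual_s_closed P0 \<phi>1 \<phi>2 0 X (\<theta>, lam) + ereal (lam * r)"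
  by (cases \<theta>) (simp add: dual_s_closed_def ac_simps flip: plus_ereal.simps(1))

lemma dual_s_closed_le_dual_s: "dual_s_closed P0 \<phi>1 \<phi>2 r X (\<theta>, lam) \<le> dual_s P0 \<phi>1 \<phi>2 r X (\<theta>, lam)"
  by (cases \<theta>)
    (simp add: dual_s_def dual_s_closed_def add_left_mono eexpect_mono_AE beta_s_closed_le_beta_s)

lemma dual_s_eq_dual_s_closed:
  assumes "lam \<noteq> 0 \<or> {0<..} \<subseteq> effdom \<phi>2"
  shows "dual_s P0 \<phi>1 \<phi>2 r X (\<theta>, lam) = dual_s_closed P0 \<phi>1 \<phi>2 r X (\<theta>, lam)"
  using beta_s_eq_beta_s_closed[OF assms] by (cases \<theta>) (simp add: dual_s_def dual_s_closed_def)

lemma dual_s_closed_antimono: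
  "0 \<le> lam \<Longrightarrow> dual_s_closed P0 \<phi>1 \<phi>2 0 X (\<theta>, lam) \<le> dual_s_closed P0 \<phi>1 \<phi>2 0 X (\<theta>, 0)"
  by (cases \<theta>) (simp add: dual_s_closed_def add_left_mono eexpect_mono_AE beta_s_closed_antimono)

end

subsection \<open>Weak duality\<close>

locale density_pair = oce P0 \<phi>1 \<phi>2 X
  for P0 :: "'a measure" and \<phi>1 \<phi>2 X +
  fixes z y :: "'a \<Rightarrow> real"
  assumes measurable_z [measurable]: "z \<in> borel_measurable P0"
    and measurable_y [measurable]: "y \<in> borel_measurable P0"
    and z_nonneg: "\<And>\<omega>. 0 \<le> z \<omega>" and y_nonneg: "\<And>\<omega>. 0 \<le> y \<omega>"
    and integrable_z: "integrable P0 z" and integral_z: "(\<integral>\<omega>. z \<omega> \<partial>P0) = 1"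
    and integrable_zy: "integrable P0 (\<lambda>\<omega>. z \<omega> * y \<omega>)" and integral_zy: "(\<integral>\<omega>. z \<omega> * y \<omega> \<partial>P0) = 1"
begin

abbreviation Q :: "'a measure" where "Q \<equiv> density P0 (\<lambda>\<omega>. ennreal (z \<omega>))"
abbreviation Q' :: "'a measure" where "Q' \<equiv> density P0 (\<lambda>\<omega>. ennreal (z \<omega> * y \<omega>))"

lemma Q'_eq_density_Q: "Q' = density Q (\<lambda>\<omega>. ennreal (y \<omega>))"
  by (simp add: density_density_mult z_nonneg)

lemma prob_space_Q: "prob_space Q" and prob_space_Q': "prob_space Q'"
  by (simp_all add: prob_space_density_iff z_nonneg y_nonneg integrable_z integral_z integrable_zy integral_zy)

lemma Q_feasible: "Q \<in> feasible_l P0"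
  using z_nonneg prob_space_Q by (intro density_in_feasible_l) auto

lemma Q'_feasible: "Q' \<in> feasible_l Q"
  unfolding Q'_eq_density_Q using y_nonneg prob_space_Q'
  by (intro density_in_feasible_l) (auto simp: Q'_eq_density_Q)

lemma sigma_finite_Q: "sigma_finite_measure Q"
  using prob_space_Q by (intro finite_measure.sigma_finite_measure prob_space.finite_measure)

lemma AE_RN_deriv_Q: "AE \<omega> in P0. enn2real (RN_deriv P0 Q \<omega>) = z \<omega>"
  by (rule RN_deriv_real_density) (auto simp: z_nonneg sigma_finite_measure_axioms)

lemma AE_RN_deriv_Q': "AE \<omega> in Q. enn2real (RN_deriv Q Q' \<omega>) = y \<omega>"
  unfolding Q'_eq_density_Q by (rule RN_deriv_real_density[OF sigma_finite_Q]) (auto simp: y_nonneg)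

lemma phi_div_Q: "phi_div \<phi>2 Q P0 = (\<integral>\<^sup>+\<omega>. \<phi>2 (z \<omega>) \<partial>P0)"
  by (rule phi_div_density) (auto simp: z_nonneg sigma_finite_measure_axioms)

lemma phi_div_Q': "phi_div \<phi>1 Q' Q = (\<integral>\<^sup>+\<omega>. ennreal (z \<omega>) * \<phi>1 (y \<omega>) \<partial>P0)"
proof -
  have "phi_div \<phi>1 Q' Q = (\<integral>\<^sup>+\<omega>. \<phi>1 (y \<omega>) \<partial>Q)"
    unfolding Q'_eq_density_Q by (rule phi_div_density[OF sigma_finite_Q]) (auto simp: y_nonneg)
  then show ?thesis by (simp add: nn_integral_density)
qed

lemma eexpect_Q': "eexpect Q' (\<lambda>\<omega>. ereal (- X \<omega>)) = eexpect P0 (\<lambda>\<omega>. ereal (- X \<omega> * (z \<omega> * y \<omega>)))"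
  by (subst eexpect_density) (auto simp: z_nonneg y_nonneg mult.commute)

text \<open>The convention in \<open>primal_l\<close> and \<open>primal_s\<close> for \<open>\<infinity> - \<infinity>\<close> makes both the expectation of a payoff.\<close>

lemma ediff_eq_eexpect_payoff:
  assumes "eexpect Q' (\<lambda>\<omega>. ereal (- X \<omega>)) \<noteq> \<infinity>
    \<or> (\<integral>\<^sup>+\<omega>. ennreal (z \<omega>) * \<phi>1 (y \<omega>) + ennreal lam * \<phi>2 (z \<omega>) \<partial>P0) \<noteq> \<infinity>"
  shows "ediff (eexpect Q' (\<lambda>\<omega>. ereal (- X \<omega>)))
      (enn2ereal (\<integral>\<^sup>+\<omega>. ennreal (z \<omega>) * \<phi>1 (y \<omega>) + ennreal lam * \<phi>2 (z \<omega>) \<partial>P0))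
    = eexpect P0 (payoff lam z y)"
  using assms unfolding eexpect_Q' payoff_def[abs_def] by (intro eexpect_diff_ennreal[symmetric]) auto

lemma primal_s_eq: "primal_s \<phi>1 X Q Q' = eexpect P0 (payoff 0 z y)"
proof -
  have "eexpect Q (\<lambda>\<omega>. let y = enn2real (RN_deriv Q Q' \<omega>) in ereal (- X \<omega> * y) - enn2ereal (\<phi>1 y))
      = eexpect Q (\<lambda>\<omega>. ereal (- X \<omega> * y \<omega>) - enn2ereal (\<phi>1 (y \<omega>)))"
    by (rule eexpect_cong_AE) (use AE_RN_deriv_Q' in eventually_elim, simp add: Let_def)
  also have "\<dots> = eexpect P0 (\<lambda>\<omega>. ereal (z \<omega>) * (ereal (- X \<omega> * y \<omega>) - enn2ereal (\<phi>1 (y \<omega>))))"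
    by (rule eexpect_density) (auto simp: z_nonneg)
  also have "\<dots> = eexpect P0 (payoff 0 z y)"
  proof (intro eexpect_cong_AE AE_I2)
    fix \<omega>
    show "ereal (z \<omega>) * (ereal (- X \<omega> * y \<omega>) - enn2ereal (\<phi>1 (y \<omega>))) = payoff 0 z y \<omega>"
      using z_nonneg[of \<omega>] by (cases "\<phi>1 (y \<omega>)"; cases "z \<omega> = 0")
        (auto simp: payoff_def times_ennreal.rep_eq algebra_simps zero_ennreal.rep_eq simp flip: zero_ereal_def)
  qed
  finally show ?thesis
    using ediff_eq_eexpect_payoff[of 0] by (auto simp: primal_s_def phi_div_Q' Let_def)
qed

lemma primal_l_eq: "primal_l P0 \<phi>1 \<phi>2 X Q Q' = eexpect P0 (payoff 1 z y)"
proof -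
  have "AE \<omega> in P0. 0 < z \<omega> \<longrightarrow> enn2real (RN_deriv Q Q' \<omega>) = y \<omega>"
    using AE_RN_deriv_Q' by (subst (asm) AE_density) auto
  then have "AE \<omega> in P0. (let z = enn2real (RN_deriv P0 Q \<omega>); y = enn2real (RN_deriv Q Q' \<omega>)
      in ereal (- X \<omega> * (z * y)) - ereal z * enn2ereal (\<phi>1 y) - enn2ereal (\<phi>2 z)) = payoff 1 z y \<omega>"
    using AE_RN_deriv_Q
  proof eventually_elim
    case (elim \<omega>)
    have "ereal a - enn2ereal b - enn2ereal c = ereal a - enn2ereal (b + c)" for a b c
      by (cases b; cases c) (auto simp: plus_ennreal.rep_eq algebra_simps)
    moreover have "ereal (z \<omega>) * enn2ereal (\<phi>1 y') = enn2ereal (ennreal (z \<omega>) * \<phi>1 y')" for y'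
      using z_nonneg[of \<omega>] by (simp add: times_ennreal.rep_eq)
    ultimately show ?case
      using elim z_nonneg[of \<omega>] by (cases "z \<omega> = 0") (auto simp: Let_def payoff_def)
  qed
  then have "eexpect P0 (\<lambda>\<omega>. let z = enn2real (RN_deriv P0 Q \<omega>); y = enn2real (RN_deriv Q Q' \<omega>)
      in ereal (- X \<omega> * (z * y)) - ereal z * enn2ereal (\<phi>1 y) - enn2ereal (\<phi>2 z)) = eexpect P0 (payoff 1 z y)"
    by (rule eexpect_cong_AE)
  moreover have "enn2ereal (phi_div \<phi>1 Q' Q) + enn2ereal (phi_div \<phi>2 Q P0)
      = enn2ereal (\<integral>\<^sup>+\<omega>. ennreal (z \<omega>) * \<phi>1 (y \<omega>) + ennreal 1 * \<phi>2 (z \<omega>) \<partial>P0)"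
    by (simp add: phi_div_Q phi_div_Q' nn_integral_add plus_ennreal.rep_eq)
  ultimately show ?thesis using ediff_eq_eexpect_payoff[of 1] by (auto simp: primal_l_def Let_def)
qed

lemma payoff_le_beta_s_closed:
  assumes lam_nonneg: "0 \<le> lam" and in_domain: "0 < lam \<or> z \<omega> \<in> effdom \<phi>2"
  shows "payoff lam z y \<omega> + ereal (\<theta>1 * z \<omega> + \<theta>2 * (z \<omega> * y \<omega>)) \<le> beta_s_closed \<phi>1 \<phi>2 X \<omega> ((\<theta>1, \<theta>2), lam)"
proof (cases "z \<omega> \<in> effdom \<phi>2 \<and> (z \<omega> = 0 \<or> y \<omega> \<in> effdom \<phi>1)")
  case True
  define y' where "y' = (if z \<omega> = 0 then 1 else y \<omega>)"
  have "y' \<in> effdom \<phi>1" using True d1.one_in_effdom by (auto simp: y'_def)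
  moreover have "payoff lam z y \<omega> + ereal (\<theta>1 * z \<omega> + \<theta>2 * (z \<omega> * y \<omega>))
      = ereal (lagrangian ((\<theta>1, \<theta>2), lam) \<omega> (z \<omega>, y'))"
    using True lam_nonneg z_nonneg by (simp add: payoff_eq_ereal lagrangian_def y'_def algebra_simps)
  ultimately show ?thesis using lagrangian_le_beta_s_closed[OF lam_nonneg] True by simp
next
  case False
  then have "payoff lam z y \<omega> = - \<infinity>"
    using in_domain z_nonneg[of \<omega>] by (intro payoff_eq_MInf) auto
  then show ?thesis by simp
qed

lemma eexpect_payoff_le_dual:
  assumes lam_nonneg: "0 \<le> lam" and in_domain: "0 < lam \<or> (AE \<omega> in P0. z \<omega> \<in> effdom \<phi>2)"
  shows "eexpect P0 (payoff lam z y) \<le> dual_s_closed P0 \<phi>1 \<phi>2 0 X (\<theta>, lam)"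
proof -
  obtain \<theta>1 \<theta>2 where theta_eq: "\<theta> = (\<theta>1, \<theta>2)" by (cases \<theta>)
  have "AE \<omega> in P0. 0 < lam \<or> z \<omega> \<in> effdom \<phi>2" using in_domain by auto
  then have "eexpect P0 (\<lambda>\<omega>. payoff lam z y \<omega> + ereal (\<theta>1 * z \<omega> + \<theta>2 * (z \<omega> * y \<omega>)))
      \<le> eexpect P0 (\<lambda>\<omega>. beta_s_closed \<phi>1 \<phi>2 X \<omega> (\<theta>, lam))"
    unfolding theta_eq by (intro eexpect_mono_AE)
      (auto elim!: eventually_mono intro: payoff_le_beta_s_closed lam_nonneg)
  moreover have "eexpect P0 (\<lambda>\<omega>. payoff lam z y \<omega> + ereal (\<theta>1 * z \<omega> + \<theta>2 * (z \<omega> * y \<omega>)))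
      = eexpect P0 (payoff lam z y) + ereal (\<theta>1 + \<theta>2)"
    by (simp add: eexpect_add_integrable integrable_z integral_z integrable_zy integral_zy)
  ultimately show ?thesis
    unfolding theta_eq dual_s_closed_def
    by (cases "eexpect P0 (payoff lam z y)";
        cases "eexpect P0 (\<lambda>\<omega>. beta_s_closed \<phi>1 \<phi>2 X \<omega> ((\<theta>1, \<theta>2), lam))") auto
qed

context
  fixes d :: real
  assumes d_nonneg: "0 \<le> d" and divergence_eq: "phi_div \<phi>2 Q P0 = ennreal d"
begin

lemma AE_z_in_effdom: "AE \<omega> in P0. z \<omega> \<in> effdom \<phi>2"
proof -
  have "AE \<omega> in P0. \<phi>2 (z \<omega>) \<noteq> \<infinity>"
    using divergence_eq by (intro nn_integral_noteq_infinite) (auto simp: phi_div_Q)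
  then show ?thesis by eventually_elim (use phi_eq_infinity in blast)
qed

lemma eexpect_payoff_0:
  assumes lam_nonneg: "0 \<le> lam"
  shows "eexpect P0 (payoff 0 z y) = eexpect P0 (payoff lam z y) + ereal (lam * d)"
proof -
  have [measurable]: "(\<lambda>\<omega>. real_phi \<phi>2 (z \<omega>)) \<in> borel_measurable P0"
    using measurable_compose[OF measurable_z d2.measurable_real_phi] .
  have "(\<integral>\<^sup>+\<omega>. ennreal (real_phi \<phi>2 (z \<omega>)) \<partial>P0) = (\<integral>\<^sup>+\<omega>. \<phi>2 (z \<omega>) \<partial>P0)"
    by (rule nn_integral_cong_AE) (use AE_z_in_effdom in eventually_elim, simp add: phi_eq_ennreal)
  then have "(\<integral>\<^sup>+\<omega>. ennreal (real_phi \<phi>2 (z \<omega>)) \<partial>P0) = ennreal d"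
    using divergence_eq by (simp add: phi_div_Q)
  then have integral_phi2: "integrable P0 (\<lambda>\<omega>. real_phi \<phi>2 (z \<omega>))" "(\<integral>\<omega>. real_phi \<phi>2 (z \<omega>) \<partial>P0) = d"
    using d_nonneg by (auto intro!: integrableI_nonneg simp: integral_eq_nn_integral)
  have "AE \<omega> in P0. payoff 0 z y \<omega> = payoff lam z y \<omega> + ereal (lam * real_phi \<phi>2 (z \<omega>))"
    using AE_z_in_effdom
  proof eventually_elim
    case (elim \<omega>)
    show ?case
    proof (cases "z \<omega> = 0 \<or> y \<omega> \<in> effdom \<phi>1")
      case True
      then show ?thesis using elim lam_nonneg z_nonneg by (simp add: payoff_eq_ereal)
    next
      case False
      then show ?thesis using z_nonneg[of \<omega>] by (simp add: payoff_eq_MInf)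
    qed
  qed
  then have "eexpect P0 (payoff 0 z y) = eexpect P0 (\<lambda>\<omega>. payoff lam z y \<omega> + ereal (lam * real_phi \<phi>2 (z \<omega>)))"
    by (rule eexpect_cong_AE)
  also have "\<dots> = eexpect P0 (payoff lam z y) + ereal (lam * d)"
    using integral_phi2 by (simp add: eexpect_add_integrable)
  finally show ?thesis .
qed

end

end

context oce
begin

lemma feasible_pair_densities:
  assumes Q_in: "Q \<in> feasible_l P0" and Q'_in: "Q' \<in> feasible_l Q"
  obtains z y where "density_pair P0 \<phi>1 \<phi>2 X z y" "Q = density P0 (\<lambda>\<omega>. ennreal (z \<omega>))"
    "Q' = density P0 (\<lambda>\<omega>. ennreal (z \<omega> * y \<omega>))"
proof -
  have prob: "prob_space Q" "prob_space Q'" and sets_Q: "sets Q = sets P0"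
    using Q_in Q'_in by (auto simp: feasible_l_def prob_on_def)
  then have "sigma_finite_measure Q"
    by (intro finite_measure.sigma_finite_measure prob_space.finite_measure)
  then obtain y :: "'a \<Rightarrow> real" where y_density: "y \<in> borel_measurable Q" "\<And>\<omega>. 0 \<le> y \<omega>"
    and Q'_y: "Q' = density Q (\<lambda>\<omega>. ennreal (y \<omega>))" using Q'_in by (rule feasible_l_density) blast
  obtain z :: "'a \<Rightarrow> real" where z_density: "z \<in> borel_measurable P0" "\<And>\<omega>. 0 \<le> z \<omega>"
    and Q_z: "Q = density P0 (\<lambda>\<omega>. ennreal (z \<omega>))"
    using sigma_finite_measure_axioms Q_in by (rule feasible_l_density) blast
  have measurable_y: "y \<in> borel_measurable P0" using y_density(1) measurable_cong_sets[OF sets_Q refl] by blast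
  have Q'_zy: "Q' = density P0 (\<lambda>\<omega>. ennreal (z \<omega> * y \<omega>))"
    unfolding Q'_y Q_z using z_density(1) measurable_y z_density(2) by (rule density_density_mult)
  have "density_pair P0 \<phi>1 \<phi>2 X z y"
    using prob_space_density_iff[of z P0] prob_space_density_iff[of "\<lambda>\<omega>. z \<omega> * y \<omega>" P0]
      prob z_density y_density measurable_y
    by unfold_locales (auto simp: Q_z Q'_zy)
  then show thesis using Q_z Q'_zy by (rule that)
qed

lemma weak_duality_l:
  assumes "Q \<in> feasible_l P0" "Q' \<in> feasible_l Q"
  shows "primal_l P0 \<phi>1 \<phi>2 X Q Q' \<le> dual_l P0 \<phi>1 \<phi>2 X \<theta>"
proof -
  obtain z y where "density_pair P0 \<phi>1 \<phi>2 X z y" and densities: "Q = density P0 (\<lambda>\<omega>. ennreal (z \<omega>))"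
    "Q' = density P0 (\<lambda>\<omega>. ennreal (z \<omega> * y \<omega>))"
    using assms by (rule feasible_pair_densities)
  then interpret density_pair P0 \<phi>1 \<phi>2 X z y by simp
  show ?thesis
    unfolding densities primal_l_eq dual_l_eq_dual_s_closed by (rule eexpect_payoff_le_dual) auto
qed

lemma feasible_s_subset_feasible_l: "Q \<in> feasible_s P0 \<phi>2 r \<Longrightarrow> Q \<in> feasible_l P0"
  by (auto simp: feasible_s_def feasible_l_def phi_div_def top_unique split: if_splits)

lemma weak_duality_s:
  assumes Q_in: "Q \<in> feasible_s P0 \<phi>2 r" and Q'_in: "Q' \<in> feasible_l Q"
    and lam_nonneg: "0 \<le> lam" and r_pos: "0 < r"
  shows "primal_s \<phi>1 X Q Q' \<le> dual_s_closed P0 \<phi>1 \<phi>2 r X (\<theta>, lam)"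
proof -
  obtain z y where "density_pair P0 \<phi>1 \<phi>2 X z y" and densities: "Q = density P0 (\<lambda>\<omega>. ennreal (z \<omega>))"
    "Q' = density P0 (\<lambda>\<omega>. ennreal (z \<omega> * y \<omega>))"
    using feasible_s_subset_feasible_l[OF Q_in] Q'_in by (rule feasible_pair_densities)
  then interpret density_pair P0 \<phi>1 \<phi>2 X z y by simp
  have "phi_div \<phi>2 Q P0 \<le> ennreal r" using Q_in by (simp add: feasible_s_def)
  then obtain d where divergence: "0 \<le> d" "phi_div \<phi>2 Q P0 = ennreal d" "d \<le> r"
    using r_pos by (cases "phi_div \<phi>2 Q P0") (auto simp: top_unique)
  note divergence_Q = divergence(1) divergence(2)[unfolded densities(1)]
  have "primal_s \<phi>1 X Q Q' = eexpect P0 (payoff lam z y) + ereal (lam * d)"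
    unfolding densities primal_s_eq by (rule eexpect_payoff_0[OF divergence_Q lam_nonneg])
  also have "\<dots> \<le> dual_s_closed P0 \<phi>1 \<phi>2 0 X (\<theta>, lam) + ereal (lam * r)"
    using lam_nonneg divergence(3) AE_z_in_effdom[OF divergence_Q]
    by (intro add_mono eexpect_payoff_le_dual) (auto intro: mult_left_mono)
  finally show ?thesis by (simp add: dual_s_closed_eq_add[of r])
qed

lemma rho_l_le_dual_l: "rho_l P0 \<phi>1 \<phi>2 X \<le> dual_l P0 \<phi>1 \<phi>2 X \<theta>"
  unfolding rho_l_def by (intro SUP_least weak_duality_l)

lemma rho_s_le_dual_s_closed:
  "0 < r \<Longrightarrow> 0 \<le> lam \<Longrightarrow> rho_s P0 \<phi>1 \<phi>2 r X \<le> dual_s_closed P0 \<phi>1 \<phi>2 r X (\<theta>, lam)"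
  unfolding rho_s_def by (intro SUP_least weak_duality_s)

subsection \<open>Strong duality\<close>

definition density_values :: "(real \<times> real) set" where
  "density_values = perspective_domain (effdom \<phi>2) (effdom \<phi>1)"

definition reward :: "'a \<Rightarrow> real \<times> real \<Rightarrow> real" where
  "reward \<omega> p = - X \<omega> * snd p - perspective (real_phi \<phi>1) p"

lemma convex_on_perspective_phi1: "convex_on density_values (perspective (real_phi \<phi>1))"
  unfolding density_values_def using d2.effdom_nonneg
  by (intro convex_on_perspective d1.convex_on_real_phi convex_on_imp_convex[OF d2.convex_on_real_phi]) auto

lemma convex_density_values: "convex density_values"
  using convex_on_perspective_phi1 by (rule convex_on_imp_convex)

lemma concave_on_reward: "concave_on density_values (reward \<omega>)"
proof -
  have "concave_on density_values (\<lambda>p. - X \<omega> * snd p)"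
    using convex_density_values by (simp add: concave_on_iff algebra_simps)
  then show ?thesis unfolding reward_def[abs_def] using convex_on_perspective_phi1 by (rule concave_on_diff)
qed

lemma convex_on_phi2_fst: "convex_on density_values (\<lambda>p. real_phi \<phi>2 (fst p))"
  using d2.convex_on_real_phi convex_density_values
  by (fastforce simp: convex_on_def density_values_def perspective_domain_def)

lemma density_valuesE:
  assumes "p \<in> density_values"
  obtains t y where "t \<in> effdom \<phi>2" "y \<in> effdom \<phi>1" "p = (t, t * y)"
  using assms by (auto simp: density_values_def perspective_domain_def)

lemma integrable_reward: "integrable P0 (\<lambda>\<omega>. reward \<omega> p)"
  unfolding reward_def using integrable_X by simp

sublocale constrained: concave_program P0 density_values reward "\<lambda>p. real_phi \<phi>2 (fst p)"
  by unfold_locales (rule concave_on_reward convex_on_phi2_fst integrable_reward)+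

sublocale penalized: concave_program P0 density_values "\<lambda>\<omega> p. reward \<omega> p - real_phi \<phi>2 (fst p)" "\<lambda>_. 0"
  using convex_density_values
  by unfold_locales (auto intro!: concave_on_diff concave_on_reward convex_on_phi2_fst
      Bochner_Integration.integrable_diff integrable_reward simp: convex_on_const)

lemma one_in_interior_density_values: "(1, 1) \<in> interior density_values"
  using interior_perspective_domain[OF d2.one_in_interior_effdom _ d1.one_in_interior_effdom]
  by (simp add: density_values_def)

lemma SUP_reward_eq_beta_s_closed:
  assumes "0 \<le> lam"
  shows "(SUP p\<in>density_values. ereal (reward \<omega> p + \<theta> \<bullet> p - lam * real_phi \<phi>2 (fst p)))
    = beta_s_closed \<phi>1 \<phi>2 X \<omega> (\<theta>, lam)"
proof -
  have "reward \<omega> (t, t * y) + \<theta> \<bullet> (t, t * y) - lam * real_phi \<phi>2 t = lagrangian (\<theta>, lam) \<omega> (t, y)" for t y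
    using perspective_scaleR[of "real_phi \<phi>1" t y]
    by (cases \<theta>) (simp add: reward_def lagrangian_def algebra_simps)
  then show ?thesis
    by (simp add: beta_s_closed_eq_SUP_lagrangian[OF assms] density_values_def perspective_domain_def
        image_image case_prod_beta)
qed

lemma selection_density_pair:
  assumes selected: "s \<in> constrained.selections" and mean: "(\<integral>\<omega>. s \<omega> \<partial>P0) = (1, 1)"
  defines "z \<equiv> \<lambda>\<omega>. fst (s \<omega>)" and "y \<equiv> \<lambda>\<omega>. snd (s \<omega>) / fst (s \<omega>)"
  shows "density_pair P0 \<phi>1 \<phi>2 X z y"
    and "0 \<le> lam \<Longrightarrow> payoff lam z y \<omega> = ereal (reward \<omega> (s \<omega>) - lam * real_phi \<phi>2 (fst (s \<omega>)))"
proof -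
  have s_values: "s \<omega> \<in> density_values" for \<omega> using selected by (auto simp: constrained.selections_def)
  have nonneg: "0 \<le> z \<omega>" "0 \<le> y \<omega>" and zy_eq: "z \<omega> * y \<omega> = snd (s \<omega>)" for \<omega>
    by (rule density_valuesE[OF s_values[of \<omega>]];
        use d1.effdom_nonneg d2.effdom_nonneg in \<open>simp add: z_def y_def\<close>)+
  note integrable_s = constrained.integrable_selection(1)[OF selected]
  have [measurable]: "s \<in> borel_measurable P0" using integrable_s by (rule borel_measurable_integrable)
  have "(\<integral>\<omega>. fst (s \<omega>) \<partial>P0) = 1" "(\<integral>\<omega>. snd (s \<omega>) \<partial>P0) = 1"
    using integral_bounded_linear[OF bounded_linear_fst integrable_s]
      integral_bounded_linear[OF bounded_linear_snd integrable_s]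
    by (simp_all add: mean)
  moreover have "integrable P0 (\<lambda>\<omega>. fst (s \<omega>))" "integrable P0 (\<lambda>\<omega>. snd (s \<omega>))"
    using integrable_s by (auto intro: integrable_bounded_linear bounded_linear_fst bounded_linear_snd)
  ultimately show "density_pair P0 \<phi>1 \<phi>2 X z y"
    by unfold_locales (auto simp: nonneg zy_eq, auto simp: z_def y_def)
  assume lam_nonneg: "0 \<le> lam"
  obtain t u where tu_values: "t \<in> effdom \<phi>2" "u \<in> effdom \<phi>1" "s \<omega> = (t, t * u)"
    using s_values by (rule density_valuesE)
  have "payoff lam z y \<omega> = ereal (- X \<omega> * (z \<omega> * y \<omega>) - z \<omega> * real_phi \<phi>1 (y \<omega>) - lam * real_phi \<phi>2 (z \<omega>))"
    using lam_nonneg tu_values d2.effdom_nonneg[OF tu_values(1)]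
    by (intro payoff_eq_ereal) (auto simp: z_def y_def)
  then show "payoff lam z y \<omega> = ereal (reward \<omega> (s \<omega>) - lam * real_phi \<phi>2 (fst (s \<omega>)))"
    using perspective_scaleR[of "real_phi \<phi>1" t u]
    by (cases "t = 0") (simp_all add: z_def y_def tu_values(3) reward_def)
qed

lemma le_rho_l:
  assumes selected: "s \<in> penalized.selections" and mean: "(\<integral>\<omega>. s \<omega> \<partial>P0) = (1, 1)"
  shows "ereal (\<integral>\<omega>. reward \<omega> (s \<omega>) - real_phi \<phi>2 (fst (s \<omega>)) \<partial>P0) \<le> rho_l P0 \<phi>1 \<phi>2 X"
proof -
  interpret density_pair P0 \<phi>1 \<phi>2 X "\<lambda>\<omega>. fst (s \<omega>)" "\<lambda>\<omega>. snd (s \<omega>) / fst (s \<omega>)"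
    using selected mean by (rule selection_density_pair)
  have "ereal (\<integral>\<omega>. reward \<omega> (s \<omega>) - real_phi \<phi>2 (fst (s \<omega>)) \<partial>P0)
      = eexpect P0 (\<lambda>\<omega>. ereal (reward \<omega> (s \<omega>) - real_phi \<phi>2 (fst (s \<omega>))))"
    using penalized.integrable_selection(3)[OF selected] by (rule eexpect_ereal[symmetric])
  also have "\<dots> = primal_l P0 \<phi>1 \<phi>2 X Q Q'"
    unfolding primal_l_eq
    by (rule eexpect_cong_AE, rule AE_I2) (simp add: selection_density_pair(2)[OF selected mean])
  also have "\<dots> \<le> rho_l P0 \<phi>1 \<phi>2 X"
    unfolding rho_l_def by (rule SUP_upper2[OF Q_feasible], rule SUP_upper[OF Q'_feasible])
  finally show ?thesis .
qed

lemma le_rho_s: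
  assumes selected: "s \<in> constrained.selections" and mean: "(\<integral>\<omega>. s \<omega> \<partial>P0) = (1, 1)"
    and cost_le: "(\<integral>\<omega>. real_phi \<phi>2 (fst (s \<omega>)) \<partial>P0) \<le> r"
  shows "ereal (\<integral>\<omega>. reward \<omega> (s \<omega>) \<partial>P0) \<le> rho_s P0 \<phi>1 \<phi>2 r X"
proof -
  interpret density_pair P0 \<phi>1 \<phi>2 X "\<lambda>\<omega>. fst (s \<omega>)" "\<lambda>\<omega>. snd (s \<omega>) / fst (s \<omega>)"
    using selected mean by (rule selection_density_pair)
  note integrable_s = constrained.integrable_selection[OF selected]
  have "s \<omega> \<in> density_values" for \<omega> using selected by (auto simp: constrained.selections_def)
  then have "fst (s \<omega>) \<in> effdom \<phi>2" for \<omega> by (metis density_valuesE fst_conv)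
  then have "phi_div \<phi>2 Q P0 = ennreal (\<integral>\<omega>. real_phi \<phi>2 (fst (s \<omega>)) \<partial>P0)"
    using integrable_s(2) by (simp add: phi_div_Q phi_eq_ennreal nn_integral_eq_integral)
  then have "Q \<in> feasible_s P0 \<phi>2 r"
    using Q_feasible cost_le by (simp add: feasible_s_def feasible_l_def ennreal_leI)
  have "ereal (\<integral>\<omega>. reward \<omega> (s \<omega>) \<partial>P0) = eexpect P0 (\<lambda>\<omega>. ereal (reward \<omega> (s \<omega>)))"
    using integrable_s(3) by (rule eexpect_ereal[symmetric])
  also have "\<dots> = primal_s \<phi>1 X Q Q'"
    unfolding primal_s_eq
    by (rule eexpect_cong_AE, rule AE_I2) (simp add: selection_density_pair(2)[OF selected mean])
  also have "\<dots> \<le> rho_s P0 \<phi>1 \<phi>2 r X"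
    unfolding rho_s_def by (rule SUP_upper2[OF \<open>Q \<in> feasible_s P0 \<phi>2 r\<close>], rule SUP_upper[OF Q'_feasible])
  finally show ?thesis .
qed

lemma dual_l_attained: "\<exists>\<theta>. dual_l P0 \<phi>1 \<phi>2 X \<theta> = rho_l P0 \<phi>1 \<phi>2 X"
proof -
  obtain \<theta> :: "real \<times> real" and lam where lam_nonneg: "0 \<le> lam" and multipliers:
    "eexpect P0 (\<lambda>\<omega>. SUP p\<in>density_values. ereal (reward \<omega> p - real_phi \<phi>2 (fst p) + \<theta> \<bullet> p - lam * 0))
      + ereal (lam * 1 - \<theta> \<bullet> (1, 1)) \<le> rho_l P0 \<phi>1 \<phi>2 X"
    using one_in_interior_density_values zero_less_one le_rho_l by (rule penalized.strong_duality)
  have "dual_l P0 \<phi>1 \<phi>2 X \<theta> \<le> dual_s_closed P0 \<phi>1 \<phi>2 0 X (\<theta>, 1) + ereal lam"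
    unfolding dual_l_eq_dual_s_closed using lam_nonneg by (intro ereal_le_add_self) simp
  also have "\<dots> \<le> rho_l P0 \<phi>1 \<phi>2 X"
    using multipliers SUP_reward_eq_beta_s_closed[of 1 _ \<theta>]
    by (cases "eexpect P0 (\<lambda>\<omega>. beta_s_closed \<phi>1 \<phi>2 X \<omega> (\<theta>, 1))") (simp_all add: dual_s_closed_eq algebra_simps)
  finally show ?thesis using rho_l_le_dual_l antisym by blast
qed

lemma dual_s_closed_attained:
  assumes "0 < r"
  shows "\<exists>\<theta> lam. 0 \<le> lam \<and> dual_s_closed P0 \<phi>1 \<phi>2 r X (\<theta>, lam) = rho_s P0 \<phi>1 \<phi>2 r X"
proof -
  have "real_phi \<phi>2 (fst (1, 1)) < r" using assms by simp
  with one_in_interior_density_values obtain \<theta> :: "real \<times> real" and lam where lam_nonneg: "0 \<le> lam" and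
    "eexpect P0 (\<lambda>\<omega>. SUP p\<in>density_values. ereal (reward \<omega> p + \<theta> \<bullet> p - lam * real_phi \<phi>2 (fst p)))
      + ereal (lam * r - \<theta> \<bullet> (1, 1)) \<le> rho_s P0 \<phi>1 \<phi>2 r X"
    using le_rho_s by (rule constrained.strong_duality)
  then have "dual_s_closed P0 \<phi>1 \<phi>2 r X (\<theta>, lam) \<le> rho_s P0 \<phi>1 \<phi>2 r X"
    using SUP_reward_eq_beta_s_closed[OF lam_nonneg] by (simp add: dual_s_closed_eq)
  then show ?thesis using rho_s_le_dual_s_closed[OF assms lam_nonneg] lam_nonneg antisym by blast
qed

subsection \<open>Dual solutions\<close>

lemma dual_l_INF: "rho_l P0 \<phi>1 \<phi>2 X = (INF \<theta>. dual_l P0 \<phi>1 \<phi>2 X \<theta>)"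
proof (rule antisym)
  show "rho_l P0 \<phi>1 \<phi>2 X \<le> (INF \<theta>. dual_l P0 \<phi>1 \<phi>2 X \<theta>)" by (intro INF_greatest rho_l_le_dual_l)
  show "(INF \<theta>. dual_l P0 \<phi>1 \<phi>2 X \<theta>) \<le> rho_l P0 \<phi>1 \<phi>2 X" using dual_l_attained by (metis INF_lower UNIV_I)
qed

text \<open>At \<open>lam = 0\<close> the function \<open>dual_s\<close> may exceed \<open>dual_s_closed\<close>. Since \<open>\<phi>2 \<ge> 0\<close>, its values
  at \<open>(\<theta>, l)\<close> with small \<open>l > 0\<close> exceed \<open>dual_s_closed\<close> at \<open>(\<theta>, 0)\<close> by at most \<open>l r\<close>.\<close>

lemma INF_dual_s_le_dual_s_closed:
  assumes r_pos: "0 < r" and lam_nonneg: "0 \<le> lam"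
  shows "(INF (\<theta>, lam) \<in> UNIV \<times> {0..}. dual_s P0 \<phi>1 \<phi>2 r X (\<theta>, lam)) \<le> dual_s_closed P0 \<phi>1 \<phi>2 r X (\<theta>, lam)"
    (is "?I \<le> _")
proof -
  have INF_le: "?I \<le> dual_s P0 \<phi>1 \<phi>2 r X (\<theta>, l)" if "0 \<le> l" for l
    by (rule INF_lower2[of "(\<theta>, l)"]) (use that in auto)
  show ?thesis
  proof (cases "lam = 0")
    case False
    then show ?thesis using INF_le[OF lam_nonneg] by (simp add: dual_s_eq_dual_s_closed)
  next
    case True
    show ?thesis
    proof (rule ereal_le_epsilon2)
      fix e :: real assume e_pos: "0 < e"
      have "?I \<le> dual_s P0 \<phi>1 \<phi>2 r X (\<theta>, e / r)" using e_pos r_pos by (intro INF_le) simp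
      also have "\<dots> = dual_s_closed P0 \<phi>1 \<phi>2 0 X (\<theta>, e / r) + ereal e"
        using e_pos r_pos by (simp add: dual_s_eq_dual_s_closed dual_s_closed_eq_add[of r])
      also have "\<dots> \<le> dual_s_closed P0 \<phi>1 \<phi>2 0 X (\<theta>, 0) + ereal e"
        using e_pos r_pos by (intro add_right_mono dual_s_closed_antimono) simp
      also have "\<dots> = dual_s_closed P0 \<phi>1 \<phi>2 r X (\<theta>, lam) + ereal e"
        by (simp add: True dual_s_closed_eq_add[of r] flip: zero_ereal_def)
      finally show "?I \<le> dual_s_closed P0 \<phi>1 \<phi>2 r X (\<theta>, lam) + ereal e" .
    qed
  qed
qed

lemma dual_s_INF:
  assumes r_pos: "0 < r"
  shows "rho_s P0 \<phi>1 \<phi>2 r X = (INF (\<theta>, lam) \<in> UNIV \<times> {0..}. dual_s P0 \<phi>1 \<phi>2 r X (\<theta>, lam))"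
proof (rule antisym)
  have "rho_s P0 \<phi>1 \<phi>2 r X \<le> dual_s P0 \<phi>1 \<phi>2 r X (\<theta>, lam)" if "0 \<le> lam" for \<theta> lam
    using rho_s_le_dual_s_closed[OF r_pos that] dual_s_closed_le_dual_s by (rule order_trans)
  then show "rho_s P0 \<phi>1 \<phi>2 r X \<le> (INF (\<theta>, lam) \<in> UNIV \<times> {0..}. dual_s P0 \<phi>1 \<phi>2 r X (\<theta>, lam))"
    by (intro INF_greatest) auto
  show "(INF (\<theta>, lam) \<in> UNIV \<times> {0..}. dual_s P0 \<phi>1 \<phi>2 r X (\<theta>, lam)) \<le> rho_s P0 \<phi>1 \<phi>2 r X"
    using dual_s_closed_attained[OF r_pos] INF_dual_s_le_dual_s_closed[OF r_pos] by metis
qed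

lemma dual_l_arg_min: "\<exists>\<theta>. is_arg_min (dual_l P0 \<phi>1 \<phi>2 X) (\<lambda>_. True) \<theta>"
  using dual_l_attained rho_l_le_dual_l by (metis is_arg_min_def not_less)

lemma dual_s_closed_arg_min:
  assumes "0 < r"
  shows "\<exists>\<theta> lam. is_arg_min (dual_s_closed P0 \<phi>1 \<phi>2 r X) (\<lambda>(\<theta>, lam). 0 \<le> lam) (\<theta>, lam)
    \<and> dual_s_closed P0 \<phi>1 \<phi>2 r X (\<theta>, lam) = rho_s P0 \<phi>1 \<phi>2 r X"
proof -
  obtain \<theta> lam where attained: "0 \<le> lam" "dual_s_closed P0 \<phi>1 \<phi>2 r X (\<theta>, lam) = rho_s P0 \<phi>1 \<phi>2 r X"
    using dual_s_closed_attained[OF assms] by blast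
  then have "is_arg_min (dual_s_closed P0 \<phi>1 \<phi>2 r X) (\<lambda>(\<theta>, lam). 0 \<le> lam) (\<theta>, lam)"
    using rho_s_le_dual_s_closed[OF assms] by (auto simp: is_arg_min_def not_less)
  with attained show ?thesis by blast
qed

lemma dual_s_arg_min:
  assumes "0 < r" and "{0<..} \<subseteq> effdom \<phi>2"
  shows "\<exists>\<theta> lam. is_arg_min (dual_s P0 \<phi>1 \<phi>2 r X) (\<lambda>(\<theta>, lam). 0 \<le> lam) (\<theta>, lam)"
proof -
  have "dual_s P0 \<phi>1 \<phi>2 r X = dual_s_closed P0 \<phi>1 \<phi>2 r X"
    using assms(2) dual_s_eq_dual_s_closed by auto
  then show ?thesis using dual_s_closed_arg_min[OF assms(1)] by auto
qed

lemma lagrangian_eq_inner: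
  "lagrangian x \<omega> p = - fst p * (X \<omega> * snd p + real_phi \<phi>1 (snd p))
    + ((fst p, fst p * snd p), - real_phi \<phi>2 (fst p)) \<bullet> x"
  by (simp add: lagrangian_def case_prod_beta inner_prod_def algebra_simps)

end

section \<open>Optimal densities\<close>

locale smooth_oce = oce P0 \<phi>1 \<phi>2 X + d1: smooth_divergence_function \<phi>1 + d2: smooth_divergence_function \<phi>2
  for P0 :: "'a measure" and \<phi>1 \<phi>2 X
begin

definition real_beta :: "'a \<Rightarrow> (real \<times> real) \<times> real \<Rightarrow> real" where
  "real_beta \<omega> x = snd x
    * real_conjugate \<phi>2 ((real_conjugate \<phi>1 (snd (fst x) - X \<omega>) + fst (fst x)) / snd x)"

definition opt_z :: "(real \<times> real) \<times> real \<Rightarrow> 'a \<Rightarrow> real" where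
  "opt_z x \<omega> = deriv (real_conjugate \<phi>2) ((real_conjugate \<phi>1 (snd (fst x) - X \<omega>) + fst (fst x)) / snd x)"

definition opt_y :: "(real \<times> real) \<times> real \<Rightarrow> 'a \<Rightarrow> real" where
  "opt_y x \<omega> = deriv (real_conjugate \<phi>1) (snd (fst x) - X \<omega>)"

definition beta_gradient :: "(real \<times> real) \<times> real \<Rightarrow> 'a \<Rightarrow> (real \<times> real) \<times> real" where
  "beta_gradient x \<omega> = ((opt_z x \<omega>, opt_z x \<omega> * opt_y x \<omega>), - real_phi \<phi>2 (opt_z x \<omega>))"

lemma measurable_real_beta [measurable]: "(\<lambda>\<omega>. real_beta \<omega> x) \<in> borel_measurable P0"
  unfolding real_beta_def using d1.measurable_real_conjugate d2.measurable_real_conjugate by measurable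

lemma measurable_opt_z [measurable]: "opt_z x \<in> borel_measurable P0"
  unfolding opt_z_def using d1.measurable_real_conjugate d2.measurable_deriv_real_conjugate by measurable

lemma measurable_opt_y [measurable]: "opt_y x \<in> borel_measurable P0"
  unfolding opt_y_def using d1.measurable_deriv_real_conjugate by measurable

lemma opt_z_in_effdom: "opt_z x \<omega> \<in> effdom \<phi>2" and opt_y_in_effdom: "opt_y x \<omega> \<in> effdom \<phi>1"
  by (simp_all add: opt_z_def opt_y_def d1.deriv_conjugate_in_effdom d2.deriv_conjugate_in_effdom)

lemma opt_z_nonneg: "0 \<le> opt_z x \<omega>" and opt_y_nonneg: "0 \<le> opt_y x \<omega>"
  using opt_z_in_effdom d2.effdom_nonneg opt_y_in_effdom d1.effdom_nonneg by blast+

lemma beta_s_eq_real_beta: "0 < snd x \<Longrightarrow> beta_s \<phi>1 \<phi>2 X \<omega> x = ereal (real_beta \<omega> x)"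
  by (cases x) (auto simp: beta_s_def conjugate_persp_def conjugate_ext_def d1.conjugate_eq_ereal
      d2.conjugate_eq_ereal real_beta_def)

lemma beta_s_closed_eq_real_beta: "0 < snd x \<Longrightarrow> beta_s_closed \<phi>1 \<phi>2 X \<omega> x = ereal (real_beta \<omega> x)"
  using beta_s_eq_real_beta[of x] beta_s_eq_beta_s_closed[of "snd x" _ "fst x"] by simp

lemma beta_l_eq_real_beta: "beta_l \<phi>1 \<phi>2 X \<omega> \<theta> = ereal (real_beta \<omega> (\<theta>, 1))"
  by (simp add: beta_l_eq_beta_s_closed beta_s_closed_eq_real_beta)

lemma real_beta_eq_lagrangian:
  assumes "0 < snd x"
  shows "real_beta \<omega> x = lagrangian x \<omega> (opt_z x \<omega>, opt_y x \<omega>)"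
proof -
  define u where "u = real_conjugate \<phi>1 (snd (fst x) - X \<omega>) + fst (fst x)"
  have "real_beta \<omega> x = snd x * (u / snd x * opt_z x \<omega> - real_phi \<phi>2 (opt_z x \<omega>))"
    using d2.Fenchel_Young_deriv[of "u / snd x"] by (simp add: real_beta_def opt_z_def u_def)
  also have "\<dots> = opt_z x \<omega> * u - snd x * real_phi \<phi>2 (opt_z x \<omega>)"
    using assms by (simp add: right_diff_distrib)
  also have "u = fst (fst x) + (snd (fst x) - X \<omega>) * opt_y x \<omega> - real_phi \<phi>1 (opt_y x \<omega>)"
    using d1.Fenchel_Young_deriv[of "snd (fst x) - X \<omega>"] by (simp add: u_def opt_y_def)
  finally show ?thesis by (simp add: lagrangian_def case_prod_beta)
qed

lemma real_beta_has_derivative: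
  assumes "0 < snd x"
  shows "(real_beta \<omega> has_derivative (\<lambda>v. beta_gradient x \<omega> \<bullet> v)) (at x)"
proof -
  define a where "a x = real_conjugate \<phi>1 (snd (fst x) - X \<omega>) + fst (fst x)" for x :: "(real \<times> real) \<times> real"
  have a_has_derivative: "(a has_derivative (\<lambda>v. opt_y x \<omega> * snd (fst v) + fst (fst v))) (at x)"
    unfolding a_def[abs_def] opt_y_def
    by (auto intro!: derivative_eq_intros DERIV_compose_FDERIV[OF d1.real_conjugate_has_real_derivative])
  have "((\<lambda>x. snd x * real_conjugate \<phi>2 (a x / snd x)) has_derivative
      (\<lambda>v. snd x * (((opt_y x \<omega> * snd (fst v) + fst (fst v)) * snd x - a x * snd v) / (snd x * snd x) * opt_z x \<omega>)
        + snd v * real_conjugate \<phi>2 (a x / snd x))) (at x)"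
    using assms unfolding opt_z_def a_def[symmetric]
    by (auto intro!: derivative_eq_intros a_has_derivative
        DERIV_compose_FDERIV[OF d2.real_conjugate_has_real_derivative])
  also have "(\<lambda>x. snd x * real_conjugate \<phi>2 (a x / snd x)) = real_beta \<omega>"
    by (simp add: real_beta_def[abs_def] a_def)
  also have "real_conjugate \<phi>2 (a x / snd x) = a x / snd x * opt_z x \<omega> - real_phi \<phi>2 (opt_z x \<omega>)"
    unfolding opt_z_def a_def by (rule d2.Fenchel_Young_deriv)
  finally show ?thesis
  proof (rule has_derivative_eq_rhs, intro ext)
    fix v :: "(real \<times> real) \<times> real"
    show "snd x * (((opt_y x \<omega> * snd (fst v) + fst (fst v)) * snd x - a x * snd v) / (snd x * snd x) * opt_z x \<omega>)
        + snd v * (a x / snd x * opt_z x \<omega> - real_phi \<phi>2 (opt_z x \<omega>)) = beta_gradient x \<omega> \<bullet> v"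
      using assms by (simp add: beta_gradient_def inner_prod_def field_simps)
  qed
qed

lemma real_beta_has_real_derivative:
  assumes "0 < lam"
  shows "((\<lambda>t. real_beta \<omega> ((t, \<theta>2), lam)) has_real_derivative opt_z ((\<theta>1, \<theta>2), lam) \<omega>) (at \<theta>1)"
    and "((\<lambda>t. real_beta \<omega> ((\<theta>1, t), lam)) has_real_derivative
      opt_z ((\<theta>1, \<theta>2), lam) \<omega> * opt_y ((\<theta>1, \<theta>2), lam) \<omega>) (at \<theta>2)"
proof -
  have beta_has_derivative: "(real_beta \<omega> has_derivative (\<lambda>v. beta_gradient ((\<theta>1, \<theta>2), lam) \<omega> \<bullet> v))
        (at ((\<theta>1, \<theta>2), lam))"
    using assms by (intro real_beta_has_derivative) simp
  have "((\<lambda>t. ((t, \<theta>2), lam)) has_derivative (\<lambda>t. ((t, 0), 0))) (at \<theta>1)"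
    and "((\<lambda>t. ((\<theta>1, t), lam)) has_derivative (\<lambda>t. ((0, t), 0))) (at \<theta>2)"
    by (auto intro!: derivative_eq_intros)
  from this[THEN has_derivative_compose, OF beta_has_derivative]
  show "((\<lambda>t. real_beta \<omega> ((t, \<theta>2), lam)) has_real_derivative opt_z ((\<theta>1, \<theta>2), lam) \<omega>) (at \<theta>1)"
    and "((\<lambda>t. real_beta \<omega> ((\<theta>1, t), lam)) has_real_derivative
      opt_z ((\<theta>1, \<theta>2), lam) \<omega> * opt_y ((\<theta>1, \<theta>2), lam) \<omega>) (at \<theta>2)"
    by (simp_all add: has_field_derivative_def beta_gradient_def mult_commute_abs)
qed

lemma convex_on_real_beta:
  assumes "convex S" "S \<subseteq> {x. 0 < snd x}"
  shows "convex_on S (real_beta \<omega>)"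
proof (rule convex_on_SUP_affine[OF assms(1)])
  fix x assume "x \<in> S"
  then have "0 < snd x" using assms(2) by auto
  then have "ereal (real_beta \<omega> x) = beta_s_closed \<phi>1 \<phi>2 X \<omega> (fst x, snd x)"
    by (simp add: beta_s_closed_eq_real_beta)
  also have "\<dots> = (SUP p\<in>effdom \<phi>2 \<times> effdom \<phi>1. ereal (lagrangian x \<omega> p))"
    using \<open>0 < snd x\<close> by (subst beta_s_closed_eq_SUP_lagrangian) auto
  finally show "ereal (real_beta \<omega> x) = (SUP p\<in>effdom \<phi>2 \<times> effdom \<phi>1.
      ereal (- fst p * (X \<omega> * snd p + real_phi \<phi>1 (snd p))
        + ((fst p, fst p * snd p), - real_phi \<phi>2 (fst p)) \<bullet> x))"
    unfolding lagrangian_eq_inner .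
qed

lemma integrable_real_beta:
  assumes "0 < snd x" "eexpect P0 (\<lambda>\<omega>. beta_s \<phi>1 \<phi>2 X \<omega> x) < \<infinity>"
  shows "integrable P0 (\<lambda>\<omega>. real_beta \<omega> x)"
proof (rule integrable_of_eexpect_finite)
  show "\<bar>eexpect P0 (\<lambda>\<omega>. ereal (real_beta \<omega> x))\<bar> \<noteq> \<infinity>"
    using assms eexpect_beta_s_closed_not_MInf[of "snd x" "fst x"]
    by (auto simp: beta_s_eq_real_beta beta_s_closed_eq_real_beta)
qed measurable

lemma dual_s_eq_integral:
  assumes "0 < snd x" "integrable P0 (\<lambda>\<omega>. real_beta \<omega> x)"
  shows "dual_s P0 \<phi>1 \<phi>2 r X x = ereal ((\<integral>\<omega>. real_beta \<omega> x \<partial>P0) - ((1, 1), - r) \<bullet> x)"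
  using assms by (cases x) (auto simp: dual_s_def beta_s_eq_real_beta eexpect_ereal algebra_simps)

lemma dual_l_eq_integral:
  assumes "integrable P0 (\<lambda>\<omega>. real_beta \<omega> (\<theta>, 1))"
  shows "dual_l P0 \<phi>1 \<phi>2 X \<theta> = ereal ((\<integral>\<omega>. real_beta \<omega> (\<theta>, 1) \<partial>P0) - (1, 1) \<bullet> \<theta>)"
  using assms by (cases \<theta>) (auto simp: dual_l_def beta_l_eq_real_beta eexpect_ereal algebra_simps)

lemma opt_density_pairI:
  assumes "\<And>v. integrable P0 (\<lambda>\<omega>. (opt_z x \<omega>, opt_z x \<omega> * opt_y x \<omega>) \<bullet> v)"
    and "\<And>v. (\<integral>\<omega>. (opt_z x \<omega>, opt_z x \<omega> * opt_y x \<omega>) \<bullet> v \<partial>P0) = (1, 1) \<bullet> v"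
  shows "density_pair P0 \<phi>1 \<phi>2 X (opt_z x) (opt_y x)"
  using assms[of "(1, 0)"] assms[of "(0, 1)"] by unfold_locales (auto simp: opt_z_nonneg opt_y_nonneg)

lemma eexpect_payoff_opt:
  assumes lam_pos: "0 < snd x" and integrable_beta: "integrable P0 (\<lambda>\<omega>. real_beta \<omega> x)"
    and "density_pair P0 \<phi>1 \<phi>2 X (opt_z x) (opt_y x)"
  shows "eexpect P0 (payoff (snd x) (opt_z x) (opt_y x)) = ereal ((\<integral>\<omega>. real_beta \<omega> x \<partial>P0) - (1, 1) \<bullet> fst x)"
proof -
  interpret density_pair P0 \<phi>1 \<phi>2 X "opt_z x" "opt_y x" by fact
  have "payoff (snd x) (opt_z x) (opt_y x) \<omega>
      = ereal (real_beta \<omega> x - (fst (fst x) * opt_z x \<omega> + snd (fst x) * (opt_z x \<omega> * opt_y x \<omega>)))" for \<omega>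
    unfolding real_beta_eq_lagrangian[OF lam_pos] using lam_pos opt_z_nonneg opt_z_in_effdom opt_y_in_effdom
    by (subst payoff_eq_ereal) (auto simp: lagrangian_def case_prod_beta algebra_simps)
  then have "eexpect P0 (payoff (snd x) (opt_z x) (opt_y x))
      = eexpect P0 (\<lambda>\<omega>. ereal (real_beta \<omega> x - (fst (fst x) * opt_z x \<omega> + snd (fst x) * (opt_z x \<omega> * opt_y x \<omega>))))"
    by (intro eexpect_cong_AE) simp
  then show ?thesis
    using integrable_beta integrable_z integral_z integrable_zy integral_zy
    by (simp add: eexpect_ereal inner_prod_def)
qed

text \<open>The first order conditions of the dual problems say that the partial derivatives are densities and,
  in \<open>(P_s)\<close>, that the divergence constraint is binding.\<close>

lemma stationary_l:
  assumes minimizer: "is_arg_min (dual_l P0 \<phi>1 \<phi>2 X) (\<lambda>_. True) \<theta>"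
    and interior: "\<theta> \<in> interior (finite_l P0 \<phi>1 \<phi>2 X)"
  shows "integrable P0 (\<lambda>\<omega>. real_beta \<omega> (\<theta>, 1))"
    and "density_pair P0 \<phi>1 \<phi>2 X (opt_z (\<theta>, 1)) (opt_y (\<theta>, 1))"
proof -
  obtain e where e_ball: "0 < e" "ball \<theta> e \<subseteq> finite_l P0 \<phi>1 \<phi>2 X" using interior by (auto simp: mem_interior)
  have integrable_beta: "integrable P0 (\<lambda>\<omega>. real_beta \<omega> (\<theta>', 1))" if "\<theta>' \<in> ball \<theta> e" for \<theta>'
  proof (rule integrable_real_beta)
    have "beta_s \<phi>1 \<phi>2 X \<omega> (\<theta>', 1) = beta_l \<phi>1 \<phi>2 X \<omega> \<theta>'" for \<omega>
      by (simp add: beta_l_eq_real_beta beta_s_eq_real_beta)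
    then show "eexpect P0 (\<lambda>\<omega>. beta_s \<phi>1 \<phi>2 X \<omega> (\<theta>', 1)) < \<infinity>" using that e_ball(2) by (auto simp: finite_l_def)
  qed simp
  show "integrable P0 (\<lambda>\<omega>. real_beta \<omega> (\<theta>, 1))" using integrable_beta e_ball(1) by simp
  have convex_beta: "convex_on (ball \<theta> e) (\<lambda>\<theta>. real_beta \<omega> (\<theta>, 1))" for \<omega>
  proof -
    have "convex_on (ball \<theta> e \<times> {1}) (real_beta \<omega>)" by (rule convex_on_real_beta) (auto intro!: convex_Times)
    then show ?thesis by (auto simp: convex_on_def)
  qed
  have gradient_beta: "((\<lambda>\<theta>. real_beta \<omega> (\<theta>, 1)) has_derivative
      (\<lambda>v. (opt_z (\<theta>, 1) \<omega>, opt_z (\<theta>, 1) \<omega> * opt_y (\<theta>, 1) \<omega>) \<bullet> v)) (at \<theta>)" for \<omega>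
  proof -
    have "((\<lambda>\<theta>. (\<theta>, 1)) has_derivative (\<lambda>v. (v, 0))) (at \<theta>)" by (auto intro!: derivative_eq_intros)
    from has_derivative_compose[OF this real_beta_has_derivative[of "(\<theta>, 1)" \<omega>]]
    show ?thesis by (simp add: beta_gradient_def)
  qed
  have minimal: "(\<integral>\<omega>. real_beta \<omega> (\<theta>, 1) \<partial>P0) - (1, 1) \<bullet> \<theta> \<le> (\<integral>\<omega>. real_beta \<omega> (\<theta>', 1) \<partial>P0) - (1, 1) \<bullet> \<theta>'"
    if "\<theta>' \<in> ball \<theta> e" for \<theta>'
  proof -
    have "dual_l P0 \<phi>1 \<phi>2 X \<theta> \<le> dual_l P0 \<phi>1 \<phi>2 X \<theta>'" using minimizer unfolding is_arg_min_linorder by blast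
    then show ?thesis using integrable_beta[OF that] integrable_beta[of \<theta>] e_ball(1)
      by (simp add: dual_l_eq_integral)
  qed
  have "\<theta> \<in> ball \<theta> e" using e_ball(1) by simp
  from integral_gradient_convex_minimizer[where F = "\<lambda>\<omega> \<theta>. real_beta \<omega> (\<theta>, 1)",
      OF open_ball this integrable_beta convex_beta gradient_beta minimal]
  show "density_pair P0 \<phi>1 \<phi>2 X (opt_z (\<theta>, 1)) (opt_y (\<theta>, 1))" by (rule opt_density_pairI)
qed

lemma interior_finite_s_pos:
  assumes "x \<in> interior (finite_s P0 \<phi>1 \<phi>2 X)"
  shows "0 < snd x"
proof -
  have "interior (finite_s P0 \<phi>1 \<phi>2 X) \<subseteq> interior (UNIV \<times> {0..})"
    by (rule interior_mono) (auto simp: finite_s_def)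
  then show ?thesis using assms by (auto simp: interior_Times)
qed

lemma stationary_s:
  assumes minimizer: "is_arg_min (dual_s P0 \<phi>1 \<phi>2 r X) (\<lambda>(\<theta>, lam). 0 \<le> lam) x"
    and interior: "x \<in> interior (finite_s P0 \<phi>1 \<phi>2 X)"
  shows "integrable P0 (\<lambda>\<omega>. real_beta \<omega> x)"
    and "density_pair P0 \<phi>1 \<phi>2 X (opt_z x) (opt_y x)"
    and "integrable P0 (\<lambda>\<omega>. real_phi \<phi>2 (opt_z x \<omega>))" "(\<integral>\<omega>. real_phi \<phi>2 (opt_z x \<omega>) \<partial>P0) = r"
proof -
  obtain e where e_ball: "0 < e" "ball x e \<subseteq> interior (finite_s P0 \<phi>1 \<phi>2 X)"
    using interior open_contains_ball[of "interior (finite_s P0 \<phi>1 \<phi>2 X)"] by auto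
  then have lam_pos: "0 < snd x'" if "x' \<in> ball x e" for x' using that by (auto intro: interior_finite_s_pos)
  have integrable_beta: "integrable P0 (\<lambda>\<omega>. real_beta \<omega> x')" if "x' \<in> ball x e" for x'
  proof (rule integrable_real_beta[OF lam_pos[OF that]])
    have "x' \<in> finite_s P0 \<phi>1 \<phi>2 X" using that e_ball(2) interior_subset by blast
    then show "eexpect P0 (\<lambda>\<omega>. beta_s \<phi>1 \<phi>2 X \<omega> x') < \<infinity>" by (auto simp: finite_s_def)
  qed
  have x_in_ball: "x \<in> ball x e" using e_ball(1) by simp
  show "integrable P0 (\<lambda>\<omega>. real_beta \<omega> x)" by (rule integrable_beta[OF x_in_ball])
  have "(\<integral>\<omega>. real_beta \<omega> x \<partial>P0) - ((1, 1), - r) \<bullet> x \<le> (\<integral>\<omega>. real_beta \<omega> x' \<partial>P0) - ((1, 1), - r) \<bullet> x'"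
    if "x' \<in> ball x e" for x'
  proof -
    have "dual_s P0 \<phi>1 \<phi>2 r X x \<le> dual_s P0 \<phi>1 \<phi>2 r X x'"
      using minimizer lam_pos[OF that] unfolding is_arg_min_linorder case_prod_beta by (meson less_imp_le)
    then show ?thesis
      using dual_s_eq_integral[OF lam_pos[OF x_in_ball] integrable_beta[OF x_in_ball]]
        dual_s_eq_integral[OF lam_pos[OF that] integrable_beta[OF that]] by simp
  qed
  then have gradient: "integrable P0 (\<lambda>\<omega>. beta_gradient x \<omega> \<bullet> v)"
    "(\<integral>\<omega>. beta_gradient x \<omega> \<bullet> v \<partial>P0) = ((1, 1), - r) \<bullet> v" for v
    using integrable_beta lam_pos x_in_ball
    by (intro integral_gradient_convex_minimizer[of "ball x e" x P0 real_beta] convex_on_real_beta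
        real_beta_has_derivative; auto)+
  show "density_pair P0 \<phi>1 \<phi>2 X (opt_z x) (opt_y x)"
    using gradient[of "(v, 0)" for v] by (intro opt_density_pairI) (simp_all add: beta_gradient_def)
  show "integrable P0 (\<lambda>\<omega>. real_phi \<phi>2 (opt_z x \<omega>))" "(\<integral>\<omega>. real_phi \<phi>2 (opt_z x \<omega>) \<partial>P0) = r"
    using gradient[of "(0, 1)"] by (simp_all add: beta_gradient_def)
qed

lemma is_density_opt:
  "is_density P0 (density P0 (\<lambda>\<omega>. ennreal (opt_z x \<omega>))) (opt_z x)"
  "is_density P0 (density P0 (\<lambda>\<omega>. ennreal (opt_z x \<omega> * opt_y x \<omega>))) (\<lambda>\<omega>. opt_z x \<omega> * opt_y x \<omega>)"
  by (auto simp: is_density_def opt_z_nonneg opt_y_nonneg)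

lemma optimal_densities_l:
  assumes minimizer: "is_arg_min (dual_l P0 \<phi>1 \<phi>2 X) (\<lambda>_. True) (\<theta>1, \<theta>2)"
    and interior: "(\<theta>1, \<theta>2) \<in> interior (finite_l P0 \<phi>1 \<phi>2 X)"
  shows "\<exists>z z' Q Q'.
     (\<forall>\<omega>\<in>space P0.
        ((\<lambda>t. real_of_ereal (beta_l \<phi>1 \<phi>2 X \<omega> (t, \<theta>2))) has_real_derivative z \<omega>) (at \<theta>1)
      \<and> ((\<lambda>t. real_of_ereal (beta_l \<phi>1 \<phi>2 X \<omega> (\<theta>1, t))) has_real_derivative z' \<omega>) (at \<theta>2))
     \<and> is_density P0 Q z \<and> is_density P0 Q' z'
     \<and> is_arg_max (\<lambda>(Q, Q'). primal_l P0 \<phi>1 \<phi>2 X Q Q')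
         (\<lambda>(Q, Q'). Q \<in> feasible_l P0 \<and> Q' \<in> feasible_l Q) (Q, Q')"
proof -
  define x where "x = ((\<theta>1, \<theta>2), 1 :: real)"
  note stationary = stationary_l[OF minimizer interior, folded x_def]
  interpret density_pair P0 \<phi>1 \<phi>2 X "opt_z x" "opt_y x" by (rule stationary(2))
  have "primal_l P0 \<phi>1 \<phi>2 X Q Q' = dual_l P0 \<phi>1 \<phi>2 X (\<theta>1, \<theta>2)"
    unfolding primal_l_eq using eexpect_payoff_opt[OF _ stationary] stationary(1)
    by (simp add: dual_l_eq_integral x_def)
  then have "is_arg_max (\<lambda>(Q, Q'). primal_l P0 \<phi>1 \<phi>2 X Q Q')
      (\<lambda>(Q, Q'). Q \<in> feasible_l P0 \<and> Q' \<in> feasible_l Q) (Q, Q')"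
    using Q_feasible Q'_feasible weak_duality_l by (auto simp: is_arg_max_def not_less)
  moreover have "\<forall>\<omega>\<in>space P0.
      ((\<lambda>t. real_of_ereal (beta_l \<phi>1 \<phi>2 X \<omega> (t, \<theta>2))) has_real_derivative opt_z x \<omega>) (at \<theta>1)
    \<and> ((\<lambda>t. real_of_ereal (beta_l \<phi>1 \<phi>2 X \<omega> (\<theta>1, t))) has_real_derivative opt_z x \<omega> * opt_y x \<omega>) (at \<theta>2)"
    by (simp add: beta_l_eq_real_beta real_beta_has_real_derivative x_def)
  ultimately show ?thesis
    by (intro exI[of _ "opt_z x"] exI[of _ "\<lambda>\<omega>. opt_z x \<omega> * opt_y x \<omega>"]
        exI[of _ Q] exI[of _ Q'] conjI is_density_opt)
qed

lemma optimal_densities_s: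
  assumes r_pos: "0 < r"
    and minimizer: "is_arg_min (dual_s P0 \<phi>1 \<phi>2 r X) (\<lambda>(\<theta>, lam). 0 \<le> lam) ((\<theta>1, \<theta>2), lam)"
    and interior: "((\<theta>1, \<theta>2), lam) \<in> interior (finite_s P0 \<phi>1 \<phi>2 X)"
  shows "\<exists>z z' Q Q'.
     (\<forall>\<omega>\<in>space P0.
        ((\<lambda>t. real_of_ereal (beta_s \<phi>1 \<phi>2 X \<omega> ((t, \<theta>2), lam))) has_real_derivative z \<omega>) (at \<theta>1)
      \<and> ((\<lambda>t. real_of_ereal (beta_s \<phi>1 \<phi>2 X \<omega> ((\<theta>1, t), lam))) has_real_derivative z' \<omega>) (at \<theta>2))
     \<and> is_density P0 Q z \<and> is_density P0 Q' z'
     \<and> is_arg_max (\<lambda>(Q, Q'). primal_s \<phi>1 X Q Q')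
         (\<lambda>(Q, Q'). Q \<in> feasible_s P0 \<phi>2 r \<and> Q' \<in> feasible_l Q) (Q, Q')"
proof -
  define x where "x = ((\<theta>1, \<theta>2), lam)"
  note stationary = stationary_s[OF minimizer interior, folded x_def]
  have lam_pos: "0 < lam" using interior_finite_s_pos[OF interior] by simp
  interpret density_pair P0 \<phi>1 \<phi>2 X "opt_z x" "opt_y x" by (rule stationary(2))
  have divergence_eq: "phi_div \<phi>2 Q P0 = ennreal r"
    using stationary(3,4) by (simp add: phi_div_Q phi_eq_ennreal[OF opt_z_in_effdom] nn_integral_eq_integral)
  have "primal_s \<phi>1 X Q Q' = eexpect P0 (payoff lam (opt_z x) (opt_y x)) + ereal (lam * r)"
    unfolding primal_s_eq using r_pos divergence_eq lam_pos by (intro eexpect_payoff_0) auto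
  also have "\<dots> = dual_s P0 \<phi>1 \<phi>2 r X ((\<theta>1, \<theta>2), lam)"
    using eexpect_payoff_opt[OF _ stationary(1,2)] stationary(1) lam_pos
    by (simp add: dual_s_eq_integral x_def)
  finally have attained: "primal_s \<phi>1 X Q Q' = dual_s P0 \<phi>1 \<phi>2 r X ((\<theta>1, \<theta>2), lam)" .
  have "primal_s \<phi>1 X R R' \<le> primal_s \<phi>1 X Q Q'"
    if "R \<in> feasible_s P0 \<phi>2 r" "R' \<in> feasible_l R" for R R'
    using weak_duality_s[OF that _ r_pos] lam_pos by (simp add: attained dual_s_eq_dual_s_closed)
  moreover have "Q \<in> feasible_s P0 \<phi>2 r"
    using Q_feasible divergence_eq by (simp add: feasible_s_def feasible_l_def)
  ultimately have "is_arg_max (\<lambda>(Q, Q'). primal_s \<phi>1 X Q Q')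
      (\<lambda>(Q, Q'). Q \<in> feasible_s P0 \<phi>2 r \<and> Q' \<in> feasible_l Q) (Q, Q')"
    using Q'_feasible by (auto simp: is_arg_max_def not_less)
  moreover have "\<forall>\<omega>\<in>space P0.
      ((\<lambda>t. real_of_ereal (beta_s \<phi>1 \<phi>2 X \<omega> ((t, \<theta>2), lam))) has_real_derivative opt_z x \<omega>) (at \<theta>1)
    \<and> ((\<lambda>t. real_of_ereal (beta_s \<phi>1 \<phi>2 X \<omega> ((\<theta>1, t), lam))) has_real_derivative opt_z x \<omega> * opt_y x \<omega>) (at \<theta>2)"
    using lam_pos by (simp add: beta_s_eq_real_beta real_beta_has_real_derivative x_def)
  ultimately show ?thesis
    by (intro exI[of _ "opt_z x"] exI[of _ "\<lambda>\<omega>. opt_z x \<omega> * opt_y x \<omega>"]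
        exI[of _ Q] exI[of _ Q'] conjI is_density_opt)
qed

end

theorem theorem1:
  fixes P0 :: "'a measure" and X :: "'a \<Rightarrow> real"
    and \<phi>1 \<phi>2 :: "real \<Rightarrow> ennreal" and r :: real
  assumes "prob_space P0" and "integrable P0 X"
    and "\<phi>1 \<in> Phi0" and "lower_semicont \<phi>1"
    and "\<phi>2 \<in> Phi0" and "lower_semicont \<phi>2"
    and "r > 0"
  shows "rho_l P0 \<phi>1 \<phi>2 X = (INF \<theta>. dual_l P0 \<phi>1 \<phi>2 X \<theta>)
    \<and> rho_s P0 \<phi>1 \<phi>2 r X = (INF (\<theta>, lam) \<in> UNIV \<times> {0..}. dual_s P0 \<phi>1 \<phi>2 r X (\<theta>, lam))
    \<and> (conjugate_differentiable \<phi>1 \<and> conjugate_differentiable \<phi>2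
        \<and> interior (finite_l P0 \<phi>1 \<phi>2 X) \<noteq> {} \<and> interior (finite_s P0 \<phi>1 \<phi>2 X) \<noteq> {}
       \<longrightarrow>
        (\<exists>\<theta>. is_arg_min (dual_l P0 \<phi>1 \<phi>2 X) (\<lambda>_. True) \<theta>)
        \<and> (\<exists>\<theta> lam. is_arg_min (dual_s_closed P0 \<phi>1 \<phi>2 r X) (\<lambda>(\<theta>, lam). 0 \<le> lam) (\<theta>, lam)
              \<and> dual_s_closed P0 \<phi>1 \<phi>2 r X (\<theta>, lam) = rho_s P0 \<phi>1 \<phi>2 r X)
        \<and> ({0<..} \<subseteq> effdom \<phi>2 \<longrightarrow>
              (\<exists>\<theta> lam. is_arg_min (dual_s P0 \<phi>1 \<phi>2 r X) (\<lambda>(\<theta>, lam). 0 \<le> lam) (\<theta>, lam)))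
        \<and> (\<forall>\<theta>1 \<theta>2. is_arg_min (dual_l P0 \<phi>1 \<phi>2 X) (\<lambda>_. True) (\<theta>1, \<theta>2)
              \<and> (\<theta>1, \<theta>2) \<in> interior (finite_l P0 \<phi>1 \<phi>2 X) \<longrightarrow>
            (\<exists>z z' Q Q'.
               (\<forall>\<omega>\<in>space P0.
                  ((\<lambda>t. real_of_ereal (beta_l \<phi>1 \<phi>2 X \<omega> (t, \<theta>2))) has_real_derivative z \<omega>) (at \<theta>1)
                \<and> ((\<lambda>t. real_of_ereal (beta_l \<phi>1 \<phi>2 X \<omega> (\<theta>1, t))) has_real_derivative z' \<omega>) (at \<theta>2))
               \<and> is_density P0 Q z \<and> is_density P0 Q' z'
               \<and> is_arg_max (\<lambda>(Q, Q'). primal_l P0 \<phi>1 \<phi>2 X Q Q')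
                   (\<lambda>(Q, Q'). Q \<in> feasible_l P0 \<and> Q' \<in> feasible_l Q) (Q, Q')))
        \<and> (\<forall>\<theta>1 \<theta>2 lam. is_arg_min (dual_s P0 \<phi>1 \<phi>2 r X) (\<lambda>(\<theta>, lam). 0 \<le> lam) ((\<theta>1, \<theta>2), lam)
              \<and> ((\<theta>1, \<theta>2), lam) \<in> interior (finite_s P0 \<phi>1 \<phi>2 X) \<longrightarrow>
            (\<exists>z z' Q Q'.
               (\<forall>\<omega>\<in>space P0.
                  ((\<lambda>t. real_of_ereal (beta_s \<phi>1 \<phi>2 X \<omega> ((t, \<theta>2), lam))) has_real_derivative z \<omega>) (at \<theta>1)
                \<and> ((\<lambda>t. real_of_ereal (beta_s \<phi>1 \<phi>2 X \<omega> ((\<theta>1, t), lam))) has_real_derivative z' \<omega>) (at \<theta>2))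
               \<and> is_density P0 Q z \<and> is_density P0 Q' z'
               \<and> is_arg_max (\<lambda>(Q, Q'). primal_s \<phi>1 X Q Q')
                   (\<lambda>(Q, Q'). Q \<in> feasible_s P0 \<phi>2 r \<and> Q' \<in> feasible_l Q) (Q, Q'))))"
proof -
  interpret oce P0 \<phi>1 \<phi>2 X
    using assms by (intro oce.intro oce_axioms.intro divergence_function.intro)
  have smooth: "smooth_oce P0 \<phi>1 \<phi>2 X" if "conjugate_differentiable \<phi>1" "conjugate_differentiable \<phi>2"
    using that
    by (intro smooth_oce.intro smooth_divergence_function.intro smooth_divergence_function_axioms.intro
        oce_axioms d1.divergence_function_axioms d2.divergence_function_axioms)
  note duality = dual_l_INF dual_s_INF[OF assms(7)]
  note dual_solutions = dual_l_arg_min dual_s_closed_arg_min[OF assms(7)] dual_s_arg_min[OF assms(7)]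
  note primal_solutions = smooth_oce.optimal_densities_l[OF smooth]
    smooth_oce.optimal_densities_s[OF smooth assms(7)]
  show ?thesis
    by (intro conjI impI allI duality dual_solutions; (elim conjE)?; (rule primal_solutions)?; assumption)
qed

end
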